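(* For all integers $d,k,t\geq 1$ and $q\geq 2$, if $k(q-1)>t+d+q-1$, then there exists a measurable $k$-coloring of $\mathbb{R}^d$ such that no $d$-dimensional necklace has a fair $q$-splitting using at most $t$ axis-aligned hyperplane cuts. The set of such colorings is dense in the metric space $\mathcal{M}$ of measurable $k$-colorings of $\mathbb{R}^d$. For $d=1$ the same holds provided $k(q-1)>t+2$.
   Context: A measurable $k$-coloring of $\mathbb{R}^d$ is a map $f:\mathbb{R}^d\to\{1,\dots,k\}$ with each $f^{-1}(i)$ Lebesgue measurable. $\mathcal{M}$ is the space of measurable $k$-colorings of $\mathbb{R}^d$, where colorings that differ only on a set of measure zero are identified, with metric $d(f,g)=\sum_{n=1}^\infty 2^{-n}\,\mathcal{L}(\{x\in[-n,n]^d:f(x)\neq g(x)\})/(2n)^d$, where $\mathcal{L}$ is Lebesgue measure. Given a coloring of $\mathbb{R}^d$, a $d$-dimensional necklace is a nontrivial axis-aligned cube $[\alpha_1,\alpha_1+\alpha_0]\times\dots\times[\alpha_d,\alpha_d+\alpha_0]$, $\alpha_0>0$, with the induced coloring. An axis-aligned hyperplane is one of the form $\{x_i=\beta\}$. A fair $q$-splitting of a necklace using $t$ axis-aligned hyperplane cuts is a division of the necklace by $t$ axis-aligned hyperplanes into cuboids (pieces), together with a distribution of the pieces into $q$ parts such that each part captures exactly $1/q$ of the total measure of every color in the necklace. *)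

theory Defs
  imports "HOL-Analysis.Analysis"
begin

text \<open>
  The dimension $d$ is \<open>CARD('d)\<close> for a finite index type \<open>'d\<close>, and $\mathbb{R}^d$ is \<open>real ^ 'd\<close>.
\<close>

definition measurable_colorings :: "nat \<Rightarrow> (real ^ 'd::finite \<Rightarrow> nat) set" where
  "measurable_colorings k =
     {f. range f \<subseteq> {1..k} \<and> (\<forall>i\<in>{1..k}. f -` {i} \<in> sets lebesgue)}"

subsection \<open>The metric space of measurable colorings\<close>

definition coloring_equiv :: "nat \<Rightarrow> ((real ^ 'd::finite \<Rightarrow> nat) \<times> (real ^ 'd \<Rightarrow> nat)) set" where
  "coloring_equiv k =
     {(f, g). f \<in> measurable_colorings k \<and> g \<in> measurable_colorings k \<and>
              (AE x in lebesgue. f x = g x)}"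

definition coloring_space :: "nat \<Rightarrow> (real ^ 'd::finite \<Rightarrow> nat) set set" where
  "coloring_space k = measurable_colorings k // coloring_equiv k"

definition centered_cube :: "nat \<Rightarrow> (real ^ 'd::finite) set" where
  "centered_cube n = cbox (\<chi> i. - real n) (\<chi> i. real n)"

text \<open>The series starts at $n = 1$, hence the index shift by \<open>Suc\<close>.\<close>

definition coloring_dist :: "(real ^ 'd::finite \<Rightarrow> nat) \<Rightarrow> (real ^ 'd \<Rightarrow> nat) \<Rightarrow> real" where
  "coloring_dist f g =
     (\<Sum>n. (1/2) ^ Suc n * measure lebesgue {x \<in> centered_cube (Suc n). f x \<noteq> g x}
            / (2 * real (Suc n)) ^ CARD('d))"

text \<open>
  The distance of two classes is that of arbitrary representatives; see
  \<open>class_dist_class\<close> below for the independence of the choice.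
\<close>

definition class_dist ::
    "(real ^ 'd::finite \<Rightarrow> nat) set \<Rightarrow> (real ^ 'd \<Rightarrow> nat) set \<Rightarrow> real" where
  "class_dist F G = coloring_dist (SOME f. f \<in> F) (SOME g. g \<in> G)"

subsection \<open>Necklaces and fair splittings\<close>

definition necklace :: "(real ^ 'd::finite) set \<Rightarrow> bool" where
  "necklace N \<longleftrightarrow> (\<exists>a s. s > 0 \<and> N = cbox a (\<chi> i. a $ i + s))"

definition axis_hyperplane :: "(real ^ 'd::finite) set \<Rightarrow> bool" where
  "axis_hyperplane H \<longleftrightarrow> (\<exists>i \<beta>. H = {x. x $ i = \<beta>})"

text \<open>
  The pieces are the connected components left after removing the cutting hyperplanes. They are
  cuboids without those faces that lie on a cut; these faces are null sets.
\<close>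

definition pieces :: "(real ^ 'd::finite) set \<Rightarrow> (real ^ 'd) set set \<Rightarrow> (real ^ 'd) set set" where
  "pieces N \<H> = components (N - \<Union>\<H>)"

definition fair_distribution ::
    "nat \<Rightarrow> nat \<Rightarrow> (real ^ 'd::finite \<Rightarrow> nat) \<Rightarrow> (real ^ 'd) set \<Rightarrow> (real ^ 'd) set set
       \<Rightarrow> ((real ^ 'd) set \<Rightarrow> nat) \<Rightarrow> bool" where
  "fair_distribution k q f N \<H> p \<longleftrightarrow>
     (\<forall>P \<in> pieces N \<H>. p P \<in> {1..q}) \<and>
     (\<forall>j\<in>{1..q}. \<forall>c\<in>{1..k}.
        measure lebesgue (\<Union>{P \<in> pieces N \<H>. p P = j} \<inter> f -` {c})
          = measure lebesgue (N \<inter> f -` {c}) / real q)"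

definition has_fair_splitting ::
    "nat \<Rightarrow> nat \<Rightarrow> nat \<Rightarrow> (real ^ 'd::finite \<Rightarrow> nat) \<Rightarrow> (real ^ 'd) set \<Rightarrow> bool" where
  "has_fair_splitting k q t f N \<longleftrightarrow>
     (\<exists>\<H> p. finite \<H> \<and> card \<H> \<le> t \<and> (\<forall>H\<in>\<H>. axis_hyperplane H) \<and>
            fair_distribution k q f N \<H> p)"

definition unsplittable_colorings ::
    "nat \<Rightarrow> nat \<Rightarrow> nat \<Rightarrow> (real ^ 'd::finite \<Rightarrow> nat) set" where
  "unsplittable_colorings k q t =
     {f \<in> measurable_colorings k. \<forall>N. necklace N \<longrightarrow> \<not> has_fair_splitting k q t f N}"

subsection \<open>The metric axioms\<close>

lemma equiv_coloring_equiv: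
  "equiv (measurable_colorings k) (coloring_equiv k :: ((real ^ 'd::finite \<Rightarrow> nat) \<times> _) set)"
proof (rule equivI)
  show "coloring_equiv k \<subseteq> measurable_colorings k \<times> (measurable_colorings k :: (real ^ 'd \<Rightarrow> nat) set)"
    by (auto simp: coloring_equiv_def)
  show "refl_on (measurable_colorings k) (coloring_equiv k :: ((real ^ 'd::finite \<Rightarrow> nat) \<times> _) set)"
    by (auto simp: refl_on_def coloring_equiv_def)
  show "sym (coloring_equiv k :: ((real ^ 'd::finite \<Rightarrow> nat) \<times> _) set)"
    by (auto simp: sym_def coloring_equiv_def eq_commute)
  show "trans (coloring_equiv k :: ((real ^ 'd::finite \<Rightarrow> nat) \<times> _) set)"
  proof (rule transI)
    fix f g h :: "real ^ 'd \<Rightarrow> nat"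
    assume *: "(f, g) \<in> coloring_equiv k" "(g, h) \<in> coloring_equiv k"
    then have "AE x in lebesgue. f x = g x" "AE x in lebesgue. g x = h x"
      by (auto simp: coloring_equiv_def)
    then have "AE x in lebesgue. f x = h x" by eventually_elim simp
    with * show "(f, h) \<in> coloring_equiv k" by (auto simp: coloring_equiv_def)
  qed
qed

lemma diff_set_measurable:
  fixes f g :: "real ^ 'd::finite \<Rightarrow> nat"
  assumes "f \<in> measurable_colorings k" "g \<in> measurable_colorings k"
  shows "{x. f x \<noteq> g x} \<in> sets lebesgue"
proof -
  have "{x. f x \<noteq> g x} = (\<Union>i\<in>{1..k}. f -` {i} - g -` {i})"
    using assms by (fastforce simp: measurable_colorings_def)
  also have "\<dots> \<in> sets lebesgue"
    using assms by (intro sets.finite_UN sets.Diff) (auto simp: measurable_colorings_def)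
  finally show ?thesis .
qed

lemma measure_centered_cube:
  "measure lebesgue (centered_cube n :: (real ^ 'd::finite) set) = (2 * real n) ^ CARD('d)"
proof -
  have "(\<chi> i. - real n) \<in> (centered_cube n :: (real ^ 'd) set)"
    by (simp add: centered_cube_def mem_box_cart)
  then have "centered_cube n \<noteq> ({} :: (real ^ 'd) set)" by blast
  then show ?thesis
    unfolding centered_cube_def by (simp add: content_cbox_cart)
qed

lemma diff_cube_lmeasurable:
  fixes f g :: "real ^ 'd::finite \<Rightarrow> nat"
  assumes "f \<in> measurable_colorings k" "g \<in> measurable_colorings k"
  shows "{x \<in> centered_cube n. f x \<noteq> g x} \<in> lmeasurable"
proof -
  have "{x \<in> centered_cube n. f x \<noteq> g x} = centered_cube n \<inter> {x. f x \<noteq> g x}" by auto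
  moreover have "centered_cube n \<in> lmeasurable" by (simp add: centered_cube_def)
  ultimately show ?thesis
    using diff_set_measurable[OF assms] by (metis fmeasurable_Int_fmeasurable)
qed

lemma diff_cube_measure_le:
  fixes f g :: "real ^ 'd::finite \<Rightarrow> nat"
  shows "measure lebesgue {x \<in> centered_cube n. f x \<noteq> g x} \<le> (2 * real n) ^ CARD('d)"
proof (cases "{x \<in> centered_cube n. f x \<noteq> g x} \<in> sets lebesgue")
  case True
  have "centered_cube n \<in> (lmeasurable :: (real ^ 'd) set set)" by (simp add: centered_cube_def)
  then have "measure lebesgue {x \<in> centered_cube n. f x \<noteq> g x}
      \<le> measure lebesgue (centered_cube n :: (real ^ 'd) set)"
    using True by (intro measure_mono_fmeasurable) auto
  then show ?thesis by (simp add: measure_centered_cube)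
next
  case False
  then show ?thesis by (simp add: measure_notin_sets)
qed

lemma coloring_dist_summable:
  fixes f g :: "real ^ 'd::finite \<Rightarrow> nat"
  shows "summable (\<lambda>n. (1/2) ^ Suc n * measure lebesgue {x \<in> centered_cube (Suc n). f x \<noteq> g x}
            / (2 * real (Suc n)) ^ CARD('d))"
proof (rule summable_comparison_test')
  show "summable (\<lambda>n. (1/2 :: real) ^ Suc n)"
    by (subst summable_Suc_iff) (simp add: summable_geometric)
  fix n :: nat
  have "measure lebesgue {x \<in> centered_cube (Suc n). f x \<noteq> g x} / (2 * real (Suc n)) ^ CARD('d) \<le> 1"
    using diff_cube_measure_le[of "Suc n" f g] by (simp add: divide_le_eq_1)
  then have "(1/2) ^ Suc n * (measure lebesgue {x \<in> centered_cube (Suc n). f x \<noteq> g x}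
      / (2 * real (Suc n)) ^ CARD('d)) \<le> (1/2) ^ Suc n * 1"
    by (intro mult_left_mono) auto
  then show "norm ((1/2) ^ Suc n * measure lebesgue {x \<in> centered_cube (Suc n). f x \<noteq> g x}
      / (2 * real (Suc n)) ^ CARD('d)) \<le> (1/2) ^ Suc n"
    by simp
qed

lemma coloring_dist_nonneg: "0 \<le> coloring_dist f g"
  unfolding coloring_dist_def by (intro suminf_nonneg coloring_dist_summable) auto

lemma coloring_dist_commute: "coloring_dist f g = coloring_dist g f"
  unfolding coloring_dist_def by (simp only: eq_commute)

lemma coloring_dist_eq_0_iff:
  fixes f g :: "real ^ 'd::finite \<Rightarrow> nat"
  assumes f: "f \<in> measurable_colorings k" and g: "g \<in> measurable_colorings k"
  shows "coloring_dist f g = 0 \<longleftrightarrow> (AE x in lebesgue. f x = g x)"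
proof -
  let ?D = "\<lambda>n. {x \<in> centered_cube n. f x \<noteq> g x}"
  have cover: "{x. f x \<noteq> g x} = (\<Union>n. ?D (Suc n))"
  proof -
    have "\<exists>n. x \<in> centered_cube (Suc n)" for x :: "real ^ 'd"
    proof -
      obtain n where "norm x \<le> real n" using real_arch_simple by blast
      then have "- real (Suc n) \<le> x $ i \<and> x $ i \<le> real (Suc n)" for i
        using component_le_norm_cart[of x i] by (simp add: abs_le_iff)
      then have "x \<in> centered_cube (Suc n)"
        by (simp add: centered_cube_def mem_box_cart)
      then show ?thesis ..
    qed
    then show ?thesis by auto
  qed
  have "coloring_dist f g = 0 \<longleftrightarrow> (\<forall>n. measure lebesgue (?D (Suc n)) = 0)"
    unfolding coloring_dist_def
    by (subst suminf_eq_zero_iff[OF coloring_dist_summable]) auto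
  also have "\<dots> \<longleftrightarrow> (\<forall>n. ?D (Suc n) \<in> null_sets lebesgue)"
    using diff_cube_lmeasurable[OF f g] by (simp add: negligible_iff_measure flip: negligible_iff_null_sets)
  also have "\<dots> \<longleftrightarrow> {x. f x \<noteq> g x} \<in> null_sets lebesgue"
  proof
    assume "\<forall>n. ?D (Suc n) \<in> null_sets lebesgue"
    then show "{x. f x \<noteq> g x} \<in> null_sets lebesgue"
      unfolding cover by (intro null_sets_UN) auto
  next
    assume "{x. f x \<noteq> g x} \<in> null_sets lebesgue"
    moreover have "?D n \<in> sets lebesgue" for n
      using diff_cube_lmeasurable[OF f g] by (simp add: fmeasurableD)
    moreover have "?D n \<subseteq> {x. f x \<noteq> g x}" for n by auto
    ultimately show "\<forall>n. ?D (Suc n) \<in> null_sets lebesgue"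
      using null_sets_subset by blast
  qed
  also have "\<dots> \<longleftrightarrow> (AE x in lebesgue. f x = g x)"
    using AE_iff_null_sets[OF diff_set_measurable[OF f g]] by simp
  finally show ?thesis .
qed

lemma coloring_dist_triangle:
  fixes f g h :: "real ^ 'd::finite \<Rightarrow> nat"
  assumes f: "f \<in> measurable_colorings k" and g: "g \<in> measurable_colorings k"
    and h: "h \<in> measurable_colorings k"
  shows "coloring_dist f h \<le> coloring_dist f g + coloring_dist g h"
proof -
  let ?t = "\<lambda>f g n. (1/2) ^ Suc n * measure lebesgue {x \<in> centered_cube (Suc n). f x \<noteq> g x}
            / (2 * real (Suc n)) ^ CARD('d)"
  have "?t f h n \<le> ?t f g n + ?t g h n" for n
  proof -
    let ?D = "\<lambda>f g. {x \<in> centered_cube (Suc n). f x \<noteq> (g x :: nat)} :: (real ^ 'd) set"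
    have "measure lebesgue (?D f h) \<le> measure lebesgue (?D f g \<union> ?D g h)"
      by (intro measure_mono_fmeasurable fmeasurable.Un diff_cube_lmeasurable[OF f g]
          diff_cube_lmeasurable[OF g h] fmeasurableD[OF diff_cube_lmeasurable[OF f h]]) auto
    also have "\<dots> \<le> measure lebesgue (?D f g) + measure lebesgue (?D g h)"
      by (intro measure_Un_le fmeasurableD diff_cube_lmeasurable[OF f g] diff_cube_lmeasurable[OF g h])
    finally have *: "measure lebesgue (?D f h)
        \<le> measure lebesgue (?D f g) + measure lebesgue (?D g h)" .
    have "?t f h n \<le> (1/2) ^ Suc n * (measure lebesgue (?D f g) + measure lebesgue (?D g h))
            / (2 * real (Suc n)) ^ CARD('d)"
      by (intro divide_right_mono mult_left_mono *) auto
    then show ?thesis by (simp only: distrib_left add_divide_distrib)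
  qed
  then have "(\<Sum>n. ?t f h n) \<le> (\<Sum>n. ?t f g n + ?t g h n)"
    by (intro suminf_le summable_add coloring_dist_summable)
  then show ?thesis
    unfolding coloring_dist_def
    by (simp only: suminf_add[OF coloring_dist_summable coloring_dist_summable])
qed

lemma class_rep:
  assumes "F \<in> coloring_space k"
  shows "(SOME f. f \<in> F) \<in> measurable_colorings k"
    and "F = coloring_equiv k `` {SOME f. f \<in> F}"
proof -
  have "(SOME f. f \<in> F) \<in> F"
    using in_quotient_imp_non_empty[OF equiv_coloring_equiv] assms
    unfolding coloring_space_def by (metis some_in_eq)
  then show "(SOME f. f \<in> F) \<in> measurable_colorings k"
    and "F = coloring_equiv k `` {SOME f. f \<in> F}"
    using assms in_quotient_imp_subset[OF equiv_coloring_equiv]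
    unfolding coloring_space_def
    by (blast, metis Image_singleton_iff equiv_class_eq_iff[OF equiv_coloring_equiv] quotientE)
qed

lemma class_dist_class:
  assumes f: "f \<in> measurable_colorings k" and g: "g \<in> measurable_colorings k"
  shows "class_dist (coloring_equiv k `` {f}) (coloring_equiv k `` {g}) = coloring_dist f g"
proof -
  define f' g' where "f' = (SOME h. h \<in> coloring_equiv k `` {f})"
    and "g' = (SOME h. h \<in> coloring_equiv k `` {g})"
  have "(f, f') \<in> coloring_equiv k" "(g, g') \<in> coloring_equiv k"
    unfolding f'_def g'_def using equiv_class_self[OF equiv_coloring_equiv] f g
    by (metis Image_singleton_iff someI_ex)+
  then have *: "f' \<in> measurable_colorings k" "g' \<in> measurable_colorings k"
    and "AE x in lebesgue. f x = f' x" "AE x in lebesgue. g x = g' x"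
    by (auto simp: coloring_equiv_def)
  then have "coloring_dist f f' = 0" "coloring_dist g g' = 0"
    using coloring_dist_eq_0_iff f g by blast+
  then have "coloring_dist f' g' = coloring_dist f g"
    using coloring_dist_triangle[OF *(1) f *(2)] coloring_dist_triangle[OF f g *(2)]
      coloring_dist_triangle[OF f *(1) g] coloring_dist_triangle[OF *(1,2) g]
      coloring_dist_commute[of f f'] coloring_dist_commute[of g g'] by linarith
  then show ?thesis by (simp add: class_dist_def f'_def g'_def)
qed

lemma Metric_space_coloring_space:
  "Metric_space (coloring_space k :: (real ^ 'd::finite \<Rightarrow> nat) set set) class_dist"
proof
  fix F G H :: "(real ^ 'd \<Rightarrow> nat) set"
  show "0 \<le> class_dist F G" by (simp add: class_dist_def coloring_dist_nonneg)
  show "class_dist F G = class_dist G F" by (simp add: class_dist_def coloring_dist_commute)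
  assume F: "F \<in> coloring_space k" and G: "G \<in> coloring_space k"
  have "class_dist F G = 0 \<longleftrightarrow> ((SOME f. f \<in> F), (SOME g. g \<in> G)) \<in> coloring_equiv k"
    using class_rep(1)[OF F] class_rep(1)[OF G]
    by (simp add: class_dist_def coloring_dist_eq_0_iff coloring_equiv_def)
  also have "\<dots> \<longleftrightarrow> F = G"
    using class_rep[OF F] class_rep[OF G] by (metis eq_equiv_class_iff[OF equiv_coloring_equiv])
  finally show "class_dist F G = 0 \<longleftrightarrow> F = G" .
  assume H: "H \<in> coloring_space k"
  show "class_dist F H \<le> class_dist F G + class_dist G H"
    unfolding class_dist_def
    by (rule coloring_dist_triangle[OF class_rep(1)[OF F] class_rep(1)[OF G] class_rep(1)[OF H]])
qed

end

theory Submission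
  imports Defs "HOL-Computational_Algebra.Fundamental_Theorem_Algebra"
begin

text \<open>
  Fix the axes of the cuts and the way in which the cells of the cut pattern are dealt out to the
  \<open>q\<close> parts. A necklace with \<open>t\<close> cuts is then given by \<open>t + d + 1\<close> real parameters: corner, side and
  positions of the cuts. Fairness amounts to \<open>m = (k - 1) * (q - 1)\<close> equations for the colors
  below \<open>k\<close>, together with \<open>q - 1\<close> equations saying that the parts have equal volume; only the former
  depend on the coloring. The assumption on \<open>k\<close>, \<open>q\<close> and \<open>t\<close> makes the equations outnumber
  the parameters, so a generic coloring should admit no solution at all.

  Generic is meant in the sense of Baire. The space of colorings is complete
  (\<open>mcomplete_coloring_space\<close>). Call a coloring robust at level \<open>n\<close> if all cut necklaces inside
  \<open>[-n, n]^d\<close> of side at least \<open>1 / n\<close> miss fairness by a common positive margin. Every necklace is seen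
  at some level, so a coloring that is robust at all levels is unsplittable. Robust colorings form
  an open set because of the margin, and it remains to see that they are dense at every level
  (\<open>unsplittable_dense_if_robust_dense\<close>).

  To make a coloring robust, reserve a thin stripe in every cell of a fine grid for every color
  \<open>c < k\<close>, give color \<open>c\<close> to a fraction \<open>u / L\<close> of that stripe and color \<open>k\<close> to its rest, and choose
  the integers \<open>u < L\<close> well. A count replaces transversality. Configurations that are nearly
  fair, within \<open>1 / L\<close>, lie within \<open>O(1 / L)\<close> of a finite set \<open>U\<close> of rounded ones, and in a rounded one
  that is close to such a configuration the first \<open>q - 1\<close> parts each contain a whole grid cell. The \<open>m\<close> weights
  of these cells control the \<open>m\<close> color equations separately, so that each of them is confined to boundedly many
  values once the other weights are chosen (\<open>card_nearly_fair_weights\<close>). Hence every element of \<open>U\<close>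
  spoils a fraction \<open>O(L^-m)\<close> of all choices of weights, and a good choice exists as soon as \<open>U\<close>
  has at most \<open>\<epsilon> * L^m\<close> elements for a suitable small \<open>\<epsilon>\<close> (\<open>robust_colorings_dense\<close>).

  Rounding all parameters would give \<open>O(L^(t + d + 1))\<close> configurations. The inequality
  \<open>k * (q - 1) > t + d + q - 1\<close> says \<open>m \<ge> t + d + 1\<close>, so in general a factor \<open>o(1)\<close> has to be gained. It comes
  from one volume equation: with everything but the side fixed, the volume of the part at the far corner minus
  a \<open>q\<close>-th of the total is a polynomial of degree \<open>d\<close> in the side with leading coefficient \<open>1 - 1 / q\<close>,
  and such a polynomial is small at \<open>o(L)\<close> grid points only (\<open>covering_by_rounding\<close>). On the line
  the volume equations are linear in the gaps between consecutive cuts, so that all \<open>q - 1\<close> of them can be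
  used, and each saves a full factor \<open>L\<close> (\<open>covering_by_rounding_gaps\<close>).
\<close>

section \<open>Parts of a cut necklace and their stability\<close>

definition cuts_below :: "nat \<Rightarrow> (nat \<Rightarrow> 'd) \<Rightarrow> real ^ 'd::finite \<Rightarrow> (nat \<Rightarrow> real) \<Rightarrow> real ^ 'd \<Rightarrow> nat set"
  where "cuts_below t \<iota> a b x = {l. l < t \<and> a $ \<iota> l + b l < x $ \<iota> l}"

text \<open>
  Cut \<open>l\<close> is the hyperplane through \<open>a $ \<iota> l + b l\<close> perpendicular to the axis \<open>\<iota> l\<close>. Up to null sets
  the pieces of the necklace are the sets of points with a given set of cuts below them, so that a
  distribution of the pieces is a function \<open>p\<close> on sets of cuts. In this form the distribution makes
  sense for all positions of the cuts at once, even where a piece degenerates.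
\<close>

definition share :: "nat \<Rightarrow> (nat \<Rightarrow> 'd) \<Rightarrow> (nat set \<Rightarrow> nat) \<Rightarrow> real ^ 'd::finite \<Rightarrow> real \<Rightarrow>
    (nat \<Rightarrow> real) \<Rightarrow> nat \<Rightarrow> (real ^ 'd) set"
  where "share t \<iota> p a s b j = {x \<in> cbox a (\<chi> i. a $ i + s). p (cuts_below t \<iota> a b x) = j}"

definition cut_cell :: "nat \<Rightarrow> (nat \<Rightarrow> 'd) \<Rightarrow> real ^ 'd::finite \<Rightarrow> real \<Rightarrow>
    (nat \<Rightarrow> real) \<Rightarrow> nat set \<Rightarrow> (real ^ 'd) set"
  where "cut_cell t \<iota> a s b S = {x \<in> cbox a (\<chi> i. a $ i + s). cuts_below t \<iota> a b x = S}"

lemma cuts_below_subset: "cuts_below t \<iota> a b x \<subseteq> {..<t}"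
  by (auto simp: cuts_below_def)

lemma cut_cell_lmeasurable: "cut_cell t \<iota> a s b S \<in> lmeasurable"
proof -
  have eq: "cut_cell t \<iota> a s b S =
      (if S \<subseteq> {..<t} then cbox a (\<chi> i. a $ i + s) \<inter>
        (\<Inter>l\<in>{..<t}. if l \<in> S then {x. a $ \<iota> l + b l < x $ \<iota> l} else {x. x $ \<iota> l \<le> a $ \<iota> l + b l})
      else {})"
  proof (cases "S \<subseteq> {..<t}")
    case True
    then have "cuts_below t \<iota> a b x = S \<longleftrightarrow> (\<forall>l<t. l \<in> S \<longleftrightarrow> a $ \<iota> l + b l < x $ \<iota> l)" for x
      unfolding cuts_below_def by blast
    then have "cut_cell t \<iota> a s b S =
        {x \<in> cbox a (\<chi> i. a $ i + s). \<forall>l<t. l \<in> S \<longleftrightarrow> a $ \<iota> l + b l < x $ \<iota> l}"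
      unfolding cut_cell_def by blast
    also have "\<dots> = cbox a (\<chi> i. a $ i + s) \<inter>
        (\<Inter>l\<in>{..<t}. if l \<in> S then {x. a $ \<iota> l + b l < x $ \<iota> l} else {x. x $ \<iota> l \<le> a $ \<iota> l + b l})"
      (is "?L = ?R")
    proof (rule set_eqI)
      fix x
      have "x \<in> (if l \<in> S then {x. a $ \<iota> l + b l < x $ \<iota> l} else {x. x $ \<iota> l \<le> a $ \<iota> l + b l})
          \<longleftrightarrow> (l \<in> S \<longleftrightarrow> a $ \<iota> l + b l < x $ \<iota> l)" for l
        by (simp add: not_less)
      then show "x \<in> ?L \<longleftrightarrow> x \<in> ?R"
        by (simp only: mem_Collect_eq Int_iff INT_iff lessThan_iff Ball_def)
    qed
    finally show ?thesis using True by simp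
  next
    case False
    have "cuts_below t \<iota> a b x \<noteq> S" for x
      using False cuts_below_subset[of t \<iota> a b x] by blast
    then show ?thesis using False by (simp add: cut_cell_def)
  qed
  have m: "(if l \<in> S then {x. a $ \<iota> l + b l < x $ \<iota> l} else {x. x $ \<iota> l \<le> a $ \<iota> l + b l})
      \<in> sets lebesgue" for l
    by (auto intro!: borel_open borel_closed closed_halfspace_component_le_cart
        open_halfspace_component_gt_cart)
  have "cbox a (\<chi> i. a $ i + s) \<inter>
        (\<Inter>l\<in>{..<t}. if l \<in> S then {x. a $ \<iota> l + b l < x $ \<iota> l} else {x. x $ \<iota> l \<le> a $ \<iota> l + b l})
       \<in> lmeasurable"
  proof (cases "t = 0")
    case False
    then show ?thesis
      by (intro fmeasurable_Int_fmeasurable lmeasurable_cbox sets.finite_INT m) auto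
  qed auto
  with eq show ?thesis by simp
qed

lemma share_eq_UN_cut_cell:
  "share t \<iota> p a s b j = (\<Union>S\<in>{S \<in> Pow {..<t}. p S = j}. cut_cell t \<iota> a s b S)"
  using cuts_below_subset[of t \<iota> a b] by (auto simp: share_def cut_cell_def Pow_def)

lemma share_lmeasurable: "share t \<iota> p a s b j \<in> lmeasurable"
  unfolding share_eq_UN_cut_cell by (intro fmeasurable.finite_UN cut_cell_lmeasurable) auto

lemma measure_share:
  "measure lebesgue (share t \<iota> p a s b j)
    = (\<Sum>S\<in>{S \<in> Pow {..<t}. p S = j}. measure lebesgue (cut_cell t \<iota> a s b S))"
  unfolding share_eq_UN_cut_cell
proof (rule measure_UNION')
  show "pairwise (\<lambda>S S'. disjnt (cut_cell t \<iota> a s b S) (cut_cell t \<iota> a s b S'))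
      {S \<in> Pow {..<t}. p S = j}"
    by (auto simp: pairwise_def disjnt_iff cut_cell_def)
qed (simp_all add: cut_cell_lmeasurable)

lemma share_subset: "share t \<iota> p a s b j \<subseteq> cbox a (\<chi> i. a $ i + s)"
  by (auto simp: share_def)

lemma disjnt_share: "j \<noteq> j' \<Longrightarrow> share t \<iota> p a s b j \<inter> share t \<iota> p a s b j' = {}"
  by (auto simp: share_def)

lemma measure_slab_le:
  fixes n :: nat and i :: "'d::finite"
  assumes "0 \<le> r"
  shows "{x \<in> centered_cube n. \<bar>x $ i - y\<bar> \<le> r} \<in> lmeasurable"
    and "measure lebesgue {x \<in> centered_cube n. \<bar>x $ i - y\<bar> \<le> r}
      \<le> 2 * r * (2 * real n) ^ (CARD('d) - 1)"
proof -
  let ?u = "\<chi> j. if j = i then y - r else - real n"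
  let ?v = "\<chi> j. if j = i then y + r else real n"
  have c: "{x :: real ^ 'd. \<bar>x $ i - y\<bar> \<le> r} = {x. x $ i \<le> y + r} \<inter> {x. y - r \<le> x $ i}"
    by auto
  have "closed {x :: real ^ 'd. \<bar>x $ i - y\<bar> \<le> r}"
    unfolding c by (intro closed_Int closed_halfspace_component_le_cart closed_halfspace_component_ge_cart)
  then have "centered_cube n \<inter> {x :: real ^ 'd. \<bar>x $ i - y\<bar> \<le> r} \<in> lmeasurable"
    unfolding centered_cube_def by (intro lmeasurable_compact compact_Int_closed compact_cbox)
  also have "centered_cube n \<inter> {x :: real ^ 'd. \<bar>x $ i - y\<bar> \<le> r}
      = {x \<in> centered_cube n. \<bar>x $ i - y\<bar> \<le> r}" by auto
  finally show lm: "{x \<in> centered_cube n. \<bar>x $ i - y\<bar> \<le> r} \<in> lmeasurable" .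
  have ne: "cbox ?u ?v \<noteq> {}"
    using assms by (simp add: interval_ne_empty_cart)
  have "measure lebesgue {x \<in> centered_cube n. \<bar>x $ i - y\<bar> \<le> r} \<le> measure lebesgue (cbox ?u ?v)"
    using lm by (intro measure_mono_fmeasurable)
      (auto simp: centered_cube_def mem_box_cart abs_le_iff algebra_simps)
  also have "\<dots> = (\<Prod>j\<in>UNIV. ?v $ j - ?u $ j)"
    using content_cbox_cart[OF ne] by simp
  also have "\<dots> = (?v $ i - ?u $ i) * (\<Prod>j\<in>UNIV - {i}. ?v $ j - ?u $ j)"
    by (rule prod.remove) auto
  also have "(\<Prod>j\<in>UNIV - {i}. ?v $ j - ?u $ j) = (\<Prod>j\<in>UNIV - {i}. 2 * real n)"
    by (rule prod.cong) auto
  also have "\<dots> = (2 * real n) ^ (CARD('d) - 1)"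
    by (simp add: card_Diff_singleton)
  finally show "measure lebesgue {x \<in> centered_cube n. \<bar>x $ i - y\<bar> \<le> r}
      \<le> 2 * r * (2 * real n) ^ (CARD('d) - 1)" by simp
qed

definition close_cuts :: "nat \<Rightarrow> real \<Rightarrow> real ^ 'd::finite \<Rightarrow> real \<Rightarrow> (nat \<Rightarrow> real) \<Rightarrow>
     real ^ 'd \<Rightarrow> real \<Rightarrow> (nat \<Rightarrow> real) \<Rightarrow> bool"
  where "close_cuts t r a s b a' s' b' \<longleftrightarrow>
    (\<forall>i. \<bar>a $ i - a' $ i\<bar> \<le> r) \<and> \<bar>s - s'\<bar> \<le> r \<and> (\<forall>l<t. \<bar>b l - b' l\<bar> \<le> r)"

text \<open>
  A point changes its part only if it lies within \<open>2 * r\<close> of one of the \<open>2 * d\<close> faces of the necklace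
  or of one of the \<open>t\<close> cuts. So the amount of every color in a part is Lipschitz in the parameters,
  with a constant that does not depend on the coloring.
\<close>

lemma measure_share_stable:
  fixes a a' :: "real ^ 'd::finite"
  assumes close: "close_cuts t r a s b a' s' b'" and r: "0 \<le> r" "2 * r \<le> 1"
    and in_cube: "\<forall>i. - real n \<le> a $ i \<and> a $ i + s \<le> real n"
    and E: "E \<in> sets lebesgue"
  shows "\<bar>measure lebesgue (share t \<iota> p a s b j \<inter> E) - measure lebesgue (share t \<iota> p a' s' b' j \<inter> E)\<bar>
    \<le> real (2 * CARD('d) + t) * (4 * (2 * real (Suc n)) ^ (CARD('d) - 1)) * r"
proof -
  let ?slab = "\<lambda>i y. {x \<in> centered_cube (Suc n) :: (real ^ 'd) set. \<bar>x $ i - y\<bar> \<le> 2 * r}"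
  define W where "W = (\<Union>i\<in>UNIV. ?slab i (a $ i)) \<union> (\<Union>i\<in>UNIV. ?slab i (a $ i + s))
    \<union> (\<Union>l\<in>{..<t}. ?slab (\<iota> l) (a $ \<iota> l + b l))"
  let ?K = "4 * r * (2 * real (Suc n)) ^ (CARD('d) - 1)"
  have slab: "?slab i y \<in> lmeasurable" "measure lebesgue (?slab i y) \<le> ?K" for i y
    using measure_slab_le[of "2 * r" "Suc n" i y] r by (simp_all add: mult_ac)
  have W: "W \<in> lmeasurable"
    unfolding W_def using slab(1) by (intro fmeasurable.Un fmeasurable.finite_UN) auto
  have U: "measure lebesgue (\<Union>i\<in>I. ?slab (h i) (y i)) \<le> card I * ?K" if "finite I" for I :: "'i set" and h y
  proof -
    have "measure lebesgue (\<Union>i\<in>I. ?slab (h i) (y i)) \<le> (\<Sum>i\<in>I. measure lebesgue (?slab (h i) (y i)))"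
      using that slab(1) by (intro measure_UNION_le) (auto simp: fmeasurableD)
    also have "\<dots> \<le> (\<Sum>i\<in>I. ?K)" using slab(2) by (intro sum_mono)
    finally show ?thesis by simp
  qed
  have Ulm: "(\<Union>i\<in>I. ?slab (h i) (y i)) \<in> lmeasurable" if "finite I" for I :: "'i set" and h y
    using slab(1) that by (intro fmeasurable.finite_UN) auto
  have "measure lebesgue W \<le> measure lebesgue ((\<Union>i\<in>UNIV. ?slab i (a $ i)) \<union> (\<Union>i\<in>UNIV. ?slab i (a $ i + s)))
     + measure lebesgue (\<Union>l\<in>{..<t}. ?slab (\<iota> l) (a $ \<iota> l + b l))"
    unfolding W_def using slab(1) by (intro measure_Un_le) (auto intro!: sets.Un sets.finite_UN simp: fmeasurableD)
  also have "measure lebesgue ((\<Union>i\<in>UNIV. ?slab i (a $ i)) \<union> (\<Union>i\<in>UNIV. ?slab i (a $ i + s)))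
     \<le> measure lebesgue (\<Union>i\<in>UNIV. ?slab i (a $ i)) + measure lebesgue (\<Union>i\<in>UNIV. ?slab i (a $ i + s))"
    using slab(1) by (intro measure_Un_le) (auto intro!: sets.finite_UN simp: fmeasurableD)
  also note U[of UNIV "\<lambda>i. i" "\<lambda>i. a $ i", OF finite_class.finite_UNIV]
  also note U[of UNIV "\<lambda>i. i" "\<lambda>i. a $ i + s", OF finite_class.finite_UNIV]
  also note U[of "{..<t}" \<iota> "\<lambda>l. a $ \<iota> l + b l", OF finite_lessThan]
  finally have mW: "measure lebesgue W
      \<le> real (2 * CARD('d) + t) * (4 * (2 * real (Suc n)) ^ (CARD('d) - 1)) * r"
    by (simp add: algebra_simps)
  let ?A = "share t \<iota> p a s b j" and ?A' = "share t \<iota> p a' s' b' j"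
  have cl: "\<bar>a $ i - a' $ i\<bar> \<le> r" "\<bar>s - s'\<bar> \<le> r" "l < t \<Longrightarrow> \<bar>b l - b' l\<bar> \<le> r" for i l
    using close by (auto simp: close_cuts_def)
  have key: "x \<in> W" if x: "x \<in> cbox a (\<chi> i. a $ i + s) \<union> cbox a' (\<chi> i. a' $ i + s')"
    and d: "\<not> (x \<in> ?A \<longleftrightarrow> x \<in> ?A')" for x
  proof -
    have cube: "x \<in> centered_cube (Suc n)"
    proof -
      have "- real (Suc n) \<le> x $ i \<and> x $ i \<le> real (Suc n)" for i
        using x cl(1)[of i] cl(2) r in_cube[rule_format, of i]
        by (auto simp: mem_box_cart abs_le_iff dest!: spec[of _ i])
      then show ?thesis by (simp add: centered_cube_def mem_box_cart)
    qed
    consider "x \<notin> cbox a (\<chi> i. a $ i + s)" | "x \<notin> cbox a' (\<chi> i. a' $ i + s')"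
      | "cuts_below t \<iota> a b x \<noteq> cuts_below t \<iota> a' b' x"
      using d unfolding share_def mem_Collect_eq by metis
    then show ?thesis
    proof cases
      case 1
      with x have "x \<in> cbox a' (\<chi> i. a' $ i + s')" by auto
      then have y: "a' $ i \<le> x $ i" "x $ i \<le> a' $ i + s'" for i by (auto simp: mem_box_cart)
      from 1 obtain i where "x $ i < a $ i \<or> x $ i > a $ i + s" by (auto simp: mem_box_cart not_le)
      then have "\<bar>x $ i - a $ i\<bar> \<le> 2 * r \<or> \<bar>x $ i - (a $ i + s)\<bar> \<le> 2 * r"
        using y[of i] cl(1)[of i] cl(2) by linarith
      then show ?thesis using cube unfolding W_def by blast
    next
      case 2
      with x have "x \<in> cbox a (\<chi> i. a $ i + s)" by auto
      then have y: "a $ i \<le> x $ i" "x $ i \<le> a $ i + s" for i by (auto simp: mem_box_cart)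
      from 2 obtain i where "x $ i < a' $ i \<or> x $ i > a' $ i + s'" by (auto simp: mem_box_cart not_le)
      then have "\<bar>x $ i - a $ i\<bar> \<le> 2 * r \<or> \<bar>x $ i - (a $ i + s)\<bar> \<le> 2 * r"
        using y[of i] cl(1)[of i] cl(2) by linarith
      then show ?thesis using cube unfolding W_def by blast
    next
      case 3
      then obtain l where l: "l < t" "\<not> (a $ \<iota> l + b l < x $ \<iota> l \<longleftrightarrow> a' $ \<iota> l + b' l < x $ \<iota> l)"
        by (auto simp: cuts_below_def)
      then have "\<bar>x $ \<iota> l - (a $ \<iota> l + b l)\<bar> \<le> 2 * r"
        using cl(1)[of "\<iota> l"] cl(3)[of l] by linarith
      then show ?thesis using cube l(1) unfolding W_def by blast
    qed
  qed
  have lm: "?A \<inter> E \<in> lmeasurable" "?A' \<inter> E \<in> lmeasurable"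
    using E by (simp_all add: fmeasurable_Int_fmeasurable share_lmeasurable)
  have sub: "?A \<inter> E \<subseteq> (?A' \<inter> E) \<union> W" "?A' \<inter> E \<subseteq> (?A \<inter> E) \<union> W"
    using key share_subset by blast+
  have "measure lebesgue (?A \<inter> E) \<le> measure lebesgue (?A' \<inter> E) + measure lebesgue W"
    by (rule order_trans[OF measure_mono_fmeasurable[OF sub(1)] measure_Un_le])
      (use lm W in \<open>auto simp: fmeasurableD\<close>)
  moreover have "measure lebesgue (?A' \<inter> E) \<le> measure lebesgue (?A \<inter> E) + measure lebesgue W"
    by (rule order_trans[OF measure_mono_fmeasurable[OF sub(2)] measure_Un_le])
      (use lm W in \<open>auto simp: fmeasurableD\<close>)
  ultimately show ?thesis using mW by linarith
qed

section \<open>Fair splittings as finitely many real parameters\<close>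

text \<open>
  Sorting the cuts by offset and moving cuts outside the necklace to its boundary loses nothing; the first
  makes the necklaces on the line easy to describe, the second bounds the parameters. The
  extensional function spaces leave finitely many choices of \<open>\<iota>\<close> and \<open>p\<close>.
\<close>

definition valid_cuts :: "nat \<Rightarrow> nat \<Rightarrow> nat \<Rightarrow> (nat \<Rightarrow> 'd) \<Rightarrow> (nat set \<Rightarrow> nat) \<Rightarrow> real ^ 'd::finite \<Rightarrow>
    real \<Rightarrow> (nat \<Rightarrow> real) \<Rightarrow> bool"
  where "valid_cuts n q t \<iota> p a s b \<longleftrightarrow>
    (\<forall>i. - real n \<le> a $ i \<and> a $ i + s \<le> real n) \<and> 1 / real n \<le> s \<and>
    (\<forall>l<t. 0 \<le> b l \<and> b l \<le> s) \<and> (\<forall>l<t. \<forall>m<t. l \<le> m \<longrightarrow> b l \<le> b m) \<and>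
    \<iota> \<in> {..<t} \<rightarrow>\<^sub>E UNIV \<and> p \<in> Pow {..<t} \<rightarrow>\<^sub>E {1..q}"

text \<open>
  The parts are compared with part \<open>q\<close> and not with the average. In this way the equation for
  part \<open>j < q\<close> is unaffected by changes of the coloring inside the other parts below \<open>q\<close>, and the system of
  equations will be diagonal in the parameters of the perturbation.
\<close>

definition nearly_fair :: "nat \<Rightarrow> nat \<Rightarrow> nat \<Rightarrow> real \<Rightarrow> (real ^ 'd::finite \<Rightarrow> nat) \<Rightarrow> (nat \<Rightarrow> 'd) \<Rightarrow>
    (nat set \<Rightarrow> nat) \<Rightarrow> real ^ 'd \<Rightarrow> real \<Rightarrow> (nat \<Rightarrow> real) \<Rightarrow> bool"
  where "nearly_fair k q t \<delta> f \<iota> p a s b \<longleftrightarrow>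
    (\<forall>j\<in>{1..q}. \<forall>c\<in>{1..k}.
      \<bar>measure lebesgue (share t \<iota> p a s b j \<inter> f -` {c}) -
       measure lebesgue (share t \<iota> p a s b q \<inter> f -` {c})\<bar> \<le> \<delta>)"

lemma sorting_permutation:
  fixes c :: "nat \<Rightarrow> real"
  obtains \<pi> where "bij_betw \<pi> {..<t} {..<t}" "\<And>l m. l < t \<Longrightarrow> m < t \<Longrightarrow> l \<le> m \<Longrightarrow> c (\<pi> l) \<le> c (\<pi> m)"
proof
  let ?xs = "sort_key c [0..<t]"
  have len: "length ?xs = t" by simp
  show "bij_betw ((!) ?xs) {..<t} {..<t}"
    by (rule bij_betw_nth) auto
  fix l m assume lm: "l < t" "m < t" "l \<le> m"
  have "sorted (map c ?xs)" by simp
  then have "map c ?xs ! l \<le> map c ?xs ! m"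
    using lm by (intro sorted_nth_mono) simp_all
  then show "c (?xs ! l) \<le> c (?xs ! m)"
    using lm by simp
qed

lemma convex_component_lt: "convex {x :: real ^ 'd::finite. x $ i < c}"
  and convex_component_gt: "convex {x :: real ^ 'd::finite. c < x $ i}"
  using convex_halfspace_lt[of "axis i 1 :: real ^ 'd" c] convex_halfspace_gt[of c "axis i 1 :: real ^ 'd"]
  by (simp_all add: inner_axis inner_commute)

lemma negligible_component_eq: "negligible {x :: real ^ 'd::finite. x $ i = c}"
  using negligible_standard_hyperplane[of "axis i 1 :: real ^ 'd" c]
  by (simp add: cart_eq_inner_axis axis_in_Basis_iff)

text \<open>
  The cuts are enumerated, padded to \<open>t\<close> of them by trivial ones on the far boundary, clamped to the
  necklace and sorted. A piece is determined by the cuts below its points, which defines \<open>p\<close>.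
  Points on a cut or on a near face of the necklace, where clamping changes the cuts below, form a null set.
\<close>

lemma fair_splitting_imp_valid_cuts:
  fixes f :: "real ^ 'd::finite \<Rightarrow> nat"
  assumes f: "f \<in> measurable_colorings k" and q: "q \<ge> 1" and N: "necklace N"
    and split: "has_fair_splitting k q t f N"
  obtains n \<iota> p a s b where "n \<ge> 1" "valid_cuts n q t \<iota> p a s b" "nearly_fair k q t 0 f \<iota> p a s b"
proof -
  obtain a s where s: "s > 0" and N_eq: "N = cbox a (\<chi> i. a $ i + s)"
    using N unfolding necklace_def by blast
  obtain \<H> lab where fin: "finite \<H>" and card: "card \<H> \<le> t" and hyps: "\<forall>H\<in>\<H>. axis_hyperplane H"
    and fair: "fair_distribution k q f N \<H> lab"
    using split unfolding has_fair_splitting_def by blast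
  define ax where "ax H = (SOME i. \<exists>\<beta>. H = {x :: real ^ 'd. x $ i = \<beta>})" for H
  define off where "off H = (SOME \<beta>. H = {x :: real ^ 'd. x $ ax H = \<beta>})" for H
  have hyp: "x \<in> H \<longleftrightarrow> x $ ax H = off H" if "H \<in> \<H>" for x H
  proof -
    have "\<exists>i \<beta>. H = {x. x $ i = \<beta>}"
      using hyps that unfolding axis_hyperplane_def by (rule bspec)
    then have "\<exists>\<beta>. H = {x. x $ ax H = \<beta>}"
      unfolding ax_def by (rule someI_ex)
    then have "H = {x. x $ ax H = off H}"
      unfolding off_def by (rule someI_ex)
    from eqset_imp_iff[OF this, of x] show ?thesis unfolding mem_Collect_eq .
  qed
  obtain e where e: "bij_betw e {0..<card \<H>} \<H>" using ex_bij_betw_nat_finite[OF fin] by blast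
  define \<iota>' where "\<iota>' l = ax (e l)" for l
  define c where "c l = (if l < card \<H> then max 0 (min s (off (e l) - a $ \<iota>' l)) else s)" for l
  obtain \<pi> where \<pi>: "bij_betw \<pi> {..<t} {..<t}"
    and sorted: "\<And>l m. l < t \<Longrightarrow> m < t \<Longrightarrow> l \<le> m \<Longrightarrow> c (\<pi> l) \<le> c (\<pi> m)"
    using sorting_permutation[of t c] by blast
  define \<iota> where "\<iota> = (\<lambda>l\<in>{..<t}. \<iota>' (\<pi> l))"
  define b where "b l = c (\<pi> l)" for l
  define X where "X = N - \<Union>\<H>"
  define Y where "Y = {x \<in> X. \<forall>i. a $ i < x $ i}"
  \<comment> \<open>Both points are on the same side of every cut, so the segment between them avoids the cuts.\<close>
  have same: "connected_component_set X x = connected_component_set X y"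
    if x: "x \<in> Y" and y: "y \<in> Y" and eq: "cuts_below t \<iota> a b x = cuts_below t \<iota> a b y" for x y
  proof -
    have "closed_segment x y \<subseteq> X"
    proof -
      have "closed_segment x y \<subseteq> N"
        using x y unfolding N_eq Y_def X_def by (intro closed_segment_subset convex_box) auto
      moreover have "closed_segment x y \<inter> H = {}" if H: "H \<in> \<H>" for H
      proof -
        obtain m where m: "m < card \<H>" "e m = H"
          using H e unfolding bij_betw_def by (metis atLeastLessThan_iff imageE)
        then have "m \<in> {..<t}" using card by simp
        then obtain l where l: "l < t" "\<pi> l = m"
          using \<pi> by (metis bij_betw_iff_bijections lessThan_iff)
        have below: "l \<in> cuts_below t \<iota> a b z \<longleftrightarrow> off H < z $ ax H" if "z \<in> Y" for z
        proof -
          have z: "a $ ax H < z $ ax H" "z $ ax H \<le> a $ ax H + s"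
            using that by (auto simp: Y_def X_def N_eq mem_box_cart)
          have "l \<in> cuts_below t \<iota> a b z \<longleftrightarrow> a $ ax H + max 0 (min s (off H - a $ ax H)) < z $ ax H"
            using l m by (simp add: cuts_below_def \<iota>_def b_def c_def \<iota>'_def)
          also have "\<dots> \<longleftrightarrow> off H < z $ ax H" using z s by (auto simp: max_def min_def)
          finally show ?thesis .
        qed
        have "x $ ax H \<noteq> off H" "y $ ax H \<noteq> off H"
          using x y H hyp[OF H] unfolding Y_def X_def by blast+
        then consider "x $ ax H < off H" "y $ ax H < off H" | "off H < x $ ax H" "off H < y $ ax H"
          using below[OF x] below[OF y] eq by (metis linorder_neqE)
        then have "closed_segment x y \<subseteq> {z. z $ ax H < off H} \<or> closed_segment x y \<subseteq> {z. off H < z $ ax H}"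
          by cases (simp_all add: closed_segment_subset convex_component_lt convex_component_gt)
        then show ?thesis using hyp[OF H] by fastforce
      qed
      ultimately show ?thesis unfolding X_def by blast
    qed
    then have "closed_segment x y \<subseteq> connected_component_set X x"
      by (intro connected_component_maximal) auto
    then have "y \<in> connected_component_set X x" by auto
    then show ?thesis by (metis connected_component_eq)
  qed
  define p where "p = (\<lambda>S\<in>Pow {..<t}. if \<exists>x\<in>Y. cuts_below t \<iota> a b x = S
      then lab (connected_component_set X (SOME x. x \<in> Y \<and> cuts_below t \<iota> a b x = S)) else 1)"
  have p_cuts: "p (cuts_below t \<iota> a b x) = lab (connected_component_set X x)" if "x \<in> Y" for x
  proof -
    let ?y = "SOME y. y \<in> Y \<and> cuts_below t \<iota> a b y = cuts_below t \<iota> a b x"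
    have "?y \<in> Y \<and> cuts_below t \<iota> a b ?y = cuts_below t \<iota> a b x"
      by (rule someI[of _ x]) (use that in simp)
    then have "connected_component_set X ?y = connected_component_set X x"
      using same that by blast
    then show ?thesis
      using that cuts_below_subset[of t \<iota> a b x] by (auto simp: p_def)
  qed
  have lab: "lab P \<in> {1..q}" if "P \<in> components X" for P
    using fair that by (auto simp: fair_distribution_def pieces_def X_def)
  have p: "p \<in> Pow {..<t} \<rightarrow>\<^sub>E {1..q}"
  proof -
    have "p S \<in> {1..q}" if "S \<in> Pow {..<t}" for S
    proof (cases "\<exists>x\<in>Y. cuts_below t \<iota> a b x = S")
      case True
      then obtain x where x: "x \<in> Y" "cuts_below t \<iota> a b x = S" by blast
      then have "p S = lab (connected_component_set X x)" using p_cuts by blast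
      then show ?thesis using lab x by (simp add: Y_def componentsI)
    next
      case False
      then show ?thesis using that q by (simp add: p_def)
    qed
    then show ?thesis by (auto simp: p_def)
  qed
  have null: "negligible (N - Y)"
  proof -
    have "N - Y \<subseteq> \<Union>\<H> \<union> (\<Union>i\<in>UNIV. {x. x $ i = a $ i})"
      unfolding Y_def X_def N_eq by (auto simp: mem_box_cart) (metis order_le_less)
    moreover have "negligible H" if "H \<in> \<H>" for H
    proof -
      have "H = {x. x $ ax H = off H}" using hyp[OF that] by blast
      then show ?thesis using negligible_component_eq[of "ax H" "off H"] by metis
    qed
    then have "negligible (\<Union>\<H> \<union> (\<Union>i\<in>UNIV. {x. x $ i = a $ i}))"
      using fin by (intro negligible_Un negligible_Union)
        (auto intro: negligible_component_eq)
    ultimately show ?thesis by (rule negligible_subset[rotated])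
  qed
  have meas: "measure lebesgue (share t \<iota> p a s b j \<inter> f -` {c})
      = measure lebesgue (\<Union>{P \<in> pieces N \<H>. lab P = j} \<inter> f -` {c})" if c: "c \<in> {1..k}" for j c
  proof (rule measure_negligible_symdiff[symmetric])
    show "share t \<iota> p a s b j \<inter> f -` {c} \<in> lmeasurable"
      using f c by (intro fmeasurable_Int_fmeasurable share_lmeasurable)
        (auto simp: measurable_colorings_def)
    have iff: "x \<in> share t \<iota> p a s b j \<longleftrightarrow> x \<in> \<Union>{P \<in> pieces N \<H>. lab P = j}" if x: "x \<in> Y" for x
    proof -
      have "x \<in> X" "x \<in> cbox a (\<chi> i. a $ i + s)" using x by (auto simp: Y_def X_def N_eq)
      have "connected_component_set X x \<in> components X" "x \<in> connected_component_set X x"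
        using \<open>x \<in> X\<close> by (simp_all add: componentsI)
      then have "P = connected_component_set X x" if "P \<in> components X" "x \<in> P" for P
        using that components_nonoverlap by blast
      with \<open>_ \<in> components X\<close> \<open>x \<in> connected_component_set X x\<close>
      have "x \<in> \<Union>{P \<in> components X. lab P = j} \<longleftrightarrow> lab (connected_component_set X x) = j"
        by blast
      moreover have "x \<in> share t \<iota> p a s b j \<longleftrightarrow> lab (connected_component_set X x) = j"
        using \<open>x \<in> cbox _ _\<close> p_cuts[OF x] by (simp add: share_def)
      ultimately show ?thesis by (simp add: pieces_def X_def)
    qed
    have "\<Union>{P \<in> pieces N \<H>. lab P = j} \<subseteq> N"
      using in_components_subset unfolding pieces_def by fastforce
    moreover have "share t \<iota> p a s b j \<subseteq> N" unfolding N_eq by (rule share_subset)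
    ultimately have "share t \<iota> p a s b j \<inter> f -` {c} - \<Union>{P \<in> pieces N \<H>. lab P = j} \<inter> f -` {c} \<union>
        (\<Union>{P \<in> pieces N \<H>. lab P = j} \<inter> f -` {c} - share t \<iota> p a s b j \<inter> f -` {c}) \<subseteq> N - Y"
      using iff by blast
    then show "negligible (share t \<iota> p a s b j \<inter> f -` {c} - \<Union>{P \<in> pieces N \<H>. lab P = j} \<inter> f -` {c} \<union>
        (\<Union>{P \<in> pieces N \<H>. lab P = j} \<inter> f -` {c} - share t \<iota> p a s b j \<inter> f -` {c}))"
      using null negligible_subset by blast
  qed
  have "nearly_fair k q t 0 f \<iota> p a s b"
    unfolding nearly_fair_def
    using fair q by (simp add: meas fair_distribution_def)
  moreover have "\<exists>n\<ge>1. valid_cuts n q t \<iota> p a s b"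
  proof -
    obtain n where n: "Max (range (\<lambda>i. max \<bar>a $ i\<bar> \<bar>a $ i + s\<bar>)) + 1 / s \<le> real n"
      using real_arch_simple by blast
    have M: "max \<bar>a $ i\<bar> \<bar>a $ i + s\<bar> \<le> Max (range (\<lambda>i. max \<bar>a $ i\<bar> \<bar>a $ i + s\<bar>))" for i
      by (rule Max_ge) auto
    have s': "1 / s > 0" using s by simp
    have box: "- real n \<le> a $ i \<and> a $ i + s \<le> real n" for i
      using M[of i] n s' by linarith
    have "Max (range (\<lambda>i. max \<bar>a $ i\<bar> \<bar>a $ i + s\<bar>)) \<ge> 0"
      using M[of undefined] by linarith
    then have n1: "1 / s \<le> real n" using n by linarith
    then have n0: "n \<ge> 1" using s' by (cases n) auto
    have "1 / real n \<le> s" using n1 n0 s by (simp add: field_simps)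
    moreover have "0 \<le> b l \<and> b l \<le> s" for l using s by (auto simp: b_def c_def)
    ultimately have "valid_cuts n q t \<iota> p a s b"
      using box sorted p by (auto simp: valid_cuts_def \<iota>_def b_def)
    then show ?thesis using n0 by blast
  qed
  ultimately show ?thesis using that by blast
qed

section \<open>Colorings that are unfair by a margin\<close>

text \<open>
  A common margin \<open>\<delta>\<close> is asked for, instead of mere absence of fair splittings, because it makes
  openness evident; the perturbation used for density produces the margin anyway.
\<close>

definition robust_colorings :: "nat \<Rightarrow> nat \<Rightarrow> nat \<Rightarrow> nat \<Rightarrow> (real ^ 'd::finite \<Rightarrow> nat) set"
  where "robust_colorings k q t n = {f \<in> measurable_colorings k.
    \<exists>\<delta>>0. \<forall>\<iota> p a s b. valid_cuts n q t \<iota> p a s b \<longrightarrow> \<not> nearly_fair k q t \<delta> f \<iota> p a s b}"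

lemma measure_diff_cube_le_dist:
  fixes f g :: "real ^ 'd::finite \<Rightarrow> nat"
  assumes "n \<ge> 1"
  shows "measure lebesgue {x \<in> centered_cube n. f x \<noteq> g x}
    \<le> 2 ^ n * (2 * real n) ^ CARD('d) * coloring_dist f g"
proof -
  obtain m where n: "n = Suc m" using assms by (cases n) auto
  let ?D = "measure lebesgue {x \<in> centered_cube n. f x \<noteq> g x}"
  have "(\<Sum>i\<in>{m}. (1/2) ^ Suc i * measure lebesgue {x \<in> centered_cube (Suc i). f x \<noteq> g x}
            / (2 * real (Suc i)) ^ CARD('d)) \<le> coloring_dist f g"
    unfolding coloring_dist_def by (rule sum_le_suminf[OF coloring_dist_summable]) auto
  then have "(1/2) ^ n * ?D / (2 * real n) ^ CARD('d) \<le> coloring_dist f g"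
    by (simp add: n)
  then have "2 ^ n * (2 * real n) ^ CARD('d) * ((1/2) ^ n * ?D / (2 * real n) ^ CARD('d))
      \<le> 2 ^ n * (2 * real n) ^ CARD('d) * coloring_dist f g"
    by (intro mult_left_mono) auto
  also have "2 ^ n * (2 * real n) ^ CARD('d) * ((1/2) ^ n * ?D / (2 * real n) ^ CARD('d)) = ?D"
    using assms by (simp add: power_one_over field_simps)
  finally show ?thesis .
qed

lemma coloring_dist_le_measure:
  fixes f g :: "real ^ 'd::finite \<Rightarrow> nat"
  assumes fg: "f \<in> measurable_colorings k" "g \<in> measurable_colorings k"
    and E: "E \<in> lmeasurable" "{x. f x \<noteq> g x} \<subseteq> E"
  shows "coloring_dist f g \<le> measure lebesgue E"
proof -
  have "(1/2) ^ Suc i * measure lebesgue {x \<in> centered_cube (Suc i). f x \<noteq> g x}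
            / (2 * real (Suc i)) ^ CARD('d) \<le> (1/2) ^ Suc i * measure lebesgue E" for i
  proof -
    have "measure lebesgue {x \<in> centered_cube (Suc i). f x \<noteq> g x} \<le> measure lebesgue E"
      using E diff_cube_lmeasurable[OF fg, of "Suc i"]
      by (intro measure_mono_fmeasurable) (auto simp: fmeasurableD)
    moreover have "(1::real) \<le> (2 * real (Suc i)) ^ CARD('d)"
      by (intro one_le_power) simp
    ultimately have "measure lebesgue {x \<in> centered_cube (Suc i). f x \<noteq> g x} / (2 * real (Suc i)) ^ CARD('d)
        \<le> measure lebesgue E / 1"
      by (intro frac_le) auto
    then have "(1/2) ^ Suc i * (measure lebesgue {x \<in> centered_cube (Suc i). f x \<noteq> g x} / (2 * real (Suc i)) ^ CARD('d))
        \<le> (1/2) ^ Suc i * measure lebesgue E"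
      by (intro mult_left_mono) auto
    then show ?thesis by simp
  qed
  moreover have geo: "(\<lambda>i. (1/2) ^ Suc i * measure lebesgue E) sums (1 * measure lebesgue E)"
    by (intro sums_mult2 power_half_series)
  ultimately have "coloring_dist f g \<le> (\<Sum>i. (1/2) ^ Suc i * measure lebesgue E)"
    unfolding coloring_dist_def by (intro suminf_le coloring_dist_summable) (auto simp: sums_iff)
  then show ?thesis using sums_unique[OF geo] by simp
qed

lemma measure_color_dist_le:
  fixes f g :: "real ^ 'd::finite \<Rightarrow> nat"
  assumes fg: "f \<in> measurable_colorings k" "g \<in> measurable_colorings k" and c: "c \<in> {1..k}"
    and n: "n \<ge> 1" and A: "A \<in> lmeasurable" "A \<subseteq> centered_cube n"
  shows "\<bar>measure lebesgue (A \<inter> f -` {c}) - measure lebesgue (A \<inter> g -` {c})\<bar>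
    \<le> 2 ^ n * (2 * real n) ^ CARD('d) * coloring_dist f g"
proof -
  let ?D = "{x \<in> centered_cube n. f x \<noteq> g x}"
  have D: "?D \<in> lmeasurable" using diff_cube_lmeasurable[OF fg] .
  have lm: "A \<inter> h -` {c} \<in> lmeasurable" if "h \<in> measurable_colorings k" for h
    using that c A by (intro fmeasurable_Int_fmeasurable) (auto simp: measurable_colorings_def)
  have "measure lebesgue (A \<inter> f -` {c}) \<le> measure lebesgue (A \<inter> g -` {c}) + measure lebesgue ?D"
    by (rule order_trans[OF measure_mono_fmeasurable measure_Un_le])
      (use lm[OF fg(1)] lm[OF fg(2)] D A(2) in \<open>auto simp: fmeasurableD\<close>)
  moreover have "measure lebesgue (A \<inter> g -` {c}) \<le> measure lebesgue (A \<inter> f -` {c}) + measure lebesgue ?D"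
    by (rule order_trans[OF measure_mono_fmeasurable measure_Un_le])
      (use lm[OF fg(1)] lm[OF fg(2)] D A(2) in \<open>auto simp: fmeasurableD\<close>)
  ultimately show ?thesis using measure_diff_cube_le_dist[OF n, of f g] by linarith
qed

lemma valid_cuts_subset_cube:
  "valid_cuts n q t \<iota> p a s b \<Longrightarrow> cbox a (\<chi> i. a $ i + s) \<subseteq> centered_cube n"
  by (fastforce simp: valid_cuts_def centered_cube_def mem_box_cart intro: order_trans)

text \<open>
  A change of the coloring by a small distance changes the amount of a color in any subset of the
  cube by a uniformly small amount, so half of the margin survives.
\<close>

lemma robust_colorings_ball:
  fixes f :: "real ^ 'd::finite \<Rightarrow> nat"
  assumes f: "f \<in> robust_colorings k q t n" and n: "n \<ge> 1"
  obtains r where "r > 0"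
    "\<And>g. g \<in> measurable_colorings k \<Longrightarrow> coloring_dist f g < r \<Longrightarrow> g \<in> robust_colorings k q t n"
proof -
  obtain \<delta> where \<delta>: "\<delta> > 0"
    and rob: "\<And>\<iota> p a s b. valid_cuts n q t \<iota> p a s b \<Longrightarrow> \<not> nearly_fair k q t \<delta> f \<iota> p a s b"
    and fm: "f \<in> measurable_colorings k"
    using f by (auto simp: robust_colorings_def)
  define K where "K = 2 ^ n * (2 * real n) ^ CARD('d)"
  have K: "K > 0" using n by (simp add: K_def)
  show ?thesis
  proof
    show "\<delta> / (4 * K) > 0" using \<delta> K by simp
    fix g assume g: "g \<in> measurable_colorings k" and d: "coloring_dist f g < \<delta> / (4 * K)"
    have "\<not> nearly_fair k q t (\<delta> / 2) g \<iota> p a s b" if v: "valid_cuts n q t \<iota> p a s b" for \<iota> p a s b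
    proof
      assume near: "nearly_fair k q t (\<delta> / 2) g \<iota> p a s b"
      have close: "\<bar>measure lebesgue (share t \<iota> p a s b j \<inter> f -` {c}) -
          measure lebesgue (share t \<iota> p a s b j \<inter> g -` {c})\<bar> \<le> \<delta> / 4" if "c \<in> {1..k}" for j c
      proof -
        have "\<bar>measure lebesgue (share t \<iota> p a s b j \<inter> f -` {c}) -
          measure lebesgue (share t \<iota> p a s b j \<inter> g -` {c})\<bar> \<le> K * coloring_dist f g"
          unfolding K_def using valid_cuts_subset_cube[OF v] share_subset
          by (intro measure_color_dist_le[OF fm g that n share_lmeasurable]) blast
        also have "\<dots> \<le> K * (\<delta> / (4 * K))" using d K by (intro mult_left_mono) auto
        finally show ?thesis using K by simp
      qed
      have "nearly_fair k q t \<delta> f \<iota> p a s b"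
        unfolding nearly_fair_def
      proof (intro ballI)
        fix j c assume j: "j \<in> {1..q}" and c: "c \<in> {1..k}"
        have "\<bar>measure lebesgue (share t \<iota> p a s b j \<inter> g -` {c}) -
          measure lebesgue (share t \<iota> p a s b q \<inter> g -` {c})\<bar> \<le> \<delta> / 2"
          using near j c unfolding nearly_fair_def by blast
        then show "\<bar>measure lebesgue (share t \<iota> p a s b j \<inter> f -` {c}) -
          measure lebesgue (share t \<iota> p a s b q \<inter> f -` {c})\<bar> \<le> \<delta>"
          using close[OF c, of j] close[OF c, of q] by linarith
      qed
      with rob[OF v] show False ..
    qed
    then show "g \<in> robust_colorings k q t n"
      unfolding robust_colorings_def using g \<delta> by (auto intro!: exI[of _ "\<delta> / 2"])
  qed
qed

lemma robust_imp_unsplittable: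
  fixes f :: "real ^ 'd::finite \<Rightarrow> nat"
  assumes f: "f \<in> measurable_colorings k" and q: "q \<ge> 1"
    and rob: "\<And>n. n \<ge> 1 \<Longrightarrow> f \<in> robust_colorings k q t n"
  shows "f \<in> unsplittable_colorings k q t"
proof -
  have "\<not> has_fair_splitting k q t f N" if N: "necklace N" for N
  proof
    assume "has_fair_splitting k q t f N"
    from fair_splitting_imp_valid_cuts[OF f q N this]
    obtain n \<iota> p a s b where n: "n \<ge> 1" and v: "valid_cuts n q t \<iota> p a s b"
      and near: "nearly_fair k q t 0 f \<iota> p a s b" .
    obtain \<delta> where \<delta>: "\<delta> > 0" "\<not> nearly_fair k q t \<delta> f \<iota> p a s b"
      using rob[OF n] v unfolding robust_colorings_def by blast
    have "nearly_fair k q t \<delta> f \<iota> p a s b"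
      using near \<delta>(1) unfolding nearly_fair_def by (meson less_imp_le order_trans)
    with \<delta>(2) show False ..
  qed
  then show ?thesis using f by (simp add: unsplittable_colorings_def)
qed

section \<open>Completeness of the space of colorings and Baire category\<close>

lemma coloring_class_eq:
  assumes "F \<in> coloring_space k" "f \<in> F"
  shows "f \<in> measurable_colorings k" "F = coloring_equiv k `` {f}"
proof -
  have "(SOME f. f \<in> F, f) \<in> coloring_equiv k"
    using class_rep(2)[OF assms(1)] assms(2) by blast
  then show "f \<in> measurable_colorings k" by (simp add: coloring_equiv_def)
  show "F = coloring_equiv k `` {f}"
    using class_rep(2)[OF assms(1)] \<open>(SOME f. f \<in> F, f) \<in> coloring_equiv k\<close>
      equiv_class_eq[OF equiv_coloring_equiv] by metis
qed

text \<open>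
  The candidate for the limit of a sequence of colorings that is Cauchy fast enough: such a sequence is eventually
  constant at almost every point. The color 1 is an arbitrary choice on the exceptional null set.
\<close>

lemma eventual_color_measurable:
  fixes g :: "nat \<Rightarrow> real ^ 'd::finite \<Rightarrow> nat"
  assumes g: "\<And>i. g i \<in> measurable_colorings k" and k: "k \<ge> 1"
  defines "h \<equiv> \<lambda>x. if \<exists>c. eventually (\<lambda>i. g i x = c) sequentially
      then THE c. eventually (\<lambda>i. g i x = c) sequentially else 1"
  shows "h \<in> measurable_colorings k"
    and "eventually (\<lambda>i. g i x = c) sequentially \<Longrightarrow> h x = c"
proof -
  have uniq: "c = c'" if "eventually (\<lambda>i. g i x = c) sequentially" "eventually (\<lambda>i. g i x = c') sequentially"
    for x c c'
  proof -
    have "eventually (\<lambda>i :: nat. c = c') sequentially" using that by eventually_elim simp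
    then show ?thesis by simp
  qed
  show hx: "h x = c" if "eventually (\<lambda>i. g i x = c) sequentially" for x c
    unfolding h_def using that uniq by (metis (mono_tags, lifting) the_equality)
  define G where "G c = {x. eventually (\<lambda>i. g i x = c) sequentially}" for c
  have range: "g i x \<in> {1..k}" for i x
  proof -
    have "range (g i) \<subseteq> {1..k}" using g[of i] by (simp add: measurable_colorings_def)
    then show ?thesis by blast
  qed
  have Gr: "c \<in> {1..k}" if "x \<in> G c" for x c
  proof -
    obtain i where "g i x = c" using \<open>x \<in> G c\<close> unfolding G_def eventually_sequentially by blast
    then show ?thesis using range by metis
  qed
  have Gm: "G c \<in> sets lebesgue" if "c \<in> {1..k}" for c
  proof -
    have "G c = (\<Union>N. \<Inter>i\<in>{N..}. g i -` {c})"
      unfolding G_def eventually_sequentially by auto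
    also have "\<dots> \<in> sets lebesgue"
      using g that by (intro sets.countable_UN'' sets.countable_INT'') (auto simp: measurable_colorings_def)
    finally show ?thesis .
  qed
  have hG: "h -` {c} = G c \<union> (if c = 1 then - (\<Union>c\<in>{1..k}. G c) else {})" for c
  proof (rule set_eqI)
    fix x
    show "x \<in> h -` {c} \<longleftrightarrow> x \<in> G c \<union> (if c = 1 then - (\<Union>c\<in>{1..k}. G c) else {})"
    proof (cases "\<exists>c. x \<in> G c")
      case True
      then obtain c' where c': "x \<in> G c'" by blast
      then have "h x = c'" using hx by (simp add: G_def)
      moreover have "x \<in> G c \<longleftrightarrow> c = c'" using c' uniq unfolding G_def by blast
      ultimately show ?thesis using Gr[OF c'] c' by auto
    next
      case False
      then have "h x = 1" by (auto simp: h_def G_def)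
      then show ?thesis using False by auto
    qed
  qed
  have "h x \<in> {1..k}" for x
  proof (cases "\<exists>c. x \<in> G c")
    case True
    then show ?thesis using hx Gr unfolding G_def by blast
  next
    case False
    then show ?thesis using k by (auto simp: h_def G_def)
  qed
  moreover have "h -` {c} \<in> sets lebesgue" if "c \<in> {1..k}" for c
  proof -
    have "(\<Union>c\<in>{1..k}. G c) \<in> sets lebesgue"
      using Gm by (intro sets.finite_UN) auto
    then have "- (\<Union>c\<in>{1..k}. G c) \<in> sets lebesgue"
      by (simp only: Compl_in_sets_lebesgue)
    then show ?thesis unfolding hG using Gm[OF that] by auto
  qed
  ultimately show "h \<in> measurable_colorings k" by (auto simp: measurable_colorings_def)
qed

lemma coloring_dist_tendsto_0:
  fixes g :: "nat \<Rightarrow> real ^ 'd::finite \<Rightarrow> nat"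
  assumes "\<And>n. n \<ge> 1 \<Longrightarrow> (\<lambda>i. measure lebesgue {x \<in> centered_cube n. g i x \<noteq> h x}) \<longlonglongrightarrow> 0"
  shows "(\<lambda>i. coloring_dist (g i) h) \<longlonglongrightarrow> 0"
proof -
  let ?a = "\<lambda>n i. (1/2) ^ Suc n * measure lebesgue {x \<in> centered_cube (Suc n). g i x \<noteq> h x}
            / (2 * real (Suc n)) ^ CARD('d)"
  have "((\<lambda>i. \<Sum>n. ?a n i) \<longlongrightarrow> (\<Sum>n. 0)) sequentially"
  proof (rule tannerys_theorem[THEN conjunct2, THEN conjunct2])
    show "(?a n \<longlongrightarrow> 0) sequentially" for n
    proof -
      have "(?a n \<longlongrightarrow> (1/2) ^ Suc n * 0 / (2 * real (Suc n)) ^ CARD('d)) sequentially"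
        by (intro tendsto_divide tendsto_mult tendsto_const assms) auto
      then show ?thesis by simp
    qed
    show "summable (\<lambda>n. (1/2 :: real) ^ Suc n)" using power_half_series by (simp add: sums_iff)
    have "norm (?a n i) \<le> (1/2) ^ Suc n" for n i
    proof -
      have "measure lebesgue {x \<in> centered_cube (Suc n). g i x \<noteq> h x} / (2 * real (Suc n)) ^ CARD('d) \<le> 1"
        using diff_cube_measure_le[of "Suc n" "g i" h] by (simp add: divide_le_eq_1)
      then have "(1/2) ^ Suc n * (measure lebesgue {x \<in> centered_cube (Suc n). g i x \<noteq> h x}
          / (2 * real (Suc n)) ^ CARD('d)) \<le> (1/2) ^ Suc n * 1"
        by (intro mult_left_mono) auto
      then show ?thesis by simp
    qed
    then show "\<forall>\<^sub>F (n, i) in sequentially \<times>\<^sub>F sequentially. norm (?a n i) \<le> (1/2) ^ Suc n"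
      by (intro always_eventually) auto
  qed simp
  then show ?thesis by (simp add: coloring_dist_def)
qed

text \<open>
  A point where the \<open>i\<close>-th coloring differs from the limit must change its color at some later step,
  so its set is covered by the sets of change of all later steps, whose measures form a geometric series.
\<close>

lemma measure_diff_eventual_color_le:
  fixes g :: "nat \<Rightarrow> real ^ 'd::finite \<Rightarrow> nat"
  assumes g: "\<And>i. g i \<in> measurable_colorings k" and h: "h \<in> measurable_colorings k"
    and lim: "\<And>x c. eventually (\<lambda>i. g i x = c) sequentially \<Longrightarrow> h x = c"
    and d: "\<And>i. coloring_dist (g i) (g (Suc i)) \<le> (1/2) ^ i" and n: "n \<ge> 1"
  shows "measure lebesgue {x \<in> centered_cube n. g i x \<noteq> h x}
    \<le> 2 ^ n * (2 * real n) ^ CARD('d) * (2 * (1/2) ^ i)"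
proof -
  define K where "K = 2 ^ n * (2 * real n) ^ CARD('d)"
  let ?E = "\<lambda>m. {x \<in> centered_cube n. g (m + i) x \<noteq> g (Suc (m + i)) x}"
  have Elm: "?E m \<in> lmeasurable" for m using diff_cube_lmeasurable[OF g g] .
  have Em: "measure lebesgue (?E m) \<le> K * ((1/2) ^ m * (1/2) ^ i)" for m
  proof -
    have "measure lebesgue (?E m) \<le> K * coloring_dist (g (m + i)) (g (Suc (m + i)))"
      unfolding K_def by (rule measure_diff_cube_le_dist[OF n])
    also have "\<dots> \<le> K * (1/2) ^ (m + i)" using d[of "m + i"] by (intro mult_left_mono) (auto simp: K_def)
    finally show ?thesis by (simp add: power_add)
  qed
  have sums: "(\<lambda>m. K * ((1/2) ^ m * (1/2) ^ i)) sums (K * (2 * (1/2) ^ i))"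
    using geometric_sums[of "1/2 :: real"] by (intro sums_mult sums_mult2) simp
  have summ: "summable (\<lambda>m. measure lebesgue (?E m))"
    by (rule summable_comparison_test'[OF sums_summable[OF sums]]) (use Em in simp)
  have sub: "{x \<in> centered_cube n. g i x \<noteq> h x} \<subseteq> (\<Union>m. ?E m)"
  proof
    fix x assume x: "x \<in> {x \<in> centered_cube n. g i x \<noteq> h x}"
    show "x \<in> (\<Union>m. ?E m)"
    proof (rule ccontr)
      assume "x \<notin> (\<Union>m. ?E m)"
      then have step: "g (Suc (m + i)) x = g (m + i) x" for m using x by auto
      have "g (m + i) x = g i x" for m by (induction m) (use step in auto)
      then have "eventually (\<lambda>j. g j x = g i x) sequentially"
        unfolding eventually_sequentially by (metis le_add_diff_inverse2)
      then show False using lim x by auto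
    qed
  qed
  have eE: "emeasure lebesgue (?E m) = ennreal (measure lebesgue (?E m))" for m
    using Elm[of m] by (simp add: emeasure_eq_measure2)
  have fin: "(\<Sum>m. emeasure lebesgue (?E m)) \<noteq> \<infinity>"
    unfolding eE infinity_ennreal_def by (subst suminf_ennreal2[OF _ summ]) simp_all
  have "measure lebesgue {x \<in> centered_cube n. g i x \<noteq> h x} \<le> measure lebesgue (\<Union>m. ?E m)"
  proof (rule measure_mono_fmeasurable[OF sub])
    show "{x \<in> centered_cube n. g i x \<noteq> h x} \<in> sets lebesgue"
      using diff_cube_lmeasurable[OF g h] by (rule fmeasurableD)
    show "(\<Union>m. ?E m) \<in> lmeasurable"
      by (rule fmeasurableI2[of "centered_cube n"]) (use Elm in \<open>auto simp: centered_cube_def fmeasurableD\<close>)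
  qed
  also have "\<dots> \<le> (\<Sum>m. measure lebesgue (?E m))"
    using Elm fin by (intro measure_subadditive_countably) (auto simp: fmeasurableD)
  also have "\<dots> \<le> (\<Sum>m. K * ((1/2) ^ m * (1/2) ^ i))"
    by (intro suminf_le Em summ sums_summable[OF sums])
  also have "\<dots> = K * (2 * (1/2) ^ i)" using sums_unique[OF sums] by simp
  finally show ?thesis by (simp add: K_def)
qed

text \<open>
  As for $L^1$: a subsequence with distances below \<open>2^-i\<close> converges pointwise almost everywhere.
\<close>

theorem mcomplete_coloring_space:
  assumes k: "k \<ge> 1"
  shows "Metric_space.mcomplete (coloring_space k :: (real ^ 'd::finite \<Rightarrow> nat) set set) class_dist"
proof -
  interpret M: Metric_space "coloring_space k :: (real ^ 'd::finite \<Rightarrow> nat) set set" class_dist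
    by (rule Metric_space_coloring_space)
  show ?thesis
    unfolding M.mcomplete_def
  proof (intro allI impI)
    fix \<sigma> :: "nat \<Rightarrow> (real ^ 'd \<Rightarrow> nat) set"
    assume cau: "M.MCauchy \<sigma>"
    have "\<forall>i. \<exists>N. \<forall>n n'. N \<le> n \<longrightarrow> N \<le> n' \<longrightarrow> class_dist (\<sigma> n) (\<sigma> n') < (1/2) ^ i"
    proof
      fix i
      have "(1/2 :: real) ^ i > 0" by simp
      with cau show "\<exists>N. \<forall>n n'. N \<le> n \<longrightarrow> N \<le> n' \<longrightarrow> class_dist (\<sigma> n) (\<sigma> n') < (1/2) ^ i"
        unfolding M.MCauchy_def by blast
    qed
    from choice[OF this] obtain N where
      N: "\<And>i n n'. N i \<le> n \<Longrightarrow> N i \<le> n' \<Longrightarrow> class_dist (\<sigma> n) (\<sigma> n') < (1/2) ^ i" by blast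
    define r where "r i = (\<Sum>l\<le>i. Suc (N l))" for i
    have r: "strict_mono r" by (simp add: strict_mono_Suc_iff r_def)
    have rN: "N i \<le> r i" for i
      unfolding r_def using member_le_sum[of i "{..i}" "\<lambda>l. Suc (N l)"] by simp
    define g where "g i = (SOME f. f \<in> \<sigma> (r i))" for i
    have \<sigma>: "\<sigma> i \<in> coloring_space k" for i using cau unfolding M.MCauchy_def by blast
    have g: "g i \<in> measurable_colorings k" "\<sigma> (r i) = coloring_equiv k `` {g i}" for i
      unfolding g_def using class_rep[OF \<sigma>] by auto
    have dist: "coloring_dist (g i) (g (Suc i)) \<le> (1/2) ^ i" for i
    proof -
      have "r i < r (Suc i)" using r by (simp add: strict_mono_Suc_iff)
      then have "class_dist (\<sigma> (r i)) (\<sigma> (r (Suc i))) < (1/2) ^ i"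
        using rN[of i] by (intro N) auto
      then show ?thesis by (simp add: class_dist_def g_def)
    qed
    define h where "h x = (if \<exists>c. eventually (\<lambda>i. g i x = c) sequentially
      then THE c. eventually (\<lambda>i. g i x = c) sequentially else 1)" for x
    note h = eventual_color_measurable[of g k, OF g(1) k, folded h_def]
    have lim: "(\<lambda>i. coloring_dist (g i) h) \<longlonglongrightarrow> 0"
    proof (rule coloring_dist_tendsto_0)
      fix n :: nat assume n: "n \<ge> 1"
      have null: "(\<lambda>i. 2 ^ n * (2 * real n) ^ CARD('d) * (2 * (1/2) ^ i)) \<longlonglongrightarrow>
          2 ^ n * (2 * real n) ^ CARD('d) * (2 * 0)"
        by (intro tendsto_mult tendsto_const LIMSEQ_power_zero) simp
      show "(\<lambda>i. measure lebesgue {x \<in> centered_cube n. g i x \<noteq> h x}) \<longlonglongrightarrow> 0"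
      proof (rule Lim_null_comparison)
        show "(\<lambda>i. 2 ^ n * (2 * real n) ^ CARD('d) * (2 * (1/2) ^ i)) \<longlonglongrightarrow> 0"
          using null by simp
        show "\<forall>\<^sub>F i in sequentially. norm (measure lebesgue {x \<in> centered_cube n. g i x \<noteq> h x})
            \<le> 2 ^ n * (2 * real n) ^ CARD('d) * (2 * (1/2) ^ i)"
          using measure_diff_eventual_color_le[of g k h, OF g(1) h dist n] by simp
      qed
    qed
    have class_h: "class_dist (\<sigma> (r i)) (coloring_equiv k `` {h}) = coloring_dist (g i) h" for i
      unfolding g(2) by (rule class_dist_class[OF g(1) h(1)])
    have "limitin M.mtopology (\<sigma> \<circ> r) (coloring_equiv k `` {h}) sequentially"
      unfolding M.limitin_metric
    proof (intro conjI allI impI)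
      show "coloring_equiv k `` {h} \<in> coloring_space k"
        using h(1) by (simp add: coloring_space_def quotientI)
      fix \<epsilon> :: real assume e: "\<epsilon> > 0"
      from order_tendstoD(2)[OF lim e]
      have "\<forall>\<^sub>F i in sequentially. coloring_dist (g i) h < \<epsilon>" .
      then show "\<forall>\<^sub>F i in sequentially. (\<sigma> \<circ> r) i \<in> coloring_space k \<and>
          class_dist ((\<sigma> \<circ> r) i) (coloring_equiv k `` {h}) < \<epsilon>"
        by eventually_elim (simp add: \<sigma> class_h)
    qed
    then show "\<exists>x. limitin M.mtopology \<sigma> x sequentially"
      using M.MCauchy_convergent_subsequence[OF cau r] by blast
  qed
qed

text \<open>
  Robustness is not affected by null sets, by the lemma on balls applied at distance zero. Hence the
  classes that meet the robust colorings at level \<open>n\<close> form an open dense set, and all members of a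
  class in the intersection over \<open>n\<close> are robust at every level.
\<close>

theorem unsplittable_dense_if_robust_dense:
  fixes k q t :: nat
  assumes k: "k \<ge> 1" and q: "q \<ge> 1"
    and dense: "\<And>n (f :: real ^ 'd::finite \<Rightarrow> nat) \<epsilon>. n \<ge> 1 \<Longrightarrow> f \<in> measurable_colorings k \<Longrightarrow> \<epsilon> > 0
      \<Longrightarrow> \<exists>g\<in>robust_colorings k q t n. coloring_dist f g < \<epsilon>"
  shows "(\<exists>f :: real ^ 'd \<Rightarrow> nat. f \<in> unsplittable_colorings k q t) \<and>
         Metric_space.mtopology (coloring_space k) class_dist closure_of
           ((\<lambda>f :: real ^ 'd \<Rightarrow> nat. coloring_equiv k `` {f}) ` unsplittable_colorings k q t)
         = coloring_space k"
proof -
  interpret M: Metric_space "coloring_space k :: (real ^ 'd::finite \<Rightarrow> nat) set set" class_dist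
    by (rule Metric_space_coloring_space)
  define W :: "nat \<Rightarrow> (real ^ 'd \<Rightarrow> nat) set set" where "W n = {F \<in> coloring_space k. F \<inter> robust_colorings k q t (Suc n) \<noteq> {}}" for n
  have rob_m: "f \<in> measurable_colorings k" if "f \<in> robust_colorings k q t n" for f :: "real ^ 'd \<Rightarrow> nat" and n
    using that by (simp add: robust_colorings_def)
  have mem_class: "f \<in> coloring_equiv k `` {f}" "coloring_equiv k `` {f} \<in> coloring_space k"
    if "f \<in> measurable_colorings k" for f :: "real ^ 'd \<Rightarrow> nat"
    using that equiv_class_self[OF equiv_coloring_equiv] by (auto simp: coloring_space_def quotientI)
  have "openin M.mtopology (W n)" for n
    unfolding M.openin_mtopology
  proof (intro conjI allI impI)
    show "W n \<subseteq> coloring_space k" by (auto simp: W_def)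
    fix F assume "F \<in> W n"
    then obtain f where F: "F \<in> coloring_space k" and f: "f \<in> F" "f \<in> robust_colorings k q t (Suc n)"
      by (auto simp: W_def)
    obtain r where r: "r > 0" "\<And>g. g \<in> measurable_colorings k \<Longrightarrow> coloring_dist f g < r
        \<Longrightarrow> g \<in> robust_colorings k q t (Suc n)"
      using robust_colorings_ball[OF f(2)] by auto
    have "M.mball F r \<subseteq> W n"
    proof
      fix G assume "G \<in> M.mball F r"
      then have G: "G \<in> coloring_space k" and d: "class_dist F G < r" by auto
      define g where "g = (SOME g. g \<in> G)"
      have g: "g \<in> measurable_colorings k" "G = coloring_equiv k `` {g}"
        unfolding g_def using class_rep[OF G] by auto
      have "class_dist F G = coloring_dist f g"
        using coloring_class_eq[OF F f(1)] g by (metis class_dist_class)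
      then have "g \<in> robust_colorings k q t (Suc n)" using r(2) g(1) d by simp
      then show "G \<in> W n" using G g mem_class(1)[OF g(1)] by (auto simp: W_def)
    qed
    then show "\<exists>r>0. M.mball F r \<subseteq> W n" using r(1) by blast
  qed
  moreover have "M.mtopology closure_of (W n) = coloring_space k" for n
  proof -
    have "F \<in> M.mtopology closure_of (W n)" if F: "F \<in> coloring_space k" for F
      unfolding M.metric_closure_of
    proof (intro CollectI conjI allI impI F)
      fix r :: real assume r: "r > 0"
      define f where "f = (SOME f. f \<in> F)"
      have f: "f \<in> measurable_colorings k" "F = coloring_equiv k `` {f}"
        unfolding f_def using class_rep[OF F] by auto
      obtain g where g: "g \<in> robust_colorings k q t (Suc n)" "coloring_dist f g < r"
        using dense[of "Suc n", OF _ f(1) r] by auto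
      have "class_dist F (coloring_equiv k `` {g}) < r"
        using g(2) f class_dist_class[OF f(1) rob_m[OF g(1)]] by simp
      then have "coloring_equiv k `` {g} \<in> W n \<inter> M.mball F r"
        using g(1) mem_class[OF rob_m[OF g(1)]] F by (auto simp: W_def)
      then show "\<exists>G\<in>W n. G \<in> M.mball F r" by blast
    qed
    then show ?thesis using closure_of_subset_topspace[of M.mtopology "W n"] by auto
  qed
  ultimately have clos: "M.mtopology closure_of (\<Inter>(range W)) = coloring_space k"
    by (intro M.metric_Baire_category mcomplete_coloring_space[OF k]) auto
  have sub: "\<Inter>(range W) \<subseteq> (\<lambda>f. coloring_equiv k `` {f}) ` unsplittable_colorings k q t"
  proof
    fix F assume F: "F \<in> \<Inter>(range W)"
    then have F': "F \<in> coloring_space k" by (auto simp: W_def)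
    define f where "f = (SOME f. f \<in> F)"
    have f: "f \<in> measurable_colorings k" "F = coloring_equiv k `` {f}"
      unfolding f_def using class_rep[OF F'] by auto
    have "f \<in> robust_colorings k q t n" if n: "n \<ge> 1" for n
    proof -
      obtain m where m: "n = Suc m" using n by (cases n) auto
      obtain g where g: "g \<in> F" "g \<in> robust_colorings k q t n" using F by (auto simp: W_def m)
      have "coloring_dist g f = 0"
        using coloring_class_eq[OF F' g(1)] f F' class_dist_class M.mdist_zero by metis
      then show ?thesis
        using robust_colorings_ball[OF g(2) n] f(1) by metis
    qed
    then have "f \<in> unsplittable_colorings k q t"
      by (intro robust_imp_unsplittable[OF f(1) q])
    then show "F \<in> (\<lambda>f. coloring_equiv k `` {f}) ` unsplittable_colorings k q t"
      using f(2) by blast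
  qed
  have clos': "M.mtopology closure_of ((\<lambda>f. coloring_equiv k `` {f}) ` unsplittable_colorings k q t)
      = coloring_space k" (is "M.mtopology closure_of ?U = _")
    using closure_of_mono[OF sub, of M.mtopology] clos
      closure_of_subset_topspace[of M.mtopology ?U] by auto
  have "?U \<noteq> {}"
  proof
    assume "?U = {}"
    then have "M.mtopology closure_of ?U = {}" by simp
    with clos' have "coloring_space k = ({} :: (real ^ 'd \<Rightarrow> nat) set set)" by simp
    moreover have "(\<lambda>x. 1) \<in> (measurable_colorings k :: (real ^ 'd \<Rightarrow> nat) set)"
      using k by (auto simp: measurable_colorings_def vimage_def)
    ultimately show False using mem_class(2) by blast
  qed
  then show ?thesis using clos' by blast
qed

section \<open>A counting principle\<close>

text \<open>
  The discrete substitute for a transversality argument: if the coordinates in \<open>J\<close> are determined by the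
  others up to an error \<open>C\<close>, then \<open>J\<close> contributes a bounded factor instead of a power of \<open>L\<close>. Each
  fibre of the restriction to \<open>I - J\<close> lies in a cube of side \<open>2 * C + 1\<close> around any of its points.
\<close>

lemma card_le_if_spread_small:
  fixes S :: "('i \<Rightarrow> nat) set"
  assumes I: "finite I" "J \<subseteq> I" and S: "S \<subseteq> I \<rightarrow>\<^sub>E {..<L}"
    and spread: "\<And>u v i. u \<in> S \<Longrightarrow> v \<in> S \<Longrightarrow> (\<And>i. i \<in> I - J \<Longrightarrow> u i = v i) \<Longrightarrow> i \<in> J \<Longrightarrow> u i \<le> v i + C"
  shows "card S \<le> (2 * C + 1) ^ card J * L ^ (card I - card J)"
proof -
  define \<phi> where "\<phi> u = restrict u (I - J)" for u :: "'i \<Rightarrow> nat"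
  define \<rho> where "\<rho> w = (SOME u. u \<in> S \<and> \<phi> u = w)" for w
  have \<rho>: "\<rho> (\<phi> u) \<in> S" "\<phi> (\<rho> (\<phi> u)) = \<phi> u" if "u \<in> S" for u
    using someI[of "\<lambda>v. v \<in> S \<and> \<phi> v = \<phi> u" u] that by (auto simp: \<rho>_def)
  have agree: "u i = v i" if "\<phi> u = \<phi> v" "i \<in> I - J" for u v i
    using fun_cong[OF that(1), of i] that(2) by (simp add: \<phi>_def)
  have near: "u i \<le> \<rho> (\<phi> u) i + C" "\<rho> (\<phi> u) i \<le> u i + C" if "u \<in> S" "i \<in> J" for u i
    using spread[OF that(1) \<rho>(1)[OF that(1)] _ that(2)] spread[OF \<rho>(1)[OF that(1)] that(1) _ that(2)]
      agree[OF \<rho>(2)[OF that(1)]] by metis+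
  define \<psi> where "\<psi> u = (\<phi> u, \<lambda>i\<in>J. u i + C - \<rho> (\<phi> u) i)" for u
  have "inj_on \<psi> S"
  proof (rule inj_onI)
    fix u v assume u: "u \<in> S" and v: "v \<in> S" and eq: "\<psi> u = \<psi> v"
    then have \<phi>: "\<phi> u = \<phi> v" by (simp add: \<psi>_def)
    have "u i = v i" if i: "i \<in> J" for i
    proof -
      have "snd (\<psi> u) i = snd (\<psi> v) i" using eq by simp
      then have "u i + C - \<rho> (\<phi> u) i = v i + C - \<rho> (\<phi> v) i"
        using i by (simp add: \<psi>_def)
      then show ?thesis using near[OF u i] near[OF v i] \<phi> by simp
    qed
    moreover have "u i = v i" if "i \<in> I - J" for i using agree[OF \<phi> that] .
    moreover have "u i = v i" if "i \<notin> I" for i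
      using S u v that by (metis PiE_arb subsetD)
    ultimately show "u = v" by blast
  qed
  moreover have "\<psi> ` S \<subseteq> ((I - J) \<rightarrow>\<^sub>E {..<L}) \<times> (J \<rightarrow>\<^sub>E {..2 * C})"
  proof
    fix w assume "w \<in> \<psi> ` S"
    then obtain u where u: "u \<in> S" "w = \<psi> u" by blast
    have "\<phi> u \<in> (I - J) \<rightarrow>\<^sub>E {..<L}"
      using PiE_mem[OF subsetD[OF S u(1)]] by (auto simp: \<phi>_def)
    moreover have "(\<lambda>i\<in>J. u i + C - \<rho> (\<phi> u) i) \<in> J \<rightarrow>\<^sub>E {..2 * C}"
      using near(1)[OF u(1)] by (fastforce simp: algebra_simps)
    ultimately show "w \<in> ((I - J) \<rightarrow>\<^sub>E {..<L}) \<times> (J \<rightarrow>\<^sub>E {..2 * C})"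
      using u(2) by (simp add: \<psi>_def)
  qed
  moreover have J: "finite J" using I finite_subset by blast
  ultimately have "card S \<le> card (((I - J) \<rightarrow>\<^sub>E {..<L}) \<times> (J \<rightarrow>\<^sub>E {..2 * C}))"
    using I by (intro card_inj_on_le finite_cartesian_product finite_PiE) auto
  also have "\<dots> = (2 * C + 1) ^ card J * L ^ (card I - card J)"
    using I J by (simp add: card_cartesian_product card_funcsetE card_Diff_subset)
  finally show ?thesis .
qed

section \<open>Recoloring thin stripes\<close>

lemma half_open_box:
  fixes A B :: "'d::finite \<Rightarrow> real"
  assumes "\<And>i. A i \<le> B i"
  shows "{x :: real ^ 'd. \<forall>i. A i \<le> x $ i \<and> x $ i < B i} \<in> lmeasurable"
    and "measure lebesgue {x :: real ^ 'd. \<forall>i. A i \<le> x $ i \<and> x $ i < B i} = (\<Prod>i\<in>UNIV. B i - A i)"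
proof -
  let ?H = "{x :: real ^ 'd. \<forall>i. A i \<le> x $ i \<and> x $ i < B i}"
  let ?C = "cbox (\<chi> i. A i) (\<chi> i. B i)"
  have "(?C - ?H) \<union> (?H - ?C) \<subseteq> (\<Union>i\<in>UNIV. {x. x $ i = B i})"
  proof
    fix x assume "x \<in> (?C - ?H) \<union> (?H - ?C)"
    then have x: "x \<in> ?C" "x \<notin> ?H" by (auto simp: mem_box_cart less_imp_le)
    then obtain i where "\<not> (A i \<le> x $ i \<and> x $ i < B i)" by blast
    moreover have "A i \<le> x $ i" "x $ i \<le> B i" using x(1) by (auto simp: mem_box_cart)
    ultimately have "x $ i = B i" by simp
    then show "x \<in> (\<Union>i\<in>UNIV. {x. x $ i = B i})" by blast
  qed
  moreover have "negligible (\<Union>i\<in>UNIV. {x :: real ^ 'd. x $ i = B i})"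
    by (intro negligible_Union) (auto intro: negligible_component_eq)
  ultimately have neg: "negligible ((?C - ?H) \<union> (?H - ?C))" by (rule negligible_subset[rotated])
  show "?H \<in> lmeasurable"
    using lmeasurable_negligible_symdiff[OF _ neg] by simp
  have ne: "?C \<noteq> {}" using assms by (simp add: interval_ne_empty_cart)
  have "measure lebesgue ?H = measure lebesgue ?C"
    using measure_negligible_symdiff[OF _ neg] by simp
  also have "\<dots> = (\<Prod>i\<in>UNIV. B i - A i)" using content_cbox_cart[OF ne] by simp
  finally show "measure lebesgue ?H = (\<Prod>i\<in>UNIV. B i - A i)" .
qed

definition grid_cell :: "nat \<Rightarrow> real ^ 'd::finite \<Rightarrow> 'd \<Rightarrow> int"
  where "grid_cell G x = (\<lambda>i. \<lfloor>real G * x $ i\<rfloor>)"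

text \<open>
  Each cell of the grid of mesh \<open>1 / G\<close> is sliced along the axis \<open>e\<close> into stripes of relative width
  \<open>h\<close>. They are numbered from 1, so that those below \<open>k\<close> are numbered by the colors below \<open>k\<close>.
\<close>

definition stripe :: "nat \<Rightarrow> real \<Rightarrow> 'd \<Rightarrow> real ^ 'd::finite \<Rightarrow> nat"
  where "stripe G h e x = Suc (nat \<lfloor>frac (real G * x $ e) / h\<rfloor>)"

definition stripe_pos :: "nat \<Rightarrow> real \<Rightarrow> 'd \<Rightarrow> real ^ 'd::finite \<Rightarrow> real"
  where "stripe_pos G h e x = frac (frac (real G * x $ e) / h)"

definition stripe_part :: "nat \<Rightarrow> real \<Rightarrow> 'd \<Rightarrow> ('d \<Rightarrow> int) \<Rightarrow> nat \<Rightarrow> real \<Rightarrow> (real ^ 'd::finite) set"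
  where "stripe_part G h e z c \<theta> = {x. grid_cell G x = z \<and> stripe G h e x = c \<and> stripe_pos G h e x < \<theta>}"

lemma stripe_part_measure:
  fixes z :: "'d::finite \<Rightarrow> int"
  assumes G: "G \<ge> 1" and h: "h > 0" and c: "c \<ge> 1" "real c * h \<le> 1" and \<theta>: "0 \<le> \<theta>" "\<theta> \<le> 1"
  shows "stripe_part G h e z c \<theta> \<in> lmeasurable"
    and "measure lebesgue (stripe_part G h e z c \<theta>) = \<theta> * (h / real G ^ CARD('d))"
proof -
  define A where "A i = (real_of_int (z i) + (if i = e then (real c - 1) * h else 0)) / real G" for i
  define B where "B i = (real_of_int (z i) + (if i = e then (real c - 1 + \<theta>) * h else 1)) / real G" for i
  have G0: "real G > 0" using G by simp
  have top: "(real c - 1 + \<theta>) * h \<le> 1"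
  proof -
    have "(real c - 1 + \<theta>) * h \<le> real c * h" using h \<theta> by (intro mult_right_mono) auto
    then show ?thesis using c by simp
  qed
  have cellE: "grid_cell G x = z \<longleftrightarrow> (\<forall>i. real_of_int (z i) \<le> real G * x $ i \<and> real G * x $ i < real_of_int (z i) + 1)" for x
    by (auto simp: grid_cell_def fun_eq_iff floor_eq_iff)
  have iff: "x \<in> stripe_part G h e z c \<theta> \<longleftrightarrow> (\<forall>i. A i \<le> x $ i \<and> x $ i < B i)" for x
  proof -
    define y where "y = real G * x $ e - real_of_int (z e)"
    have 1: "x \<in> stripe_part G h e z c \<theta> \<longleftrightarrow>
        grid_cell G x = z \<and> (real c - 1) * h \<le> y \<and> y < (real c - 1 + \<theta>) * h"
    proof (cases "grid_cell G x = z")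
      case True
      then have "\<lfloor>real G * x $ e\<rfloor> = z e" by (auto simp: grid_cell_def)
      then have y: "frac (real G * x $ e) = y" by (simp add: frac_def y_def)
      then have y0: "y \<ge> 0" using frac_ge_0 by metis
      have "nat \<lfloor>y / h\<rfloor> = c - 1 \<longleftrightarrow> \<lfloor>y / h\<rfloor> = int c - 1"
      proof -
        have "0 \<le> \<lfloor>y / h\<rfloor>" using y0 h by simp
        then show ?thesis using c(1) by linarith
      qed
      also have "\<dots> \<longleftrightarrow> (real c - 1) \<le> y / h \<and> y / h < real c"
        by (simp add: floor_eq_iff)
      finally have s: "stripe G h e x = c \<longleftrightarrow> (real c - 1) \<le> y / h \<and> y / h < real c"
        using c(1) unfolding stripe_def y by auto
      have "frac (y / h) = y / h - (real c - 1)" if "(real c - 1) \<le> y / h" "y / h < real c"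
      proof -
        have "\<lfloor>y / h\<rfloor> = int c - 1" using that by (simp add: floor_eq_iff)
        then show ?thesis by (simp add: frac_def)
      qed
      moreover have "x \<in> stripe_part G h e z c \<theta> \<longleftrightarrow>
          ((real c - 1) \<le> y / h \<and> y / h < real c) \<and> frac (y / h) < \<theta>"
        using True s by (simp add: stripe_part_def stripe_pos_def y)
      ultimately have "x \<in> stripe_part G h e z c \<theta> \<longleftrightarrow> (real c - 1) \<le> y / h \<and> y / h < real c - 1 + \<theta>"
        using \<theta>(2) by (smt (verit))
      also have "\<dots> \<longleftrightarrow> (real c - 1) * h \<le> y \<and> y < (real c - 1 + \<theta>) * h"
        using h by (simp add: pos_le_divide_eq pos_divide_less_eq)
      finally show ?thesis using True by simp
    qed (simp add: stripe_part_def)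
    have AB: "A i \<le> x $ i \<and> x $ i < B i \<longleftrightarrow>
       real_of_int (z i) + (if i = e then (real c - 1) * h else 0) \<le> real G * x $ i \<and>
       real G * x $ i < real_of_int (z i) + (if i = e then (real c - 1 + \<theta>) * h else 1)" for i
      unfolding A_def B_def using G0 by (simp only: pos_le_divide_eq pos_less_divide_eq pos_divide_le_eq mult.commute)
    have ch: "(real c - 1) * h \<ge> 0" using c h by simp
    show ?thesis
      unfolding 1 cellE AB
    proof safe
      fix i
      assume *: "\<forall>i. real_of_int (z i) \<le> real G * x $ i \<and> real G * x $ i < real_of_int (z i) + 1"
        and y: "(real c - 1) * h \<le> y" "y < (real c - 1 + \<theta>) * h"
      show "real_of_int (z i) + (if i = e then (real c - 1) * h else 0) \<le> real G * x $ i"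
        "real G * x $ i < real_of_int (z i) + (if i = e then (real c - 1 + \<theta>) * h else 1)"
        using *[rule_format, of i] y by (auto simp: y_def)
    next
      fix i
      assume *: "\<forall>i. real_of_int (z i) + (if i = e then (real c - 1) * h else 0) \<le> real G * x $ i \<and>
         real G * x $ i < real_of_int (z i) + (if i = e then (real c - 1 + \<theta>) * h else 1)"
      show "real_of_int (z i) \<le> real G * x $ i" "real G * x $ i < real_of_int (z i) + 1"
        using *[rule_format, of i] ch top by (auto split: if_splits)
      show "(real c - 1) * h \<le> y" "y < (real c - 1 + \<theta>) * h"
        using *[rule_format, of e] by (auto simp: y_def)
    qed
  qed
  then have eq: "stripe_part G h e z c \<theta> = {x. \<forall>i. A i \<le> x $ i \<and> x $ i < B i}" by blast
  have AB: "A i \<le> B i" for i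
    unfolding A_def B_def using h \<theta> c by (intro divide_right_mono) (auto intro!: mult_right_mono)
  show "stripe_part G h e z c \<theta> \<in> lmeasurable" unfolding eq by (rule half_open_box(1)[OF AB])
  have "measure lebesgue (stripe_part G h e z c \<theta>) = (\<Prod>i\<in>UNIV. B i - A i)"
    unfolding eq by (rule half_open_box(2)[OF AB])
  also have "\<dots> = (B e - A e) * (\<Prod>i\<in>UNIV - {e}. B i - A i)" by (rule prod.remove) auto
  also have "(\<Prod>i\<in>UNIV - {e}. B i - A i) = (\<Prod>i\<in>UNIV - {e}. 1 / real G)"
    by (intro prod.cong) (auto simp: A_def B_def diff_divide_distrib[symmetric])
  also have "\<dots> = 1 / real G ^ (CARD('d) - 1)" by (simp add: card_Diff_singleton power_one_over)
  also have "B e - A e = \<theta> * h / real G" by (simp add: A_def B_def diff_divide_distrib[symmetric] algebra_simps)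
  also have "\<theta> * h / real G * (1 / real G ^ (CARD('d) - 1)) = \<theta> * (h / real G ^ CARD('d))"
    using power_minus_mult[of "CARD('d)" "real G"] by (simp add: mult.commute)
  finally show "measure lebesgue (stripe_part G h e z c \<theta>) = \<theta> * (h / real G ^ CARD('d))" .
qed

text \<open>
  In each selected cell a fraction \<open>u (z, c) / L\<close> of stripe \<open>c < k\<close> receives color \<open>c\<close> and the rest of it color
  \<open>k\<close>. So \<open>u (z, c)\<close> alone governs how much of color \<open>c\<close> is in the cell \<open>z\<close>, and it does so linearly; color \<open>k\<close>
  absorbs what the others leave over, since the volume of the cell cannot be changed.
\<close>

definition recolor :: "nat \<Rightarrow> nat \<Rightarrow> nat \<Rightarrow> real \<Rightarrow> 'd \<Rightarrow> ('d \<Rightarrow> int) set \<Rightarrow> (real ^ 'd::finite \<Rightarrow> nat) \<Rightarrow>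
    (('d \<Rightarrow> int) \<times> nat \<Rightarrow> nat) \<Rightarrow> real ^ 'd \<Rightarrow> nat"
  where "recolor k L G h e Z f u x =
    (if grid_cell G x \<in> Z \<and> stripe G h e x < k
     then if stripe_pos G h e x < real (u (grid_cell G x, stripe G h e x)) / real L then stripe G h e x else k
     else f x)"

lemma stripe_ge_1: "1 \<le> stripe G h e x"
  by (simp add: stripe_def)

lemma stripe_pos_bounds: "0 \<le> stripe_pos G h e x" "stripe_pos G h e x < 1"
  by (simp_all add: stripe_pos_def frac_ge_0 frac_lt_1)

text \<open>
  The bound \<open>real (k - 1) * h \<le> 1\<close> makes the \<open>k - 1\<close> stripes fit into a cell.
\<close>

locale recoloring =
  fixes k L G :: nat and h :: real and e :: "'d::finite" and Z :: "('d \<Rightarrow> int) set"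
    and f :: "real ^ 'd \<Rightarrow> nat"
  assumes G: "G \<ge> 1" and L: "L \<ge> 1" and h: "h > 0" "real (k - 1) * h \<le> 1" and Z: "finite Z"
    and k: "k \<ge> 1" and f: "f \<in> measurable_colorings k"
begin

abbreviation params :: "(('d \<Rightarrow> int) \<times> nat) set"
  where "params \<equiv> Z \<times> {1..<k}"

abbreviation weights :: "(('d \<Rightarrow> int) \<times> nat \<Rightarrow> nat) set"
  where "weights \<equiv> params \<rightarrow>\<^sub>E {..<L}"

abbreviation rc :: "(('d \<Rightarrow> int) \<times> nat \<Rightarrow> nat) \<Rightarrow> real ^ 'd \<Rightarrow> nat"
  where "rc \<equiv> recolor k L G h e Z f"

definition part_at :: "(('d \<Rightarrow> int) \<times> nat) \<Rightarrow> real \<Rightarrow> (real ^ 'd) set"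
  where "part_at zc \<theta> = stripe_part G h e (fst zc) (snd zc) \<theta>"

lemma part_at_measure:
  assumes "zc \<in> params" "0 \<le> \<theta>" "\<theta> \<le> 1"
  shows "part_at zc \<theta> \<in> lmeasurable" "measure lebesgue (part_at zc \<theta>) = \<theta> * (h / real G ^ CARD('d))"
proof -
  have "real (snd zc) * h \<le> real (k - 1) * h"
    using assms(1) h(1) by (intro mult_right_mono) auto
  then have "real (snd zc) * h \<le> 1" using h(2) by simp
  then show "part_at zc \<theta> \<in> lmeasurable" "measure lebesgue (part_at zc \<theta>) = \<theta> * (h / real G ^ CARD('d))"
    unfolding part_at_def using assms G h(1) by (intro stripe_part_measure; auto)+
qed

lemma weight_fraction:
  assumes "u \<in> weights" "zc \<in> params"
  shows "0 \<le> real (u zc) / real L" "real (u zc) / real L \<le> 1"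
  using assms L PiE_mem[OF assms] by auto

lemma recolored_region: "{x. rc u x \<noteq> f x} \<subseteq> (\<Union>zc\<in>params. part_at zc 1)"
proof
  fix x assume "x \<in> {x. rc u x \<noteq> f x}"
  then have "grid_cell G x \<in> Z \<and> stripe G h e x < k" by (auto simp: recolor_def split: if_splits)
  then have "(grid_cell G x, stripe G h e x) \<in> params" using stripe_ge_1 by auto
  moreover have "x \<in> part_at (grid_cell G x, stripe G h e x) 1"
    by (simp add: part_at_def stripe_part_def stripe_pos_bounds)
  ultimately show "x \<in> (\<Union>zc\<in>params. part_at zc 1)" by blast
qed

lemma rc_measurable:
  assumes u: "u \<in> weights"
  shows "rc u \<in> measurable_colorings k"
proof -
  have rf: "f x \<in> {1..k}" for x
  proof -
    have "range f \<subseteq> {1..k}" using f by (simp add: measurable_colorings_def)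
    then show ?thesis by blast
  qed
  have "rc u x \<in> {1..k}" for x
    using rf[of x] stripe_ge_1[of G h e x] k by (auto simp: recolor_def)
  moreover have "rc u -` {c} \<in> sets lebesgue" if c: "c \<in> {1..k}" for c
  proof -
    have eq: "rc u -` {c} = (f -` {c} - (\<Union>zc\<in>params. part_at zc 1))
        \<union> (\<Union>zc\<in>{zc\<in>params. snd zc = c}. part_at zc (real (u zc) / real L))
        \<union> (if c = k then \<Union>zc\<in>params. part_at zc 1 - part_at zc (real (u zc) / real L) else {})"
      (is "_ = ?R")
    proof (rule set_eqI)
      fix x
      let ?zc = "(grid_cell G x, stripe G h e x)"
      have mem: "x \<in> part_at zc \<theta> \<longleftrightarrow> zc = ?zc \<and> stripe_pos G h e x < \<theta>" for zc \<theta>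
        by (cases zc) (auto simp: part_at_def stripe_part_def)
      have in_params: "?zc \<in> params \<longleftrightarrow> grid_cell G x \<in> Z \<and> stripe G h e x < k"
        using stripe_ge_1 by auto
      show "x \<in> rc u -` {c} \<longleftrightarrow> x \<in> ?R"
      proof (cases "?zc \<in> params")
        case True
        then have "stripe G h e x \<noteq> k" "rc u x = (if stripe_pos G h e x < real (u ?zc) / real L then stripe G h e x else k)"
          using in_params by (auto simp: recolor_def)
        moreover have "x \<in> (\<Union>zc\<in>params. part_at zc 1)"
          using True mem stripe_pos_bounds(2)[of G h e x] by blast
        moreover have "x \<in> (\<Union>zc\<in>{zc\<in>params. snd zc = c}. part_at zc (real (u zc) / real L))
            \<longleftrightarrow> stripe G h e x = c \<and> stripe_pos G h e x < real (u ?zc) / real L"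
          using True mem by auto
        moreover have "x \<in> (\<Union>zc\<in>params. part_at zc 1 - part_at zc (real (u zc) / real L))
            \<longleftrightarrow> \<not> stripe_pos G h e x < real (u ?zc) / real L"
          using True mem stripe_pos_bounds(2)[of G h e x] by auto
        ultimately show ?thesis by (auto split: if_splits)
      next
        case False
        then have "rc u x = f x" using in_params by (auto simp: recolor_def)
        then show ?thesis using False mem by (auto split: if_splits)
      qed
    qed
    have p: "part_at zc 1 \<in> sets lebesgue" "part_at zc (real (u zc) / real L) \<in> sets lebesgue"
      if "zc \<in> params" for zc
      using part_at_measure(1)[OF that] weight_fraction[OF u that] by (auto simp: fmeasurableD)
    have fp: "finite params" using Z by simp
    have "(\<Union>zc\<in>params. part_at zc 1) \<in> sets lebesgue"
      "(\<Union>zc\<in>{zc\<in>params. snd zc = c}. part_at zc (real (u zc) / real L)) \<in> sets lebesgue"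
      "(\<Union>zc\<in>params. part_at zc 1 - part_at zc (real (u zc) / real L)) \<in> sets lebesgue"
      using p fp by (intro sets.finite_UN sets.Diff; auto)+
    moreover have "f -` {c} \<in> sets lebesgue" using f c by (auto simp: measurable_colorings_def)
    ultimately show ?thesis unfolding eq by (intro sets.Un sets.Diff) (auto split: if_splits)
  qed
  ultimately show ?thesis by (auto simp: measurable_colorings_def)
qed

lemma dist_rc_le:
  assumes u: "u \<in> weights"
  shows "coloring_dist f (rc u) \<le> real (card params) * h"
proof -
  have fp: "finite params" using Z by simp
  have p: "part_at zc 1 \<in> lmeasurable" "measure lebesgue (part_at zc 1) \<le> h" if "zc \<in> params" for zc
  proof -
    show "part_at zc 1 \<in> lmeasurable" using part_at_measure(1)[OF that] by simp
    have "h / real G ^ CARD('d) \<le> h / 1"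
      using h(1) G by (intro divide_left_mono one_le_power) auto
    then show "measure lebesgue (part_at zc 1) \<le> h" using part_at_measure(2)[OF that, of 1] by simp
  qed
  have "coloring_dist f (rc u) \<le> measure lebesgue (\<Union>zc\<in>params. part_at zc 1)"
    using recolored_region[of u] fp p(1)
    by (intro coloring_dist_le_measure[OF f rc_measurable[OF u]] fmeasurable.finite_UN) auto
  also have "\<dots> \<le> (\<Sum>zc\<in>params. measure lebesgue (part_at zc 1))"
    using fp p(1) by (intro measure_UNION_le) (auto simp: fmeasurableD)
  also have "\<dots> \<le> (\<Sum>zc\<in>params. h)" using p(2) by (intro sum_mono)
  finally show ?thesis by simp
qed

lemma rc_eq_color_iff:
  assumes c: "c \<in> {1..<k}" and uv: "u (grid_cell G x, c) = v (grid_cell G x, c) \<or> grid_cell G x \<notin> Z"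
  shows "rc u x = c \<longleftrightarrow> rc v x = c"
  using assms by (auto simp: recolor_def)

lemma color_count_unchanged:
  assumes c: "c \<in> {1..<k}" and uv: "\<And>z x. z \<in> Z \<Longrightarrow> x \<in> A \<Longrightarrow> grid_cell G x = z \<Longrightarrow> u (z, c) = v (z, c)"
  shows "A \<inter> rc u -` {c} = A \<inter> rc v -` {c}"
  using rc_eq_color_iff[OF c, of u _ v] uv by blast

lemma color_count_change:
  assumes A: "A \<in> lmeasurable" and z: "z \<in> Z" and sub: "{x. grid_cell G x = z} \<subseteq> A"
    and c: "c \<in> {1..<k}" and u: "u \<in> weights" and v: "v \<in> weights"
    and uv: "\<And>z' x. z' \<in> Z \<Longrightarrow> z' \<noteq> z \<Longrightarrow> x \<in> A \<Longrightarrow> grid_cell G x = z' \<Longrightarrow> u (z', c) = v (z', c)"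
  shows "measure lebesgue (A \<inter> rc u -` {c}) - measure lebesgue (A \<inter> rc v -` {c})
    = (real (u (z, c)) - real (v (z, c))) / real L * (h / real G ^ CARD('d))"
proof -
  have zc: "(z, c) \<in> params" using z c by auto
  have decomp: "measure lebesgue (A \<inter> rc w -` {c}) = measure lebesgue (A \<inter> rc w -` {c} - part_at (z, c) 1)
      + real (w (z, c)) / real L * (h / real G ^ CARD('d))" if w: "w \<in> weights" for w
  proof -
    have lm: "A \<inter> rc w -` {c} \<in> lmeasurable"
      using rc_measurable[OF w] c A by (intro fmeasurable_Int_fmeasurable) (auto simp: measurable_colorings_def)
    have part: "(A \<inter> rc w -` {c}) \<inter> part_at (z, c) 1 = part_at (z, c) (real (w (z, c)) / real L)"
    proof (rule set_eqI)
      fix x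
      have "real (w (z, c)) / real L \<le> 1" using weight_fraction[OF w zc] by simp
      then show "x \<in> (A \<inter> rc w -` {c}) \<inter> part_at (z, c) 1 \<longleftrightarrow> x \<in> part_at (z, c) (real (w (z, c)) / real L)"
        using sub z c by (auto simp: part_at_def stripe_part_def recolor_def split: if_splits)
    qed
    have "measure lebesgue (A \<inter> rc w -` {c})
        = measure lebesgue ((A \<inter> rc w -` {c} - part_at (z, c) 1) \<union> (A \<inter> rc w -` {c}) \<inter> part_at (z, c) 1)"
      by (rule arg_cong[of _ _ "measure lebesgue"]) blast
    also have "\<dots> = measure lebesgue (A \<inter> rc w -` {c} - part_at (z, c) 1)
        + measure lebesgue ((A \<inter> rc w -` {c}) \<inter> part_at (z, c) 1)"
    proof -
      have "A \<inter> rc w -` {c} - part_at (z, c) 1 \<in> lmeasurable"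
        "(A \<inter> rc w -` {c}) \<inter> part_at (z, c) 1 \<in> lmeasurable"
        using lm part_at_measure(1)[OF zc, of 1] by (auto intro: fmeasurable.Diff fmeasurable.Int)
      moreover have "(A \<inter> rc w -` {c} - part_at (z, c) 1) \<inter> ((A \<inter> rc w -` {c}) \<inter> part_at (z, c) 1) = {}"
        by blast
      ultimately show ?thesis by (simp add: measure_Un3)
    qed
    also have "measure lebesgue ((A \<inter> rc w -` {c}) \<inter> part_at (z, c) 1)
        = real (w (z, c)) / real L * (h / real G ^ CARD('d))"
      unfolding part by (rule part_at_measure(2)[OF zc weight_fraction[OF w zc]])
    finally show ?thesis .
  qed
  have "A \<inter> rc u -` {c} - part_at (z, c) 1 = A \<inter> rc v -` {c} - part_at (z, c) 1"
  proof (rule set_eqI)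
    fix x
    show "x \<in> A \<inter> rc u -` {c} - part_at (z, c) 1 \<longleftrightarrow> x \<in> A \<inter> rc v -` {c} - part_at (z, c) 1"
    proof (cases "grid_cell G x = z")
      case True
      have "rc w x \<noteq> c" if "stripe G h e x \<noteq> c" "stripe G h e x < k" for w
        using True z that c by (auto simp: recolor_def)
      moreover have "rc u x = rc v x" if "\<not> stripe G h e x < k"
        using that by (simp add: recolor_def)
      moreover have "stripe G h e x \<noteq> c" if "x \<notin> part_at (z, c) 1"
        using that True stripe_pos_bounds(2)[of G h e x] by (auto simp: part_at_def stripe_part_def)
      ultimately show ?thesis by (cases "stripe G h e x < k") auto
    next
      case False
      then show ?thesis
        using uv[of "grid_cell G x" x] rc_eq_color_iff[OF c, of u x v] by blast
    qed
  qed
  then show ?thesis using decomp[OF u] decomp[OF v] by (simp add: diff_divide_distrib left_diff_distrib)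
qed

end

section \<open>Large parts contain grid cells\<close>

lemma sum_measure_share:
  assumes p: "p \<in> Pow {..<t} \<rightarrow>\<^sub>E {1..q}" and s: "0 \<le> s"
  shows "(\<Sum>j\<in>{1..q}. measure lebesgue (share t \<iota> p (a :: real ^ 'd::finite) s b j)) = s ^ CARD('d)"
proof -
  have "(\<Union>j\<in>{1..q}. share t \<iota> p a s b j) = cbox a (\<chi> i. a $ i + s)"
  proof
    show "(\<Union>j\<in>{1..q}. share t \<iota> p a s b j) \<subseteq> cbox a (\<chi> i. a $ i + s)"
      using share_subset by blast
    show "cbox a (\<chi> i. a $ i + s) \<subseteq> (\<Union>j\<in>{1..q}. share t \<iota> p a s b j)"
    proof
      fix x assume x: "x \<in> cbox a (\<chi> i. a $ i + s)"
      have "p (cuts_below t \<iota> a b x) \<in> {1..q}"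
        by (rule PiE_mem[OF p]) (simp add: cuts_below_subset)
      then show "x \<in> (\<Union>j\<in>{1..q}. share t \<iota> p a s b j)"
        using x by (auto simp: share_def)
    qed
  qed
  moreover have "measure lebesgue (\<Union>j\<in>{1..q}. share t \<iota> p a s b j)
      = (\<Sum>j\<in>{1..q}. measure lebesgue (share t \<iota> p a s b j))"
    by (rule measure_UNION') (auto simp: share_lmeasurable pairwise_def disjnt_def disjnt_share)
  moreover have "measure lebesgue (cbox a (\<chi> i. a $ i + s)) = s ^ CARD('d)"
  proof -
    have "cbox a (\<chi> i. a $ i + s) \<noteq> {}" using s by (simp add: interval_ne_empty_cart)
    then show ?thesis by (simp add: content_cbox_cart)
  qed
  ultimately show ?thesis by simp
qed

text \<open>
  The volumes of the parts add up to \<open>s ^ d\<close> and are pairwise within \<open>2 * \<beta>\<close> of each other.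
\<close>

lemma balanced_share_near_average:
  assumes p: "p \<in> Pow {..<t} \<rightarrow>\<^sub>E {1..q}" and s: "0 \<le> s"
    and bal: "\<forall>j\<in>{1..q}. \<bar>measure lebesgue (share t \<iota> p a s b j) - measure lebesgue (share t \<iota> p a s b q)\<bar> \<le> \<beta>"
    and j: "j \<in> {1..q}"
  shows "\<bar>measure lebesgue (share t \<iota> p (a :: real ^ 'd::finite) s b j) - s ^ CARD('d) / real q\<bar> \<le> 2 * \<beta>"
proof -
  let ?m = "\<lambda>j. measure lebesgue (share t \<iota> p a s b j)"
  have q: "q \<ge> 1" using j by simp
  have "\<bar>real q * ?m j - s ^ CARD('d)\<bar> = \<bar>\<Sum>i\<in>{1..q}. ?m j - ?m i\<bar>"
    by (simp only: sum_subtractf sum_measure_share[OF p s]) simp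
  also have "\<dots> \<le> (\<Sum>i\<in>{1..q}. \<bar>?m j - ?m i\<bar>)" by (rule sum_abs)
  also have "\<dots> \<le> (\<Sum>i\<in>{1..q}. 2 * \<beta>)"
  proof (rule sum_mono)
    fix i assume "i \<in> {1..q}"
    then show "\<bar>?m j - ?m i\<bar> \<le> 2 * \<beta>" using bspec[OF bal j] bspec[OF bal, of i] by linarith
  qed
  finally have "\<bar>real q * ?m j - s ^ CARD('d)\<bar> \<le> real q * (2 * \<beta>)" by simp
  moreover have "real q * ?m j - s ^ CARD('d) = real q * (?m j - s ^ CARD('d) / real q)"
    using q by (simp add: field_simps)
  ultimately have "real q * \<bar>?m j - s ^ CARD('d) / real q\<bar> \<le> real q * (2 * \<beta>)"
    by (simp add: abs_mult)
  then show ?thesis using q by simp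
qed

text \<open>
  One of the at most \<open>2 ^ t\<close> boxes that make up a large part is large itself, and being contained in a
  bounded cube it cannot be thin in any direction. Shrinking it by \<open>2 * r\<close> on all sides leaves it inside the
  same part of every configuration at distance \<open>r\<close>, with room for a grid cell.
\<close>

lemma share_contains_grid_cell:
  fixes a a' :: "real ^ 'd::finite"
  assumes valid: "valid_cuts n q t \<iota> p a s b" and n: "n \<ge> 1"
    and big: "2 * \<eta> * (2 * real n) ^ (CARD('d) - 1) * 2 ^ t < measure lebesgue (share t \<iota> p a s b j)"
    and \<eta>: "0 < \<eta>" "8 \<le> \<eta> * real G" "8 * r \<le> \<eta>" "0 \<le> r"
    and close: "close_cuts t r a s b a' s' b'"
  obtains z where "\<forall>i. - int (n * G) \<le> z i \<and> z i < int (n * G)"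
    "{x. grid_cell G x = z} \<subseteq> share t \<iota> p a' s' b' j"
proof -
  let ?v = "2 * \<eta> * (2 * real n) ^ (CARD('d) - 1)"
  have "\<exists>S\<in>{S \<in> Pow {..<t}. p S = j}. ?v < measure lebesgue (cut_cell t \<iota> a s b S)"
  proof (rule ccontr)
    assume "\<not> ?thesis"
    then have "measure lebesgue (share t \<iota> p a s b j) \<le> (\<Sum>S\<in>{S \<in> Pow {..<t}. p S = j}. ?v)"
      unfolding measure_share by (intro sum_mono) force
    also have "\<dots> \<le> (\<Sum>S\<in>Pow {..<t}. ?v)" using \<eta> by (intro sum_mono2) auto
    also have "\<dots> = ?v * 2 ^ t" by (simp add: card_Pow)
    finally show False using big by simp
  qed
  then obtain S where S: "S \<subseteq> {..<t}" "p S = j" and vol: "?v < measure lebesgue (cut_cell t \<iota> a s b S)"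
    by auto
  let ?Q = "cut_cell t \<iota> a s b S"
  have Q_cube: "?Q \<subseteq> centered_cube n"
    using valid_cuts_subset_cube[OF valid] by (auto simp: cut_cell_def)
  have "\<forall>i. \<exists>x y. x \<in> ?Q \<and> y \<in> ?Q \<and> \<eta> \<le> y $ i - x $ i"
  proof (rule ccontr)
    assume "\<not> ?thesis"
    then obtain i where i: "\<And>x y. x \<in> ?Q \<Longrightarrow> y \<in> ?Q \<Longrightarrow> y $ i - x $ i < \<eta>"
      unfolding not_all not_ex de_Morgan_conj not_le by blast
    have v0: "0 \<le> ?v" using \<eta> by simp
    then have "?Q \<noteq> {}" using vol by force
    then obtain x0 where x0: "x0 \<in> ?Q" by blast
    \<comment> \<open>A cell of extent below \<open>\<eta>\<close> in direction \<open>i\<close> lies in a slab of too small a volume.\<close>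
    have "?Q \<subseteq> {x \<in> centered_cube n. \<bar>x $ i - x0 $ i\<bar> \<le> \<eta>}"
    proof
      fix x assume x: "x \<in> ?Q"
      have "x $ i - x0 $ i < \<eta>" "x0 $ i - x $ i < \<eta>" using i x x0 by blast+
      then show "x \<in> {x \<in> centered_cube n. \<bar>x $ i - x0 $ i\<bar> \<le> \<eta>}" using x Q_cube by auto
    qed
    then have "measure lebesgue ?Q \<le> measure lebesgue {x \<in> centered_cube n. \<bar>x $ i - x0 $ i\<bar> \<le> \<eta>}"
      using measure_slab_le(1)[of \<eta> n i] \<eta>(1)
      by (intro measure_mono_fmeasurable) (auto simp: cut_cell_lmeasurable fmeasurableD)
    also have "\<dots> \<le> ?v" using measure_slab_le(2)[of \<eta> n i] \<eta>(1) by simp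
    finally show False using vol by simp
  qed
  then obtain X Y where X: "\<And>i. X i \<in> ?Q" and Y: "\<And>i. Y i \<in> ?Q" and XY: "\<And>i. \<eta> \<le> Y i $ i - X i $ i"
    by metis
  define lo where "lo i = X i $ i" for i
  define hi where "hi i = Y i $ i" for i
  have G0: "real G > 0" using \<eta>(1,2) by (cases "G = 0") auto
  \<comment> \<open>The box extends from \<open>lo\<close> to \<open>hi\<close>; the cell starts at the first grid point above the lower margin.\<close>
  define z where "z i = \<lceil>real G * (lo i + 2 * r)\<rceil>" for i
  have z1: "real G * (lo i + 2 * r) \<le> real_of_int (z i)" for i by (simp add: z_def)
  have z2: "real_of_int (z i) + 1 \<le> real G * (hi i - 2 * r)" for i
  proof -
    have "real_of_int (z i) < real G * (lo i + 2 * r) + 1" unfolding z_def by linarith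
    then have "real_of_int (z i) + 1 \<le> real G * (lo i + 2 * r) + 2" by simp
    also have "\<dots> \<le> real G * (lo i + 2 * r) + real G * (\<eta> - 4 * r)"
    proof -
      have "\<eta> / 2 * real G \<le> (\<eta> - 4 * r) * real G" using \<eta> G0 by (intro mult_right_mono) auto
      then show ?thesis using \<eta>(2) by (simp add: mult.commute)
    qed
    also have "\<dots> = real G * (lo i + \<eta> - 2 * r)" by (simp add: algebra_simps)
    also have "\<dots> \<le> real G * (hi i - 2 * r)"
      using XY[of i] G0 by (intro mult_left_mono) (auto simp: lo_def hi_def)
    finally show ?thesis .
  qed
  have X': "a $ i \<le> lo i" "l < t \<Longrightarrow> l \<in> S \<Longrightarrow> \<iota> l = i \<Longrightarrow> a $ i + b l < lo i" for i l
    using X[of i] S by (auto simp: cut_cell_def mem_box_cart lo_def cuts_below_def)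
  have Y': "hi i \<le> a $ i + s" "l < t \<Longrightarrow> l \<notin> S \<Longrightarrow> \<iota> l = i \<Longrightarrow> hi i \<le> a $ i + b l" for i l
    using Y[of i] S by (auto simp: cut_cell_def mem_box_cart hi_def cuts_below_def not_less)
  have cl: "\<bar>a $ i - a' $ i\<bar> \<le> r" "\<bar>s - s'\<bar> \<le> r" "l < t \<Longrightarrow> \<bar>b l - b' l\<bar> \<le> r" for i l
    using close by (auto simp: close_cuts_def)
  show ?thesis
  proof
    have box: "- real n \<le> a $ i" "a $ i + s \<le> real n" for i
      using valid by (auto simp: valid_cuts_def)
    show "\<forall>i. - int (n * G) \<le> z i \<and> z i < int (n * G)"
    proof
      fix i
      have "real G * (- real n) \<le> real G * (lo i + 2 * r)"
        using X'(1)[of i] box(1)[of i] \<eta>(4) G0 by (intro mult_left_mono) auto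
      then have 1: "- real n * real G \<le> real_of_int (z i)" using z1[of i] by (simp add: mult.commute)
      have "real G * (hi i - 2 * r) \<le> real G * real n"
        using Y'(1)[of i] box(2)[of i] \<eta>(4) G0 by (intro mult_left_mono) auto
      then have 2: "real_of_int (z i) + 1 \<le> real n * real G" using z2[of i] by (simp add: mult.commute)
      have "real_of_int (- int (n * G)) \<le> real_of_int (z i)" "real_of_int (z i + 1) \<le> real_of_int (int (n * G))"
        using 1 2 by simp_all
      then show "- int (n * G) \<le> z i \<and> z i < int (n * G)" unfolding of_int_le_iff by simp
    qed
    show "{x. grid_cell G x = z} \<subseteq> share t \<iota> p a' s' b' j"
    proof
      fix x assume "x \<in> {x. grid_cell G x = z}"
      then have x: "\<lfloor>real G * x $ i\<rfloor> = z i" for i by (auto simp: grid_cell_def)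
      have lo: "lo i + 2 * r \<le> x $ i" for i
      proof -
        have "real_of_int (z i) \<le> real G * x $ i" using x[of i] by (simp add: floor_eq_iff)
        then have "real G * (lo i + 2 * r) \<le> real G * x $ i" using z1[of i] by simp
        then show ?thesis using G0 by simp
      qed
      have hi: "x $ i \<le> hi i - 2 * r" for i
      proof -
        have "real G * x $ i \<le> real_of_int (z i) + 1" using x[of i] by (simp add: floor_eq_iff)
        then have "real G * x $ i \<le> real G * (hi i - 2 * r)" using z2[of i] by simp
        then show ?thesis using G0 by simp
      qed
      have "a' $ i \<le> x $ i \<and> x $ i \<le> a' $ i + s'" for i
        using lo[of i] hi[of i] X'(1)[of i] Y'(1)[of i] cl(1)[of i] cl(2) \<eta>(4) by linarith
      moreover have "cuts_below t \<iota> a' b' x = S"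
      proof -
        have "a' $ \<iota> l + b' l < x $ \<iota> l \<longleftrightarrow> l \<in> S" if l: "l < t" for l
        proof (cases "l \<in> S")
          case True
          then show ?thesis
            using lo[of "\<iota> l"] X'(2)[OF l True refl] cl(1)[of "\<iota> l"] cl(3)[OF l] by (simp; linarith)
        next
          case False
          then show ?thesis
            using hi[of "\<iota> l"] Y'(2)[OF l False refl] cl(1)[of "\<iota> l"] cl(3)[OF l] by (simp; linarith)
        qed
        then show ?thesis using S(1) by (auto simp: cuts_below_def)
      qed
      ultimately show "x \<in> share t \<iota> p a' s' b' j"
        using S(2) by (simp add: share_def mem_box_cart)
    qed
  qed
qed

lemma grid_cell_nonempty:
  assumes "G \<ge> 1"
  shows "\<exists>x :: real ^ 'd::finite. grid_cell G x = z"
  by (rule exI[of _ "\<chi> i. real_of_int (z i) / real G"]) (use assms in \<open>simp add: grid_cell_def\<close>)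

text \<open>
  Fix the weights of all cells other than the \<open>z j\<close>. For \<open>c < k\<close> the excess of color \<open>c\<close> in part \<open>j\<close> over
  part \<open>q\<close> then depends on \<open>u (z j, c)\<close> only, because the remaining \<open>z i\<close> lie in other parts.
  It changes by \<open>v / L\<close>, with \<open>v\<close> the volume of a stripe, when this weight changes by 1. So a bound of
  order \<open>1 / L\<close> on the excess leaves boundedly many values for the weight.
\<close>

lemma (in recoloring) card_nearly_fair_weights:
  fixes A :: "nat \<Rightarrow> (real ^ 'd) set"
  assumes A: "\<And>j. j \<in> {1..q} \<Longrightarrow> A j \<in> lmeasurable"
    and disj: "\<And>i j. i \<in> {1..q} \<Longrightarrow> j \<in> {1..q} \<Longrightarrow> i \<noteq> j \<Longrightarrow> A i \<inter> A j = {}"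
    and z: "\<And>j. j \<in> {1..<q} \<Longrightarrow> z j \<in> Z" "\<And>j. j \<in> {1..<q} \<Longrightarrow> {x. grid_cell G x = z j} \<subseteq> A j"
    and C: "2 * C1 / (h / real G ^ CARD('d)) \<le> real C2"
  defines "B \<equiv> {u \<in> weights. \<forall>j\<in>{1..<q}. \<forall>c\<in>{1..<k}.
    \<bar>measure lebesgue (A j \<inter> rc u -` {c}) - measure lebesgue (A q \<inter> rc u -` {c})\<bar> \<le> C1 / real L}"
  shows "card B * L ^ ((k - 1) * (q - 1)) \<le> (2 * C2 + 1) ^ ((k - 1) * (q - 1)) * L ^ card params"
proof -
  define J where "J = z ` {1..<q} \<times> {1..<k}"
  let ?v = "h / real G ^ CARD('d)"
  have v: "?v > 0" using h(1) G by simp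
  have not_in: "grid_cell G x \<noteq> z j" if "x \<in> A i" "i \<in> {1..q}" "j \<in> {1..<q}" "i \<noteq> j" for x i j
    using z(2)[OF that(3)] disj[of i j] that by auto
  have "inj_on z {1..<q}"
  proof (rule inj_onI, rule ccontr)
    fix i j assume ij: "i \<in> {1..<q}" "j \<in> {1..<q}" "z i = z j" "i \<noteq> j"
    obtain x :: "real ^ 'd" where "grid_cell G x = z i" using grid_cell_nonempty[OF G] by blast
    then show False using not_in[of x i j] z(2)[OF ij(1)] ij by auto
  qed
  then have cardJ: "card J = (k - 1) * (q - 1)"
    by (simp add: J_def card_cartesian_product card_image mult.commute)
  have fp: "finite params" using Z by simp
  have J: "J \<subseteq> params" using z(1) by (auto simp: J_def)
  have "card B \<le> (2 * C2 + 1) ^ card J * L ^ (card params - card J)"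
  proof (rule card_le_if_spread_small[OF fp J])
    show "B \<subseteq> weights" by (auto simp: B_def)
    fix u v zc assume u: "u \<in> B" and v': "v \<in> B" and eq: "\<And>i. i \<in> params - J \<Longrightarrow> u i = v i" and zc: "zc \<in> J"
    obtain j c where j: "j \<in> {1..<q}" and c: "c \<in> {1..<k}" and zc_eq: "zc = (z j, c)"
      using zc by (auto simp: J_def)
    have w: "u \<in> weights" "v \<in> weights" using u v' by (auto simp: B_def)
    have q': "j \<in> {1..q}" "q \<in> {1..q}" "j \<noteq> q" using j by auto
    have eqz: "u (z', c) = v (z', c)" if "z' \<in> Z" "z' \<notin> z ` {1..<q}" for z'
      using eq[of "(z', c)"] that c by (auto simp: J_def)
    have "measure lebesgue (A j \<inter> rc u -` {c}) - measure lebesgue (A j \<inter> rc v -` {c})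
      = (real (u (z j, c)) - real (v (z j, c))) / real L * ?v"
    proof (rule color_count_change[OF A[OF q'(1)] z(1)[OF j] z(2)[OF j] c w])
      fix z' x assume *: "z' \<in> Z" "z' \<noteq> z j" "x \<in> A j" "grid_cell G x = z'"
      then have "z' \<notin> z ` {1..<q}" using not_in[OF *(3) q'(1)] by (metis imageE)
      then show "u (z', c) = v (z', c)" using eqz *(1) by blast
    qed
    moreover have "measure lebesgue (A q \<inter> rc u -` {c}) = measure lebesgue (A q \<inter> rc v -` {c})"
    proof (rule arg_cong[OF color_count_unchanged[OF c]])
      fix z' x assume *: "z' \<in> Z" "x \<in> A q" "grid_cell G x = z'"
      have "q \<noteq> i" if "i \<in> {1..<q}" for i using that by simp
      then have "z' \<notin> z ` {1..<q}" using not_in[OF *(2) q'(2)] *(3) by (metis imageE)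
      then show "u (z', c) = v (z', c)" using eqz *(1) by blast
    qed
    moreover have "\<bar>measure lebesgue (A j \<inter> rc u -` {c}) - measure lebesgue (A q \<inter> rc u -` {c})\<bar> \<le> C1 / real L"
      "\<bar>measure lebesgue (A j \<inter> rc v -` {c}) - measure lebesgue (A q \<inter> rc v -` {c})\<bar> \<le> C1 / real L"
      using u v' j c by (auto simp: B_def)
    ultimately have "(real (u (z j, c)) - real (v (z j, c))) / real L * ?v \<le> 2 * (C1 / real L)"
      by linarith
    moreover have "y * w \<le> 2 * C1" if "y / real L * w \<le> 2 * (C1 / real L)" for y w :: real
      using that L by (simp add: field_simps)
    ultimately have "(real (u (z j, c)) - real (v (z j, c))) * ?v \<le> 2 * C1" by blast
    then have "real (u (z j, c)) - real (v (z j, c)) \<le> 2 * C1 / ?v"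
      using v by (simp only: pos_le_divide_eq)
    then show "u zc \<le> v zc + C2" using C by (simp add: zc_eq)
  qed
  then have "card B * L ^ card J \<le> (2 * C2 + 1) ^ card J * L ^ (card params - card J) * L ^ card J"
    by (rule mult_right_mono) simp
  also have "\<dots> = (2 * C2 + 1) ^ card J * L ^ card params"
    using card_mono[OF fp J] by (simp add: power_add[symmetric] mult.assoc)
  finally show ?thesis by (simp only: cardJ)
qed

section \<open>Density of the robust colorings\<close>

text \<open>
  The set \<open>U\<close> serves all colorings: besides validity only the equality of volumes, up to \<open>\<beta>\<close>, is
  asked of the configurations that have to be covered.
\<close>

definition covers_balanced :: "nat \<Rightarrow> nat \<Rightarrow> nat \<Rightarrow> real \<Rightarrow> real \<Rightarrow> (nat \<Rightarrow> 'd) \<Rightarrow> (nat set \<Rightarrow> nat) \<Rightarrow>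
    ((real ^ 'd::finite) \<times> real \<times> (nat \<Rightarrow> real)) set \<Rightarrow> bool"
  where "covers_balanced n q t \<beta> r \<iota> p U \<longleftrightarrow>
    (\<forall>a s b. valid_cuts n q t \<iota> p a s b \<longrightarrow>
      (\<forall>j\<in>{1..q}. \<bar>measure lebesgue (share t \<iota> p a s b j) - measure lebesgue (share t \<iota> p a s b q)\<bar> \<le> \<beta>) \<longrightarrow>
      (\<exists>(a', s', b')\<in>U. close_cuts t r a s b a' s' b'))"

lemma nearly_fair_imp_balanced:
  fixes f :: "real ^ 'd::finite \<Rightarrow> nat"
  assumes f: "f \<in> measurable_colorings k" and near: "nearly_fair k q t \<delta> f \<iota> p a s b" and j: "j \<in> {1..q}"
  shows "\<bar>measure lebesgue (share t \<iota> p a s b j) - measure lebesgue (share t \<iota> p a s b q)\<bar> \<le> real k * \<delta>"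
proof -
  let ?S = "share t \<iota> p a s b"
  have split: "measure lebesgue (?S i) = (\<Sum>c\<in>{1..k}. measure lebesgue (?S i \<inter> f -` {c}))" for i
  proof -
    have "range f \<subseteq> {1..k}" using f by (simp add: measurable_colorings_def)
    then have "?S i = (\<Union>c\<in>{1..k}. ?S i \<inter> f -` {c})" by blast
    then have "measure lebesgue (?S i) = measure lebesgue (\<Union>c\<in>{1..k}. ?S i \<inter> f -` {c})" by simp
    also have "\<dots> = (\<Sum>c\<in>{1..k}. measure lebesgue (?S i \<inter> f -` {c}))"
    proof (rule measure_UNION')
      show "?S i \<inter> f -` {c} \<in> lmeasurable" if "c \<in> {1..k}" for c
        using that f by (intro fmeasurable_Int_fmeasurable share_lmeasurable) (auto simp: measurable_colorings_def)
    qed (auto simp: pairwise_def disjnt_def)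
    finally show ?thesis .
  qed
  have "\<bar>measure lebesgue (?S j) - measure lebesgue (?S q)\<bar>
      = \<bar>\<Sum>c\<in>{1..k}. measure lebesgue (?S j \<inter> f -` {c}) - measure lebesgue (?S q \<inter> f -` {c})\<bar>"
    unfolding split[of j] split[of q] sum_subtractf ..
  also have "\<dots> \<le> (\<Sum>c\<in>{1..k}. \<bar>measure lebesgue (?S j \<inter> f -` {c}) - measure lebesgue (?S q \<inter> f -` {c})\<bar>)"
    by (rule sum_abs)
  also have "\<dots> \<le> (\<Sum>c\<in>{1..k}. \<delta>)"
    using near j by (intro sum_mono) (auto simp: nearly_fair_def)
  finally show ?thesis by simp
qed

text \<open>
  Count the choices of weights that are spoilt. If the recoloring is nearly fair within \<open>1 / L\<close> at some valid
  configuration, then it is nearly fair within \<open>C1 / L\<close> at a rounded configuration close to it, whose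
  parts still contain grid cells. Each of the at most \<open>\<epsilon>' * L ^ m\<close> rounded configurations (for each choice of axes
  and labels) spoils at most \<open>(2 * C2 + 1) ^ m * L ^ (card I - m)\<close> of the \<open>L ^ card I\<close> choices.
  The constants \<open>C1\<close> and \<open>C2\<close> do not depend on \<open>L\<close>, so for small \<open>\<epsilon>'\<close> a choice is left over.
\<close>

theorem robust_colorings_dense:
  fixes f :: "real ^ 'd::finite \<Rightarrow> nat"
  assumes k: "k \<ge> 1" and q: "q \<ge> 1" and n: "n \<ge> 1" and C: "C \<ge> 0"
    and net: "\<And>\<epsilon>. \<epsilon> > 0 \<Longrightarrow> \<exists>L0. \<forall>L\<ge>L0. \<forall>(\<iota> :: nat \<Rightarrow> 'd) p. \<exists>U. finite U \<and>
      real (card U) \<le> \<epsilon> * real L ^ ((k - 1) * (q - 1)) \<and>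
      covers_balanced n q t (real k / real L) (C / real L) \<iota> p U"
    and f: "f \<in> measurable_colorings k" and \<epsilon>: "\<epsilon> > 0"
  shows "\<exists>g\<in>robust_colorings k q t n. coloring_dist f g < \<epsilon>"
proof -
  \<comment> \<open>A lower bound for the average volume of a part.\<close>
  define vol where "vol = (1 / real n) ^ CARD('d) / real q"
  define w where "w = 2 * (2 * real n) ^ (CARD('d) - 1) * 2 ^ t"
  \<comment> \<open>Chosen such that a part of volume above \<open>vol / 4\<close> is wide enough to contain a grid cell.\<close>
  define \<eta> where "\<eta> = vol / (4 * w)"
  define G where "G = Suc (nat \<lceil>8 / \<eta>\<rceil>)"
  define Z where "Z = (UNIV :: 'd set) \<rightarrow>\<^sub>E {- int (n * G)..<int (n * G)}"
  define I where "I = Z \<times> {1..<k}"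
  define h where "h = min (1 / real k) (\<epsilon> / (2 * (real (card I) + 1)))"
  define v where "v = h / real G ^ CARD('d)"
  define K where "K = real (2 * CARD('d) + t) * (4 * (2 * real (Suc n)) ^ (CARD('d) - 1))"
  \<comment> \<open>The margin 1 of the recoloring plus the effect of rounding on two parts, in units of \<open>1 / L\<close>.\<close>
  define C1 where "C1 = 1 + 2 * K * C"
  define C2 where "C2 = nat \<lceil>2 * C1 / v\<rceil>"
  define m where "m = (k - 1) * (q - 1)"
  define Axes where "Axes = {..<t} \<rightarrow>\<^sub>E (UNIV :: 'd set)"
  define Labels where "Labels = Pow {..<t} \<rightarrow>\<^sub>E {1..q}"
  define M where "M = real (card Axes) * real (card Labels) * real ((2 * C2 + 1) ^ m)"
  define \<epsilon>' where "\<epsilon>' = 1 / (2 * (M + 1))"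
  have vol: "vol > 0" and w: "w > 0" using n q by (simp_all add: vol_def w_def)
  then have \<eta>: "\<eta> > 0" by (simp add: \<eta>_def)
  have \<eta>w: "2 * \<eta> * (2 * real n) ^ (CARD('d) - 1) * 2 ^ t = vol / 4"
  proof -
    have "2 * \<eta> * (2 * real n) ^ (CARD('d) - 1) * 2 ^ t = \<eta> * w" by (simp add: w_def)
    then show ?thesis using w by (simp add: \<eta>_def)
  qed
  have G: "G \<ge> 1" "8 \<le> \<eta> * real G"
  proof -
    have "8 / \<eta> \<le> real G" unfolding G_def by linarith
    then show "8 \<le> \<eta> * real G" using \<eta> by (simp add: pos_divide_le_eq mult.commute)
  qed (simp add: G_def)
  have finZ: "finite Z" unfolding Z_def by (intro finite_PiE) auto
  have finI: "finite I" using finZ by (simp add: I_def)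
  have h: "h > 0" "real (k - 1) * h \<le> 1" "real (card I) * h < \<epsilon>"
  proof -
    show "h > 0" using k \<epsilon> by (simp add: h_def)
    have "real (k - 1) * h \<le> real k * (1 / real k)" using \<open>h > 0\<close> by (intro mult_mono) (auto simp: h_def)
    then show "real (k - 1) * h \<le> 1" using k by simp
    have "real (card I) * h \<le> real (card I) * (\<epsilon> / (2 * (real (card I) + 1)))"
      by (intro mult_left_mono) (auto simp: h_def)
    also have "\<dots> < \<epsilon>" using \<epsilon> by (simp add: field_simps add_nonneg_pos)
    finally show "real (card I) * h < \<epsilon>" .
  qed
  have C2: "2 * C1 / v \<le> real C2" unfolding C2_def by linarith
  have M: "M \<ge> 0" by (simp add: M_def)
  have \<epsilon>': "\<epsilon>' > 0" "M * \<epsilon>' < 1"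
    using M by (simp_all add: \<epsilon>'_def field_simps add_nonneg_pos)
  obtain L0 where L0: "\<And>L \<iota> p. L \<ge> L0 \<Longrightarrow> \<exists>U. finite U \<and>
      real (card U) \<le> \<epsilon>' * real L ^ m \<and>
      covers_balanced n q t (real k / real L) (C / real L) (\<iota> :: nat \<Rightarrow> 'd) p U"
    using net[OF \<epsilon>'(1)] unfolding m_def by blast
  obtain L1 where L1: "2 * C + 8 * C / \<eta> + 4 * real k / vol + 1 \<le> real L1"
    using real_arch_simple by blast
  define L where "L = max L0 L1"
  have L: "L \<ge> L0" "2 * C + 8 * C / \<eta> + 4 * real k / vol + 1 \<le> real L"
    using L1 by (auto simp: L_def)
  have nonneg: "2 * C \<ge> 0" "8 * C / \<eta> \<ge> 0" "4 * real k / vol \<ge> 0" using C \<eta> vol by simp_all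
  then have L': "L \<ge> 1" "2 * C \<le> real L" "8 * C / \<eta> \<le> real L" "4 * real k / vol \<le> real L"
    using L(2) by linarith+
  define r where "r = C / real L"
  have r: "0 \<le> r" "2 * r \<le> 1" "8 * r \<le> \<eta>" and kL: "real k / real L \<le> vol / 4"
    using L' C \<eta> vol by (auto simp: r_def field_simps)
  interpret R: recoloring k L G h "undefined :: 'd" Z f
    using G L' h finZ k f by unfold_locales auto
  have "\<forall>\<iota> p. \<exists>U. finite U \<and> real (card U) \<le> \<epsilon>' * real L ^ m \<and>
      covers_balanced n q t (real k / real L) r (\<iota> :: nat \<Rightarrow> 'd) p U"
    using L0[OF L(1)] unfolding r_def by blast
  then obtain U where U: "\<And>\<iota> p. finite (U \<iota> p)" "\<And>\<iota> p. real (card (U \<iota> p)) \<le> \<epsilon>' * real L ^ m"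
    "\<And>\<iota> p. covers_balanced n q t (real k / real L) r (\<iota> :: nat \<Rightarrow> 'd) p (U \<iota> p)"
    by metis
  define bad where "bad \<iota> p = (\<lambda>(a, s, b). {u \<in> R.weights.
      (\<forall>j\<in>{1..<q}. \<exists>z\<in>Z. {x. grid_cell G x = z} \<subseteq> share t \<iota> p a s b j) \<and>
      (\<forall>j\<in>{1..<q}. \<forall>c\<in>{1..<k}. \<bar>measure lebesgue (share t \<iota> p a s b j \<inter> R.rc u -` {c})
          - measure lebesgue (share t \<iota> p a s b q \<inter> R.rc u -` {c})\<bar> \<le> C1 / real L)})"
    for \<iota> :: "nat \<Rightarrow> 'd" and p
  have card_weights: "card R.weights = L ^ card I"
    using finI by (simp add: card_funcsetE I_def)
  have card_bad: "real (card (bad \<iota> p \<theta>)) * real L ^ m \<le> real ((2 * C2 + 1) ^ m) * real (L ^ card I)" for \<iota> p \<theta>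
  proof -
    obtain a s b where \<theta>: "\<theta> = (a, s, b)" by (cases \<theta>) auto
    show ?thesis
    proof (cases "\<forall>j\<in>{1..<q}. \<exists>z\<in>Z. {x. grid_cell G x = z} \<subseteq> share t \<iota> p a s b j")
      case True
      then obtain z where z: "\<And>j. j \<in> {1..<q} \<Longrightarrow> z j \<in> Z"
        "\<And>j. j \<in> {1..<q} \<Longrightarrow> {x. grid_cell G x = z j} \<subseteq> share t \<iota> p a s b j" by metis
      have "card (bad \<iota> p \<theta>) * L ^ ((k - 1) * (q - 1)) \<le> (2 * C2 + 1) ^ ((k - 1) * (q - 1)) * L ^ card R.params"
        using R.card_nearly_fair_weights[of q "share t \<iota> p a s b" z C1 C2, OF share_lmeasurable disjnt_share z]
          C2 True unfolding bad_def \<theta> v_def by simp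
      then have "real (card (bad \<iota> p \<theta>) * L ^ m) \<le> real ((2 * C2 + 1) ^ m * L ^ card I)"
        unfolding m_def I_def of_nat_le_iff .
      then show ?thesis by (simp only: of_nat_mult of_nat_power)
    next
      case False
      then have "bad \<iota> p \<theta> = {}" by (auto simp: bad_def \<theta>)
      then show ?thesis by simp
    qed
  qed
  define Bad where "Bad = (\<Union>\<iota>\<in>Axes. \<Union>p\<in>Labels. \<Union>\<theta>\<in>U \<iota> p. bad \<iota> p \<theta>)"
  have fin: "finite Axes" "finite Labels" by (auto simp: Axes_def Labels_def intro!: finite_PiE)
  have Lm: "real L ^ m > 0" using L'(1) by simp
  have "real (card Bad) * real L ^ m < real (L ^ card I) * real L ^ m"
  proof -
    let ?b = "real ((2 * C2 + 1) ^ m) * real (L ^ card I)"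
    have "card Bad \<le> (\<Sum>\<iota>\<in>Axes. card (\<Union>p\<in>Labels. \<Union>\<theta>\<in>U \<iota> p. bad \<iota> p \<theta>))"
      unfolding Bad_def by (rule card_UN_le[OF fin(1)])
    also have "\<dots> \<le> (\<Sum>\<iota>\<in>Axes. \<Sum>p\<in>Labels. card (\<Union>\<theta>\<in>U \<iota> p. bad \<iota> p \<theta>))"
      by (intro sum_mono card_UN_le fin(2))
    also have "\<dots> \<le> (\<Sum>\<iota>\<in>Axes. \<Sum>p\<in>Labels. \<Sum>\<theta>\<in>U \<iota> p. card (bad \<iota> p \<theta>))"
      by (intro sum_mono card_UN_le U(1))
    finally have "real (card Bad) * real L ^ m
        \<le> real (\<Sum>\<iota>\<in>Axes. \<Sum>p\<in>Labels. \<Sum>\<theta>\<in>U \<iota> p. card (bad \<iota> p \<theta>)) * real L ^ m"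
      using Lm by (intro mult_right_mono) (simp_all only: of_nat_le_iff less_imp_le)
    also have "\<dots> = (\<Sum>\<iota>\<in>Axes. \<Sum>p\<in>Labels. \<Sum>\<theta>\<in>U \<iota> p. real (card (bad \<iota> p \<theta>)) * real L ^ m)"
      by (simp only: of_nat_sum sum_distrib_right)
    also have "\<dots> \<le> (\<Sum>\<iota>\<in>Axes. \<Sum>p\<in>Labels. \<Sum>\<theta>\<in>U \<iota> p. ?b)"
      by (intro sum_mono card_bad)
    also have "\<dots> = (\<Sum>\<iota>\<in>Axes. \<Sum>p\<in>Labels. real (card (U \<iota> p)) * ?b)" by simp
    also have "\<dots> \<le> (\<Sum>\<iota>\<in>Axes. \<Sum>p\<in>Labels. \<epsilon>' * real L ^ m * ?b)"
      by (intro sum_mono mult_right_mono U(2)) simp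
    also have "\<dots> = M * \<epsilon>' * (real (L ^ card I) * real L ^ m)" by (simp add: M_def)
    also have "\<dots> < 1 * (real (L ^ card I) * real L ^ m)"
      using \<epsilon>'(2) Lm L'(1) by (intro mult_strict_right_mono) auto
    finally show ?thesis by simp
  qed
  then have "card Bad < card R.weights" unfolding card_weights using Lm by simp
  moreover have "Bad \<subseteq> R.weights" by (auto simp: Bad_def bad_def split: prod.splits)
  ultimately obtain u where u: "u \<in> R.weights" "u \<notin> Bad"
    by (metis less_irrefl subsetI subset_antisym)
  have rcm: "R.rc u \<in> measurable_colorings k" by (rule R.rc_measurable[OF u(1)])
  have "\<not> nearly_fair k q t (1 / real L) (R.rc u) \<iota> p a s b" if valid: "valid_cuts n q t \<iota> p a s b" for \<iota> p a s b
  proof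
    assume near: "nearly_fair k q t (1 / real L) (R.rc u) \<iota> p a s b"
    have \<iota>p: "\<iota> \<in> Axes" "p \<in> Labels" using valid by (auto simp: valid_cuts_def Axes_def Labels_def)
    have bal: "\<forall>j\<in>{1..q}. \<bar>measure lebesgue (share t \<iota> p a s b j) - measure lebesgue (share t \<iota> p a s b q)\<bar> \<le> real k / real L"
      using nearly_fair_imp_balanced[OF rcm near] by simp
    then obtain a' s' b' where \<theta>: "(a', s', b') \<in> U \<iota> p" "close_cuts t r a s b a' s' b'"
      using U(3)[of \<iota> p] valid unfolding covers_balanced_def by blast
    have s: "1 / real n \<le> s" using valid by (simp add: valid_cuts_def)
    then have s0: "0 \<le> s" by (rule order_trans[rotated]) simp
    have cell: "\<exists>z\<in>Z. {x. grid_cell G x = z} \<subseteq> share t \<iota> p a' s' b' j" if j: "j \<in> {1..<q}" for j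
    proof -
      have "(1 / real n) ^ CARD('d) \<le> s ^ CARD('d)" using s by (intro power_mono) auto
      then have "vol \<le> s ^ CARD('d) / real q" unfolding vol_def by (intro divide_right_mono) auto
      moreover have "\<bar>measure lebesgue (share t \<iota> p a s b j) - s ^ CARD('d) / real q\<bar> \<le> 2 * (real k / real L)"
        using balanced_share_near_average[OF \<iota>p(2)[unfolded Labels_def] s0 bal] j by simp
      ultimately have "vol / 4 < measure lebesgue (share t \<iota> p a s b j)" using kL vol by linarith
      from share_contains_grid_cell[OF valid n _ \<eta> G(2) r(3,1) \<theta>(2), unfolded \<eta>w, OF this]
      obtain z where z: "\<forall>i. - int (n * G) \<le> z i \<and> z i < int (n * G)"
        "{x. grid_cell G x = z} \<subseteq> share t \<iota> p a' s' b' j" .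
      then have "z \<in> Z" by (auto simp: Z_def)
      then show ?thesis using z(2) by blast
    qed
    have diff: "\<bar>measure lebesgue (share t \<iota> p a' s' b' j \<inter> R.rc u -` {c})
          - measure lebesgue (share t \<iota> p a' s' b' q \<inter> R.rc u -` {c})\<bar> \<le> C1 / real L"
      if j: "j \<in> {1..<q}" and c: "c \<in> {1..<k}" for j c
    proof -
      have E: "R.rc u -` {c} \<in> sets lebesgue" using rcm c by (auto simp: measurable_colorings_def)
      have stable: "\<bar>measure lebesgue (share t \<iota> p a s b i \<inter> R.rc u -` {c})
          - measure lebesgue (share t \<iota> p a' s' b' i \<inter> R.rc u -` {c})\<bar> \<le> K * r" for i
        unfolding K_def using valid
        by (intro measure_share_stable[OF \<theta>(2) r(1,2) _ E])
          (auto simp: valid_cuts_def)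
      have "\<bar>measure lebesgue (share t \<iota> p a s b j \<inter> R.rc u -` {c})
          - measure lebesgue (share t \<iota> p a s b q \<inter> R.rc u -` {c})\<bar> \<le> 1 / real L"
        using near j c by (auto simp: nearly_fair_def)
      then have "\<bar>measure lebesgue (share t \<iota> p a' s' b' j \<inter> R.rc u -` {c})
          - measure lebesgue (share t \<iota> p a' s' b' q \<inter> R.rc u -` {c})\<bar> \<le> 1 / real L + 2 * (K * r)"
        using stable[of j] stable[of q] by linarith
      also have "\<dots> = C1 / real L" by (simp add: C1_def r_def add_divide_distrib)
      finally show ?thesis .
    qed
    have "u \<in> bad \<iota> p (a', s', b')" using u(1) cell diff by (simp add: bad_def)
    then have "u \<in> Bad" using \<iota>p \<theta>(1) unfolding Bad_def by blast
    with u(2) show False ..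
  qed
  then have "R.rc u \<in> robust_colorings k q t n"
    using rcm L'(1) unfolding robust_colorings_def by (auto intro!: exI[of _ "1 / real L"])
  moreover have "coloring_dist f (R.rc u) < \<epsilon>"
    using R.dist_rc_le[OF u(1)] h(3) unfolding I_def by simp
  ultimately show ?thesis by blast
qed

section \<open>Volumes of the parts as polynomials in the side\<close>

text \<open>
  The faces of a cell, relative to the corner of the necklace: the highest cut below the cell and the lowest cut
  above it, or else the faces of the necklace at 0 and \<open>s\<close>.
\<close>

definition cell_bot :: "(nat \<Rightarrow> 'd) \<Rightarrow> (nat \<Rightarrow> real) \<Rightarrow> nat set \<Rightarrow> 'd \<Rightarrow> real"
  where "cell_bot \<iota> b S i = Max (insert 0 (b ` {l \<in> S. \<iota> l = i}))"

definition cell_top :: "nat \<Rightarrow> (nat \<Rightarrow> 'd) \<Rightarrow> real \<Rightarrow> (nat \<Rightarrow> real) \<Rightarrow> nat set \<Rightarrow> 'd \<Rightarrow> real"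
  where "cell_top t \<iota> s b S i = Min (insert s (b ` {l \<in> {..<t} - S. \<iota> l = i}))"

lemma measure_cut_cell:
  fixes a :: "real ^ 'd::finite"
  assumes S: "S \<subseteq> {..<t}"
  shows "measure lebesgue (cut_cell t \<iota> a s b S)
    = (\<Prod>i\<in>UNIV. max 0 (cell_top t \<iota> s b S i - cell_bot \<iota> b S i))"
proof -
  let ?lo = "\<chi> i. a $ i + cell_bot \<iota> b S i"
  let ?hi = "\<chi> i. a $ i + cell_top t \<iota> s b S i"
  have fin: "finite {l \<in> S. \<iota> l = i}" "finite {l \<in> {..<t} - S. \<iota> l = i}" for i
    using finite_subset[OF S] by simp_all
  have bot_le: "cell_bot \<iota> b S i \<le> y \<longleftrightarrow> 0 \<le> y \<and> (\<forall>l\<in>S. \<iota> l = i \<longrightarrow> b l \<le> y)" for i y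
    unfolding cell_bot_def using fin by (subst Max_le_iff) auto
  have bot_less: "cell_bot \<iota> b S i < y \<longleftrightarrow> 0 < y \<and> (\<forall>l\<in>S. \<iota> l = i \<longrightarrow> b l < y)" for i y
    unfolding cell_bot_def using fin by (subst Max_less_iff) auto
  have top_ge: "y \<le> cell_top t \<iota> s b S i \<longleftrightarrow> y \<le> s \<and> (\<forall>l\<in>{..<t} - S. \<iota> l = i \<longrightarrow> y \<le> b l)" for i y
    unfolding cell_top_def using fin by (subst Min_ge_iff) auto
  have mem: "x \<in> cut_cell t \<iota> a s b S \<longleftrightarrow> (\<forall>i. a $ i \<le> x $ i \<and> x $ i \<le> a $ i + s) \<and>
      (\<forall>l\<in>S. a $ \<iota> l + b l < x $ \<iota> l) \<and> (\<forall>l\<in>{..<t} - S. x $ \<iota> l \<le> a $ \<iota> l + b l)" for x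
  proof -
    have "cuts_below t \<iota> a b x = S \<longleftrightarrow>
        (\<forall>l\<in>S. a $ \<iota> l + b l < x $ \<iota> l) \<and> (\<forall>l\<in>{..<t} - S. x $ \<iota> l \<le> a $ \<iota> l + b l)"
      using S unfolding cuts_below_def set_eq_iff by (auto simp: not_less[symmetric])
    then show ?thesis by (auto simp: cut_cell_def mem_box_cart)
  qed
  have sub: "cut_cell t \<iota> a s b S \<subseteq> cbox ?lo ?hi"
  proof
    fix x assume x: "x \<in> cut_cell t \<iota> a s b S"
    have "cell_bot \<iota> b S i \<le> x $ i - a $ i \<and> x $ i - a $ i \<le> cell_top t \<iota> s b S i" for i
      using x unfolding mem bot_le top_ge by (fastforce simp: algebra_simps)
    then show "x \<in> cbox ?lo ?hi" by (simp add: mem_box_cart algebra_simps)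
  qed
  have sup: "box ?lo ?hi \<subseteq> cut_cell t \<iota> a s b S"
  proof
    fix x assume "x \<in> box ?lo ?hi"
    then have 1: "cell_bot \<iota> b S i < x $ i - a $ i" and 2: "x $ i - a $ i \<le> cell_top t \<iota> s b S i" for i
      by (auto simp: mem_box_cart algebra_simps less_imp_le)
    show "x \<in> cut_cell t \<iota> a s b S"
      unfolding mem
    proof (intro conjI allI ballI)
      fix i
      show "a $ i \<le> x $ i" "x $ i \<le> a $ i + s"
        using 1[of i] 2[of i] unfolding bot_less top_ge by auto
    next
      fix l assume "l \<in> S"
      then show "a $ \<iota> l + b l < x $ \<iota> l" using 1[of "\<iota> l"] unfolding bot_less by force
    next
      fix l assume "l \<in> {..<t} - S"
      then have "x $ \<iota> l - a $ \<iota> l \<le> b l" using 2[of "\<iota> l"] unfolding top_ge by blast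
      then show "x $ \<iota> l \<le> a $ \<iota> l + b l" by simp
    qed
  qed
  have "measure lebesgue (cut_cell t \<iota> a s b S) = measure lebesgue (cbox ?lo ?hi)"
  proof (rule measure_negligible_symdiff[OF lmeasurable_cbox])
    have "cbox ?lo ?hi - cut_cell t \<iota> a s b S \<union> (cut_cell t \<iota> a s b S - cbox ?lo ?hi) \<subseteq> cbox ?lo ?hi - box ?lo ?hi"
      using sub sup by blast
    then show "negligible (cbox ?lo ?hi - cut_cell t \<iota> a s b S \<union> (cut_cell t \<iota> a s b S - cbox ?lo ?hi))"
      using negligible_frontier_interval negligible_subset by blast
  qed
  also have "\<dots> = (\<Prod>i\<in>UNIV. max 0 (cell_top t \<iota> s b S i - cell_bot \<iota> b S i))"
  proof (cases "\<forall>i. cell_bot \<iota> b S i \<le> cell_top t \<iota> s b S i")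
    case True
    then have "cbox ?lo ?hi \<noteq> {}" by (simp add: interval_ne_empty_cart)
    then have "measure lebesgue (cbox ?lo ?hi) = (\<Prod>i\<in>UNIV. cell_top t \<iota> s b S i - cell_bot \<iota> b S i)"
      by (simp add: content_cbox_cart)
    also have "\<dots> = (\<Prod>i\<in>UNIV. max 0 (cell_top t \<iota> s b S i - cell_bot \<iota> b S i))"
      using True by (intro prod.cong) (auto simp: max_def)
    finally show ?thesis .
  next
    case False
    then obtain i where i: "cell_top t \<iota> s b S i < cell_bot \<iota> b S i" by (auto simp: not_le)
    then have "cbox ?lo ?hi = {}" by (auto simp: interval_eq_empty_cart)
    moreover have "(\<Prod>i\<in>UNIV. max 0 (cell_top t \<iota> s b S i - cell_bot \<iota> b S i)) = 0"
      using i by (intro prod_zero bexI[of _ i]) auto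
    ultimately show ?thesis by simp
  qed
  finally show ?thesis .
qed

text \<open>
  As a function of the side \<open>s\<close>, the extent of a cell in direction \<open>i\<close> is constant if some cut bounds the
  cell from above, and otherwise equals \<open>s\<close> minus a constant. Only the cell at the far corner, above all
  cuts, is unbounded by cuts in every direction.
\<close>

lemma cell_polynomial:
  fixes \<iota> :: "nat \<Rightarrow> 'd::finite"
  assumes b: "\<forall>l<t. 0 \<le> b l" and S: "S \<subseteq> {..<t}"
  obtains P :: "real poly" where "degree P \<le> CARD('d)" "coeff P CARD('d) = (if S = {..<t} then 1 else 0)"
    "\<And>a s. 0 \<le> s \<Longrightarrow> \<forall>l<t. b l \<le> s \<Longrightarrow> measure lebesgue (cut_cell t \<iota> a s b S) = poly P s"
proof
  let ?above = "\<lambda>i. {l \<in> {..<t} - S. \<iota> l = i}"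
  define F where "F i = (if ?above i = {} then [:- cell_bot \<iota> b S i, 1:]
      else [:max 0 (Min (b ` ?above i) - cell_bot \<iota> b S i):])" for i
  let ?P = "\<Prod>i\<in>UNIV. F i"
  have deg: "degree ?P \<le> (\<Sum>i\<in>UNIV. degree (F i))"
    using degree_prod_sum_le[of UNIV F] by simp
  have degF: "degree (F i) \<le> 1" for i by (simp add: F_def)
  have "(\<Sum>i\<in>UNIV. degree (F i)) \<le> (\<Sum>i\<in>(UNIV :: 'd set). 1)" using degF by (intro sum_mono)
  then show "degree ?P \<le> CARD('d)" using deg by simp
  show "coeff ?P CARD('d) = (if S = {..<t} then 1 else 0)"
  proof (cases "S = {..<t}")
    case True
    then have F: "F i = [:- cell_bot \<iota> b S i, 1:]" for i by (simp add: F_def)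
    have "degree ?P = (\<Sum>i\<in>(UNIV :: 'd set). 1)"
      by (subst degree_prod_sum_eq) (auto simp: F)
    moreover have "lead_coeff ?P = 1" unfolding lead_coeff_prod by (simp add: F)
    ultimately show ?thesis using True by simp
  next
    case False
    then obtain l where l: "l \<in> {..<t} - S" using S by blast
    then have "?above (\<iota> l) \<noteq> {}" by blast
    then have "degree (F (\<iota> l)) = 0" by (simp add: F_def)
    then have "(\<Sum>i\<in>UNIV. degree (F i)) < (\<Sum>i\<in>(UNIV :: 'd set). 1)"
      using degF by (intro sum_strict_mono_ex1) (auto intro!: bexI[of _ "\<iota> l"])
    then have "degree ?P < CARD('d)" using deg by simp
    then show ?thesis using False by (simp add: coeff_eq_0)
  qed
  fix a :: "real ^ 'd" and s :: real assume s: "0 \<le> s" "\<forall>l<t. b l \<le> s"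
  have "max 0 (cell_top t \<iota> s b S i - cell_bot \<iota> b S i) = poly (F i) s" for i
  proof (cases "?above i = {}")
    case True
    have "cell_bot \<iota> b S i \<le> s"
      unfolding cell_bot_def using s S finite_subset[OF S] by (subst Max_le_iff) auto
    moreover have "cell_top t \<iota> s b S i = s" unfolding cell_top_def True by simp
    ultimately show ?thesis using True by (simp add: F_def)
  next
    case False
    have "cell_top t \<iota> s b S i = min s (Min (b ` ?above i))"
      unfolding cell_top_def using False by (intro Min_insert) auto
    also have "\<dots> = Min (b ` ?above i)"
    proof (rule min_absorb2)
      have "Min (b ` ?above i) \<in> b ` ?above i" using False by (intro Min_in) auto
      then show "Min (b ` ?above i) \<le> s" using s by auto
    qed
    finally have top: "cell_top t \<iota> s b S i = Min (b ` ?above i)" .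
    show ?thesis unfolding F_def if_not_P[OF False] top by simp
  qed
  then show "measure lebesgue (cut_cell t \<iota> a s b S) = poly ?P s"
    unfolding measure_cut_cell[OF S] poly_prod by simp
qed

text \<open>
  The part at the far corner contains the one cell whose volume has the leading term \<open>s ^ d\<close>. The leading coefficient
  \<open>1 - 1 / q\<close> stays away from zero uniformly in all parameters other than \<open>s\<close>.
\<close>

lemma share_excess_polynomial:
  fixes \<iota> :: "nat \<Rightarrow> 'd::finite"
  assumes b: "\<forall>l<t. 0 \<le> b l" and q: "q \<ge> 2"
  shows "\<exists>P :: real poly. degree P = CARD('d) \<and> lead_coeff P \<ge> 1 / 2 \<and>
    (\<forall>a s. 0 \<le> s \<longrightarrow> (\<forall>l<t. b l \<le> s) \<longrightarrow>
      measure lebesgue (share t \<iota> p a s b (p {..<t})) - s ^ CARD('d) / real q = poly P s)"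
proof -
  let ?d = "CARD('d)"
  have "\<exists>P :: real poly. degree P \<le> ?d \<and> coeff P ?d = (if S = {..<t} then 1 else 0) \<and>
      (\<forall>a s. 0 \<le> s \<longrightarrow> (\<forall>l<t. b l \<le> s) \<longrightarrow> measure lebesgue (cut_cell t \<iota> a s b S) = poly P s)"
    if "S \<subseteq> {..<t}" for S
    using cell_polynomial[OF b that, of \<iota>] by metis
  then obtain Q :: "nat set \<Rightarrow> real poly" where
    Q: "\<And>S. S \<subseteq> {..<t} \<Longrightarrow> degree (Q S) \<le> ?d"
      "\<And>S. S \<subseteq> {..<t} \<Longrightarrow> coeff (Q S) ?d = (if S = {..<t} then 1 else 0)"
      "\<And>S a s. S \<subseteq> {..<t} \<Longrightarrow> 0 \<le> s \<Longrightarrow> \<forall>l<t. b l \<le> s \<Longrightarrow>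
        measure lebesgue (cut_cell t \<iota> a s b S) = poly (Q S) s"
    by metis
  let ?A = "{S \<in> Pow {..<t}. p S = p {..<t}}"
  define P where "P = (\<Sum>S\<in>?A. Q S) - monom (1 / real q) ?d"
  have "degree (\<Sum>S\<in>?A. Q S) \<le> ?d" using Q(1) by (intro degree_sum_le) auto
  then have le: "degree P \<le> ?d" unfolding P_def by (intro degree_diff_le degree_monom_le)
  have "coeff P ?d = (\<Sum>S\<in>?A. coeff (Q S) ?d) - 1 / real q" by (simp add: P_def coeff_sum)
  also have "(\<Sum>S\<in>?A. coeff (Q S) ?d) = (\<Sum>S\<in>?A. if S = {..<t} then 1 else 0)"
    using Q(2) by (intro sum.cong) auto
  also have "\<dots> = 1" by (subst sum.delta) auto
  finally have coeff: "coeff P ?d = 1 - 1 / real q" .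
  have "1 / real q \<le> 1 / 2" using q by (intro divide_left_mono) auto
  then have half: "coeff P ?d \<ge> 1 / 2" using coeff by linarith
  have "degree P = ?d"
  proof (rule antisym[OF le le_degree])
    show "coeff P ?d \<noteq> 0" using half by linarith
  qed
  moreover have "measure lebesgue (share t \<iota> p a s b (p {..<t})) - s ^ ?d / real q = poly P s"
    if "0 \<le> s" "\<forall>l<t. b l \<le> s" for a s
  proof -
    have "measure lebesgue (share t \<iota> p a s b (p {..<t})) = (\<Sum>S\<in>?A. poly (Q S) s)"
      unfolding measure_share using Q(3) that by (intro sum.cong) auto
    then show ?thesis by (simp add: P_def poly_sum poly_monom)
  qed
  moreover have "lead_coeff P \<ge> 1 / 2" using half \<open>degree P = ?d\<close> by simp
  ultimately show ?thesis by blast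
qed

text \<open>
  If \<open>x\<close> were at distance at least \<open>\<rho>\<close> from the real parts of all complex roots, then each factor
  of the factorization over the complex numbers would have modulus at least \<open>\<rho>\<close>.
\<close>

lemma small_values_near_roots:
  fixes P :: "real poly"
  assumes "lead_coeff P \<ge> 1 / 2"
  obtains R :: "nat \<Rightarrow> real" where
    "\<And>\<rho> x. 0 \<le> \<rho> \<Longrightarrow> \<bar>poly P x\<bar> < \<rho> ^ degree P / 2 \<Longrightarrow> \<exists>i<degree P. \<bar>x - R i\<bar> < \<rho>"
proof -
  define Pc where "Pc = map_poly complex_of_real P"
  have deg: "degree Pc = degree P" unfolding Pc_def by (rule degree_map_poly) simp
  have lead: "lead_coeff Pc = of_real (lead_coeff P)"
    unfolding deg by (simp add: Pc_def coeff_map_poly)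
  have eval: "poly Pc (of_real x) = of_real (poly P x)" for x
    unfolding Pc_def by (induction P) (auto simp: map_poly_pCons)
  obtain root where root: "smult (lead_coeff Pc) (\<Prod>i<degree Pc. [:- root i, 1:]) = Pc"
    using complex_poly_decompose' .
  have "\<exists>i<degree P. \<bar>x - Re (root i)\<bar> < \<rho>" if \<rho>: "0 \<le> \<rho>" and small: "\<bar>poly P x\<bar> < \<rho> ^ degree P / 2" for \<rho> x
  proof (rule ccontr)
    assume "\<not> ?thesis"
    then have no: "\<And>i. i < degree P \<Longrightarrow> \<rho> \<le> \<bar>x - Re (root i)\<bar>" by force
    have far: "\<rho> \<le> cmod (of_real x - root i)" if "i < degree P" for i
      using no[OF that] abs_Re_le_cmod[of "of_real x - root i"] by simp
    have "poly Pc (of_real x) = lead_coeff Pc * (\<Prod>i<degree Pc. of_real x - root i)"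
      using arg_cong[OF root, of "\<lambda>p. poly p (of_real x)", symmetric] by (simp add: poly_prod)
    then have "cmod (poly Pc (of_real x)) = cmod (lead_coeff Pc) * (\<Prod>i<degree Pc. cmod (of_real x - root i))"
      by (simp only: norm_mult prod_norm)
    then have "\<bar>poly P x\<bar> = \<bar>lead_coeff P\<bar> * (\<Prod>i<degree P. cmod (of_real x - root i))"
      unfolding eval deg lead[unfolded deg] norm_of_real .
    also have "\<dots> \<ge> 1 / 2 * (\<Prod>i<degree P. \<rho>)"
      using assms far \<rho> by (intro mult_mono prod_mono prod_nonneg) auto
    finally show False using small by simp
  qed
  then show ?thesis by (rule that[of "\<lambda>i. Re (root i)"])
qed

lemma card_int_interval_le:
  assumes "0 \<le> w"
  shows "finite {u :: int. \<bar>real_of_int u - y\<bar> < w}" "real (card {u :: int. \<bar>real_of_int u - y\<bar> < w}) \<le> 2 * w + 1"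
proof -
  have sub: "{u :: int. \<bar>real_of_int u - y\<bar> < w} \<subseteq> {\<lceil>y - w\<rceil>..\<lfloor>y + w\<rfloor>}"
    by (auto simp: ceiling_le_iff le_floor_iff abs_less_iff)
  then show "finite {u :: int. \<bar>real_of_int u - y\<bar> < w}" by (rule finite_subset) simp
  have "card {u :: int. \<bar>real_of_int u - y\<bar> < w} \<le> card {\<lceil>y - w\<rceil>..\<lfloor>y + w\<rfloor>}"
    by (rule card_mono[OF _ sub]) simp
  also have "\<dots> = nat (\<lfloor>y + w\<rfloor> + 1 - \<lceil>y - w\<rceil>)" by simp
  finally have "real (card {u :: int. \<bar>real_of_int u - y\<bar> < w}) \<le> real (nat (\<lfloor>y + w\<rfloor> + 1 - \<lceil>y - w\<rceil>))"
    by simp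
  also have "\<dots> \<le> 2 * w + 1"
  proof -
    have "real_of_int (\<lfloor>y + w\<rfloor> + 1 - \<lceil>y - w\<rceil>) \<le> 2 * w + 1" by linarith
    then show ?thesis using assms by (cases "\<lfloor>y + w\<rfloor> + 1 - \<lceil>y - w\<rceil> \<ge> 0") auto
  qed
  finally show "real (card {u :: int. \<bar>real_of_int u - y\<bar> < w}) \<le> 2 * w + 1" .
qed

text \<open>
  Values of order \<open>1 / L\<close> occur only within \<open>\<rho>\<close> of \<open>d\<close> points, where \<open>\<rho>\<close> may be chosen
  arbitrarily small as \<open>L\<close> grows. It matters that \<open>L0\<close> is independent of the polynomial.
\<close>

lemma card_grid_small_values:
  fixes C \<epsilon> :: real and d :: nat
  assumes d: "d \<ge> 1" and C: "C \<ge> 0" and \<epsilon>: "\<epsilon> > 0"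
  obtains L0 where "\<And>L (P :: real poly). L \<ge> L0 \<Longrightarrow> degree P = d \<Longrightarrow> lead_coeff P \<ge> 1 / 2 \<Longrightarrow>
    finite {u :: int. \<bar>poly P (real_of_int u / real L)\<bar> \<le> C / real L} \<and>
    real (card {u :: int. \<bar>poly P (real_of_int u / real L)\<bar> \<le> C / real L}) \<le> \<epsilon> * real L"
proof -
  define \<rho> where "\<rho> = \<epsilon> / (4 * real d)"
  have \<rho>: "\<rho> > 0" using \<epsilon> d by (simp add: \<rho>_def)
  obtain L0 where L0: "2 * C / \<rho> ^ d + 2 * real d / \<epsilon> + 1 \<le> real L0" using real_arch_simple by blast
  show ?thesis
  proof
    fix L and P :: "real poly" assume L: "L \<ge> L0" and P: "degree P = d" "lead_coeff P \<ge> 1 / 2"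
    have nonneg: "0 \<le> 2 * C / \<rho> ^ d" "0 \<le> 2 * real d / \<epsilon>" using C \<rho> \<epsilon> by simp_all
    have "2 * C / \<rho> ^ d + 2 * real d / \<epsilon> + 1 \<le> real L" using L0 L by simp
    then have L': "real L > 0" "2 * C / \<rho> ^ d < real L" "2 * real d / \<epsilon> \<le> real L"
      using nonneg by linarith+
    have small: "C / real L < \<rho> ^ d / 2"
      using L'(1,2) \<rho> by (simp add: field_simps)
    obtain R where R: "\<And>\<rho> x. 0 \<le> \<rho> \<Longrightarrow> \<bar>poly P x\<bar> < \<rho> ^ degree P / 2 \<Longrightarrow> \<exists>i<degree P. \<bar>x - R i\<bar> < \<rho>"
      using small_values_near_roots[OF P(2)] by blast
    let ?B = "\<lambda>i. {u :: int. \<bar>real_of_int u - real L * R i\<bar> < \<rho> * real L}"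
    let ?A = "{u :: int. \<bar>poly P (real_of_int u / real L)\<bar> \<le> C / real L}"
    have sub: "?A \<subseteq> (\<Union>i\<in>{..<d}. ?B i)"
    proof
      fix u assume "u \<in> ?A"
      then have "\<bar>poly P (real_of_int u / real L)\<bar> \<le> C / real L" by simp
      with small have "\<bar>poly P (real_of_int u / real L)\<bar> < \<rho> ^ degree P / 2" unfolding P(1) by linarith
      then obtain i where i: "i < d" "\<bar>real_of_int u / real L - R i\<bar> < \<rho>"
        using R[of \<rho>] \<rho> P(1) by auto
      have "\<bar>real_of_int u - real L * R i\<bar> = \<bar>real_of_int u / real L - R i\<bar> * real L"
        using L'(1) by (simp add: abs_mult[symmetric] field_simps flip: abs_of_pos)
      then have "\<bar>real_of_int u - real L * R i\<bar> < \<rho> * real L" using i(2) L'(1) by simp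
      then show "u \<in> (\<Union>i\<in>{..<d}. ?B i)" using i(1) by blast
    qed
    have B: "finite (?B i)" "real (card (?B i)) \<le> 2 * (\<rho> * real L) + 1" for i
      using card_int_interval_le[of "\<rho> * real L" "real L * R i"] \<rho> by simp_all
    have fin: "finite (\<Union>i\<in>{..<d}. ?B i)" using B by blast
    have "card ?A \<le> (\<Sum>i\<in>{..<d}. card (?B i))"
      by (rule order_trans[OF card_mono[OF fin sub] card_UN_le]) simp
    then have "real (card ?A) \<le> (\<Sum>i\<in>{..<d}. real (card (?B i)))" by (simp flip: of_nat_sum)
    also have "\<dots> \<le> (\<Sum>i\<in>{..<d}. 2 * (\<rho> * real L) + 1)" using B(2) by (intro sum_mono)
    also have "\<dots> = \<epsilon> * real L / 2 + real d" using d by (simp add: \<rho>_def field_simps)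
    also have "\<dots> \<le> \<epsilon> * real L" using L'(3) \<epsilon> by (simp add: field_simps)
    finally show "finite ?A \<and> real (card ?A) \<le> \<epsilon> * real L" using finite_subset[OF sub fin] by blast
  qed
qed

section \<open>Rounding in arbitrary dimension\<close>

text \<open>
  All parameters are rounded down to multiples of \<open>1 / L\<close>; rounding is monotone, so that the cuts stay
  inside the rounded necklace. For the \<open>O(L ^ (d + t))\<close> choices of corner and cuts, the equation for the volume of the part
  at the far corner leaves at most \<open>\<epsilon>' * L\<close> possible sides.
\<close>

lemma covering_by_rounding:
  fixes n k q t m :: nat
  assumes n: "n \<ge> 1" and q: "q \<ge> 2" and m: "m \<ge> t + CARD('d::finite) + 1" and \<epsilon>: "\<epsilon> > 0"
  shows "\<exists>L0. \<forall>L\<ge>L0. \<forall>(\<iota> :: nat \<Rightarrow> 'd) p. \<exists>U. finite U \<and> real (card U) \<le> \<epsilon> * real L ^ m \<and>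
    covers_balanced n q t (real k / real L) (1 / real L) \<iota> p U"
proof -
  let ?d = "CARD('d)"
  define K where "K = real (2 * ?d + t) * (4 * (2 * real (Suc n)) ^ (?d - 1))"
  define C where "C = 2 * (real k + 2 * K)"
  define \<epsilon>' where "\<epsilon>' = \<epsilon> / (3 * real n) ^ (?d + t)"
  have C: "C \<ge> 0" by (simp add: C_def K_def)
  have \<epsilon>': "\<epsilon>' > 0" using \<epsilon> n by (simp add: \<epsilon>'_def)
  have d1: "?d \<ge> 1" by (simp add: Suc_leI)
  obtain L0 where L0: "\<And>L (P :: real poly). L \<ge> L0 \<Longrightarrow> degree P = ?d \<Longrightarrow> lead_coeff P \<ge> 1 / 2 \<Longrightarrow>
    finite {u :: int. \<bar>poly P (real_of_int u / real L)\<bar> \<le> C / real L} \<and>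
    real (card {u :: int. \<bar>poly P (real_of_int u / real L)\<bar> \<le> C / real L}) \<le> \<epsilon>' * real L"
    using card_grid_small_values[OF d1 C \<epsilon>'] by metis
  show ?thesis
  proof (intro exI[of _ "max L0 2"] allI impI)
    fix L and \<iota> :: "nat \<Rightarrow> 'd" and p :: "nat set \<Rightarrow> nat"
    assume "L \<ge> max L0 2"
    then have L: "L \<ge> L0" "L \<ge> 2" by auto
    then have Lpos: "real L > 0" by simp
    let ?s = "\<lambda>u :: int. real_of_int u / real L"
    let ?b = "\<lambda>\<beta> l. real_of_int (\<beta> l) / real L"
    \<comment> \<open>The admissible sides; volumes are translation invariant, so any corner \<open>a\<close> may witness the bound.\<close>
    define T where "T \<beta> = {u :: int. 0 \<le> u \<and> (\<forall>l<t. ?b \<beta> l \<le> ?s u) \<and>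
       (\<exists>a :: real ^ 'd. \<bar>measure lebesgue (share t \<iota> p a (?s u) (?b \<beta>) (p {..<t})) - ?s u ^ ?d / real q\<bar>
          \<le> C / real L)}" for \<beta> :: "nat \<Rightarrow> int"
    define A where "A = (UNIV :: 'd set) \<rightarrow>\<^sub>E {- int (n * L)..int (n * L)}"
    define B where "B = {..<t} \<rightarrow>\<^sub>E {0..int (2 * n * L)}"
    define U where "U = (\<lambda>(\<alpha>, \<beta>, u). (\<chi> i. real_of_int (\<alpha> i) / real L, ?s u, ?b \<beta>)) ` (A \<times> Sigma B T)"
    have T: "finite (T \<beta>)" "real (card (T \<beta>)) \<le> \<epsilon>' * real L" if \<beta>: "\<beta> \<in> B" for \<beta>
    proof -
      have b0: "\<forall>l<t. 0 \<le> ?b \<beta> l"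
      proof (intro allI impI)
        fix l assume "l < t"
        then have "\<beta> l \<in> {0..int (2 * n * L)}" using PiE_mem[OF \<beta>[unfolded B_def]] by blast
        then show "0 \<le> ?b \<beta> l" by simp
      qed
      obtain P :: "real poly" where P: "degree P = ?d" "lead_coeff P \<ge> 1 / 2"
        and excess: "\<forall>(a :: real ^ 'd) s. 0 \<le> s \<longrightarrow> (\<forall>l<t. ?b \<beta> l \<le> s) \<longrightarrow>
          measure lebesgue (share t \<iota> p a s (?b \<beta>) (p {..<t})) - s ^ ?d / real q = poly P s"
        using share_excess_polynomial[OF b0 q, of \<iota> p] by (elim exE conjE)
      have sub: "T \<beta> \<subseteq> {u. \<bar>poly P (?s u)\<bar> \<le> C / real L}"
      proof
        fix u assume u: "u \<in> T \<beta>"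
        then obtain a :: "real ^ 'd" where
          a: "\<bar>measure lebesgue (share t \<iota> p a (?s u) (?b \<beta>) (p {..<t})) - ?s u ^ ?d / real q\<bar> \<le> C / real L"
          by (auto simp: T_def)
        have "measure lebesgue (share t \<iota> p a (?s u) (?b \<beta>) (p {..<t})) - ?s u ^ ?d / real q = poly P (?s u)"
          using u by (intro excess[rule_format]) (auto simp: T_def)
        then show "u \<in> {u. \<bar>poly P (?s u)\<bar> \<le> C / real L}" using a by simp
      qed
      show "finite (T \<beta>)" using L0[OF L(1) P] finite_subset[OF sub] by blast
      have "card (T \<beta>) \<le> card {u. \<bar>poly P (?s u)\<bar> \<le> C / real L}"
        using L0[OF L(1) P] by (intro card_mono sub) blast
      then show "real (card (T \<beta>)) \<le> \<epsilon>' * real L" using L0[OF L(1) P] by linarith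
    qed
    have fin: "finite A" "finite B" by (auto simp: A_def B_def intro!: finite_PiE)
    have cardA: "card A = (2 * n * L + 1) ^ ?d"
      unfolding A_def by (subst card_funcsetE) (auto simp: nat_add_distrib nat_mult_distrib algebra_simps)
    have cardB: "card B = (2 * n * L + 1) ^ t"
      unfolding B_def by (subst card_funcsetE) (auto simp: nat_add_distrib nat_mult_distrib algebra_simps)
    have finS: "finite (Sigma B T)" using fin T(1) by (intro finite_SigmaI)
    have "finite U" unfolding U_def using fin finS by (intro finite_imageI finite_cartesian_product)
    moreover have "real (card U) \<le> \<epsilon> * real L ^ m"
    proof -
      have "card U \<le> card (A \<times> Sigma B T)"
        unfolding U_def using fin finS by (intro card_image_le finite_cartesian_product)
      also have "\<dots> = card A * (\<Sum>\<beta>\<in>B. card (T \<beta>))"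
        using fin T(1) by (simp add: card_cartesian_product card_SigmaI)
      finally have "real (card U) \<le> real (card A) * (\<Sum>\<beta>\<in>B. real (card (T \<beta>)))"
        by (metis of_nat_le_iff of_nat_mult of_nat_sum)
      also have "\<dots> \<le> real (card A) * (\<Sum>\<beta>\<in>B. \<epsilon>' * real L)"
        using T(2) by (intro mult_left_mono sum_mono) auto
      also have "\<dots> = (real (2 * n * L + 1)) ^ (?d + t) * (\<epsilon>' * real L)"
        by (simp add: cardA cardB power_add)
      also have "\<dots> \<le> (3 * real n * real L) ^ (?d + t) * (\<epsilon>' * real L)"
      proof (intro mult_right_mono power_mono)
        have "1 \<le> n * L" using n L(2) by simp
        then have "real 1 \<le> real (n * L)" unfolding of_nat_le_iff .
        then show "real (2 * n * L + 1) \<le> 3 * real n * real L" by (simp add: mult.commute)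
      qed (use \<epsilon>' in auto)
      also have "\<dots> = \<epsilon> * real L ^ (t + ?d + 1)"
        using n by (simp add: \<epsilon>'_def power_mult_distrib power_add)
      also have "\<dots> \<le> \<epsilon> * real L ^ m"
        using m \<epsilon> L(2) by (intro mult_left_mono power_increasing) auto
      finally show ?thesis .
    qed
    moreover have "covers_balanced n q t (real k / real L) (1 / real L) \<iota> p U"
      unfolding covers_balanced_def
    proof (intro allI impI)
      fix a :: "real ^ 'd" and s b
      assume valid: "valid_cuts n q t \<iota> p a s b"
        and bal: "\<forall>j\<in>{1..q}. \<bar>measure lebesgue (share t \<iota> p a s b j) - measure lebesgue (share t \<iota> p a s b q)\<bar> \<le> real k / real L"
      have box: "- real n \<le> a $ i" "a $ i + s \<le> real n" for i using valid by (auto simp: valid_cuts_def)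
      have "1 / real n \<le> s" using valid by (simp add: valid_cuts_def)
      then have s0: "0 \<le> s" by (rule order_trans[rotated]) simp
      have bs: "0 \<le> b l" "b l \<le> s" if "l < t" for l using valid that by (auto simp: valid_cuts_def)
      have p: "p \<in> Pow {..<t} \<rightarrow>\<^sub>E {1..q}" using valid by (simp add: valid_cuts_def)
      have s2: "s \<le> 2 * real n" using box[of undefined] by linarith
      define \<alpha> where "\<alpha> i = \<lfloor>real L * a $ i\<rfloor>" for i
      define u where "u = \<lfloor>real L * s\<rfloor>"
      define \<beta> where "\<beta> = (\<lambda>l\<in>{..<t}. \<lfloor>real L * b l\<rfloor>)"
      have round: "\<bar>x - real_of_int \<lfloor>real L * x\<rfloor> / real L\<bar> \<le> 1 / real L" for x
      proof -
        have "\<bar>real L * x - real_of_int \<lfloor>real L * x\<rfloor>\<bar> \<le> 1" by linarith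
        then have "\<bar>real L * x - real_of_int \<lfloor>real L * x\<rfloor>\<bar> / real L \<le> 1 / real L"
          using Lpos by (intro divide_right_mono) auto
        moreover have "x - real_of_int \<lfloor>real L * x\<rfloor> / real L = (real L * x - real_of_int \<lfloor>real L * x\<rfloor>) / real L"
          using Lpos by (simp add: field_simps)
        ultimately show ?thesis using Lpos by (simp add: abs_divide)
      qed
      have close: "close_cuts t (1 / real L) a s b (\<chi> i. real_of_int (\<alpha> i) / real L) (?s u) (?b \<beta>)"
        using round by (simp add: close_cuts_def \<alpha>_def u_def \<beta>_def)
      have \<alpha>: "\<alpha> \<in> A"
      proof -
        have "- int (n * L) \<le> \<alpha> i \<and> \<alpha> i \<le> int (n * L)" for i
        proof -
          have "real L * (- real n) \<le> real L * a $ i"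
            using box(1)[of i] by (rule mult_left_mono) simp
          moreover have "real L * a $ i \<le> real L * real n"
            using box(2)[of i] s0 by (intro mult_left_mono) auto
          ultimately have "real_of_int (- int (n * L)) \<le> real L * a $ i" "real L * a $ i < real_of_int (int (n * L)) + 1"
            by (simp_all add: mult.commute)
          then show ?thesis unfolding \<alpha>_def by (simp only: le_floor_iff floor_le_iff)
        qed
        then show ?thesis by (simp add: A_def PiE_iff)
      qed
      have \<beta>: "\<beta> \<in> B"
      proof -
        have "0 \<le> \<lfloor>real L * b l\<rfloor> \<and> \<lfloor>real L * b l\<rfloor> \<le> int (2 * n * L)" if l: "l < t" for l
        proof -
          have "0 \<le> real L * b l" using bs[OF l] by simp
          moreover have "real L * b l \<le> real L * (2 * real n)"
            using bs(2)[OF l] s2 by (intro mult_left_mono) auto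
          ultimately have "real_of_int 0 \<le> real L * b l" "real L * b l < real_of_int (int (2 * n * L)) + 1"
            by (simp_all add: mult_ac)
          then show ?thesis by (simp only: le_floor_iff floor_le_iff)
        qed
        then show ?thesis by (auto simp: B_def \<beta>_def)
      qed
      have u0: "0 \<le> u" using s0 Lpos by (simp add: u_def)
      have bu: "?b \<beta> l \<le> ?s u" if l: "l < t" for l
      proof -
        have "\<lfloor>real L * b l\<rfloor> \<le> \<lfloor>real L * s\<rfloor>" using bs[OF l] Lpos by (intro floor_mono mult_left_mono) auto
        then show ?thesis using l Lpos by (simp add: \<beta>_def u_def divide_right_mono)
      qed
      let ?a = "\<chi> i. real_of_int (\<alpha> i) / real L"
      have stable: "\<bar>measure lebesgue (share t \<iota> p a s b j) - measure lebesgue (share t \<iota> p ?a (?s u) (?b \<beta>) j)\<bar>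
          \<le> K * (1 / real L)" for j
        using measure_share_stable[OF close, of n UNIV \<iota> p j] L(2) box
        unfolding K_def by simp
      have bal': "\<forall>j\<in>{1..q}. \<bar>measure lebesgue (share t \<iota> p ?a (?s u) (?b \<beta>) j)
          - measure lebesgue (share t \<iota> p ?a (?s u) (?b \<beta>) q)\<bar> \<le> (real k + 2 * K) / real L"
      proof
        fix j assume "j \<in> {1..q}"
        then have "\<bar>measure lebesgue (share t \<iota> p ?a (?s u) (?b \<beta>) j)
          - measure lebesgue (share t \<iota> p ?a (?s u) (?b \<beta>) q)\<bar> \<le> real k / real L + 2 * (K * (1 / real L))"
          using bal stable[of j] stable[of q] by fastforce
        then show "\<bar>measure lebesgue (share t \<iota> p ?a (?s u) (?b \<beta>) j)
          - measure lebesgue (share t \<iota> p ?a (?s u) (?b \<beta>) q)\<bar> \<le> (real k + 2 * K) / real L"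
          by (simp add: add_divide_distrib)
      qed
      have "p {..<t} \<in> {1..q}" by (rule PiE_mem[OF p]) simp
      then have "\<bar>measure lebesgue (share t \<iota> p ?a (?s u) (?b \<beta>) (p {..<t})) - ?s u ^ ?d / real q\<bar>
          \<le> 2 * ((real k + 2 * K) / real L)"
        using u0 by (intro balanced_share_near_average[OF p _ bal']) auto
      then have "\<bar>measure lebesgue (share t \<iota> p ?a (?s u) (?b \<beta>) (p {..<t})) - ?s u ^ ?d / real q\<bar> \<le> C / real L"
        by (simp add: C_def)
      then have "u \<in> T \<beta>" using u0 bu unfolding T_def by blast
      then have "(\<chi> i. real_of_int (\<alpha> i) / real L, ?s u, ?b \<beta>) \<in> U"
        unfolding U_def using \<alpha> \<beta> by (intro image_eqI[of _ _ "(\<alpha>, \<beta>, u)"]) auto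
      then show "\<exists>(a', s', b')\<in>U. close_cuts t (1 / real L) a s b a' s' b'"
        using close by blast
    qed
    ultimately show "\<exists>U. finite U \<and> real (card U) \<le> \<epsilon> * real L ^ m \<and>
      covers_balanced n q t (real k / real L) (1 / real L) \<iota> p U" by blast
  qed
qed

section \<open>Rounding on the line\<close>

text \<open>
  The cuts on the line in order, with the two ends of the necklace added at the indices \<open>0\<close> and \<open>t + 1\<close>.
\<close>

definition cut_pos :: "nat \<Rightarrow> real \<Rightarrow> (nat \<Rightarrow> real) \<Rightarrow> nat \<Rightarrow> real"
  where "cut_pos t s b i = (if i = 0 then 0 else if i \<le> t then b (i - 1) else s)"

definition gap :: "nat \<Rightarrow> real \<Rightarrow> (nat \<Rightarrow> real) \<Rightarrow> nat \<Rightarrow> real"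
  where "gap t s b i = cut_pos t s b (Suc i) - cut_pos t s b i"

lemma gap_nonneg:
  assumes "valid_cuts n q t \<iota> p a s b" "i \<le> t"
  shows "0 \<le> gap t s b i"
proof -
  have s: "0 \<le> s"
  proof -
    have "1 / real n \<le> s" using assms(1) by (simp add: valid_cuts_def)
    then show ?thesis by (rule order_trans[rotated]) simp
  qed
  have b: "0 \<le> b l" "b l \<le> s" "l \<le> m \<Longrightarrow> m < t \<Longrightarrow> b l \<le> b m" if "l < t" for l m
    using assms(1) that by (auto simp: valid_cuts_def)
  show ?thesis
    using assms(2) s b(1)[of i] b(2)[of "i - 1"] b(3)[of "i - 1" i]
    by (cases "i = 0"; cases "i < t") (auto simp: gap_def cut_pos_def)
qed

lemma sum_gap: "(\<Sum>i<j. gap t s b i) = cut_pos t s b j"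
  unfolding gap_def sum_lessThan_telescope by (simp add: cut_pos_def)

text \<open>
  On the line the set of cuts below a point is an initial segment of the sorted cuts, and the cell above
  exactly the first \<open>i\<close> cuts is the \<open>i\<close>-th gap.
\<close>

lemma measure_share_eq_sum_gaps:
  fixes a :: "real ^ 'd::finite"
  assumes d: "CARD('d) = 1" and valid: "valid_cuts n q t \<iota> p a s b"
  shows "measure lebesgue (share t \<iota> p a s b j) = (\<Sum>i\<in>{i \<in> {..t}. p {..<i} = j}. gap t s b i)"
proof -
  have sorted: "b l \<le> b m" if "l \<le> m" "m < t" for l m using valid that by (auto simp: valid_cuts_def)
  have s: "0 \<le> s"
  proof -
    have "1 / real n \<le> s" using valid by (simp add: valid_cuts_def)
    then show ?thesis by (rule order_trans[rotated]) simp
  qed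
  have b: "0 \<le> b l" "b l \<le> s" if "l < t" for l using valid that by (auto simp: valid_cuts_def)
  obtain e :: 'd where e: "UNIV = {e}" using d by (auto simp: card_1_singleton_iff)
  have \<iota>_e: "\<iota> l = e" for l using e by blast
  have initial: "cuts_below t \<iota> a b x \<in> (\<lambda>i. {..<i}) ` {..t}" for x
  proof -
    have down: "m \<in> cuts_below t \<iota> a b x" if "l \<in> cuts_below t \<iota> a b x" "m \<le> l" for l m
      using that sorted[of m l] by (auto simp: cuts_below_def \<iota>_e)
    define i where "i = card (cuts_below t \<iota> a b x)"
    have "cuts_below t \<iota> a b x = {..<i}"
    proof (cases "cuts_below t \<iota> a b x = {}")
      case False
      have fin: "finite (cuts_below t \<iota> a b x)" by (rule finite_subset[OF cuts_below_subset]) simp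
      define M where "M = Max (cuts_below t \<iota> a b x)"
      have "M \<in> cuts_below t \<iota> a b x" unfolding M_def by (rule Max_in[OF fin False])
      then have eqM: "cuts_below t \<iota> a b x = {..M}"
        using down[of M] Max_ge[OF fin] by (auto simp: M_def)
      then have "i = Suc M" by (simp add: i_def)
      then show ?thesis using eqM by (simp add: lessThan_Suc_atMost)
    qed (simp add: i_def)
    moreover have "i \<le> t" using card_mono[OF _ cuts_below_subset[of t \<iota> a b x]] by (simp add: i_def)
    ultimately show ?thesis by blast
  qed
  have cell: "measure lebesgue (cut_cell t \<iota> a s b {..<i}) = gap t s b i" if i: "i \<le> t" for i
  proof -
    have iota: "{l \<in> S. \<iota> l = e} = S" for S by (simp add: \<iota>_e)
    have "cell_bot \<iota> b {..<i} e = cut_pos t s b i"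
    proof (cases "i = 0")
      case False
      have "Max (insert 0 (b ` {..<i})) = b (i - 1)"
        using False i b sorted by (intro Max_eqI) auto
      then show ?thesis unfolding cell_bot_def iota using False i by (simp add: cut_pos_def)
    qed (simp add: cell_bot_def cut_pos_def)
    moreover have "cell_top t \<iota> s b {..<i} e = cut_pos t s b (Suc i)"
    proof (cases "i = t")
      case False
      have "Min (insert s (b ` ({..<t} - {..<i}))) = b i"
      proof (rule Min_eqI)
        have "i < t" using False i by simp
        then show "b i \<in> insert s (b ` ({..<t} - {..<i}))" by simp
        show "b i \<le> y" if "y \<in> insert s (b ` ({..<t} - {..<i}))" for y
          using that b(2)[OF \<open>i < t\<close>] sorted[of i] by auto
      qed simp
      then show ?thesis unfolding cell_top_def iota using False i by (simp add: cut_pos_def)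
    qed (simp add: cell_top_def cut_pos_def)
    ultimately have "measure lebesgue (cut_cell t \<iota> a s b {..<i}) = max 0 (gap t s b i)"
      using i measure_cut_cell[of "{..<i}" t \<iota> a s b] by (simp add: e gap_def)
    then show ?thesis using gap_nonneg[OF valid i] by simp
  qed
  have "measure lebesgue (share t \<iota> p a s b j)
      = (\<Sum>S\<in>{S \<in> Pow {..<t}. p S = j}. measure lebesgue (cut_cell t \<iota> a s b S))"
    by (rule measure_share)
  also have "\<dots> = (\<Sum>S\<in>(\<lambda>i. {..<i}) ` {i \<in> {..t}. p {..<i} = j}. measure lebesgue (cut_cell t \<iota> a s b S))"
  proof (rule sum.mono_neutral_right)
    show "\<forall>S\<in>{S \<in> Pow {..<t}. p S = j} - (\<lambda>i. {..<i}) ` {i \<in> {..t}. p {..<i} = j}.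
        measure lebesgue (cut_cell t \<iota> a s b S) = 0"
    proof
      fix S assume S: "S \<in> {S \<in> Pow {..<t}. p S = j} - (\<lambda>i. {..<i}) ` {i \<in> {..t}. p {..<i} = j}"
      have "cuts_below t \<iota> a b x \<noteq> S" for x using initial[of x] S by auto
      then have "cut_cell t \<iota> a s b S = {}" by (auto simp: cut_cell_def)
      then show "measure lebesgue (cut_cell t \<iota> a s b S) = 0" by simp
    qed
  qed auto
  also have "\<dots> = (\<Sum>i\<in>{i \<in> {..t}. p {..<i} = j}. measure lebesgue (cut_cell t \<iota> a s b {..<i}))"
    by (rule sum.reindex_cong[of "\<lambda>i. {..<i}"]) (auto simp: inj_on_def)
  also have "\<dots> = (\<Sum>i\<in>{i \<in> {..t}. p {..<i} = j}. gap t s b i)"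
    using cell by (intro sum.cong) auto
  finally show ?thesis .
qed

text \<open>
  Choose one gap of each label \<open>j < q\<close>. The sums for the labels below \<open>q\<close> involve one chosen gap each and the
  sum for \<open>q\<close> none, so the other gaps determine the chosen ones up to a bounded error.
\<close>

lemma card_balanced_gaps:
  fixes lab :: "nat \<Rightarrow> nat" and D B :: nat
  assumes onto: "{1..q} \<subseteq> lab ` {..t}" and q: "q \<ge> 1"
  shows "card {\<omega> \<in> {..t} \<rightarrow>\<^sub>E {..<B}. \<forall>j\<in>{1..q}.
      \<bar>real (\<Sum>i\<in>{i\<in>{..t}. lab i = j}. \<omega> i) - real (\<Sum>i\<in>{i\<in>{..t}. lab i = q}. \<omega> i)\<bar> \<le> real D}
    \<le> (4 * D + 1) ^ (q - 1) * B ^ (t + 1 - (q - 1))" (is "card ?W \<le> _")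
  and "q \<le> t + 1"
proof -
  have "\<forall>j\<in>{1..q}. \<exists>i. i \<le> t \<and> lab i = j" using onto by force
  then obtain f where f: "\<And>j. j \<in> {1..q} \<Longrightarrow> f j \<le> t" "\<And>j. j \<in> {1..q} \<Longrightarrow> lab (f j) = j" by metis
  have inj: "inj_on f {1..q}" by (rule inj_on_inverseI[of _ lab]) (use f in auto)
  have "card (f ` {1..q}) \<le> card {..t}" using f by (intro card_mono) auto
  then show "q \<le> t + 1" using card_image[OF inj] by simp
  define J where "J = f ` {1..<q}"
  have cJ: "card J = q - 1"
  proof -
    have "inj_on f {1..<q}" by (rule inj_on_subset[OF inj]) auto
    then show ?thesis by (simp add: J_def card_image)
  qed
  have "card ?W \<le> (2 * (2 * D) + 1) ^ card J * B ^ (card {..t} - card J)"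
  proof (rule card_le_if_spread_small)
    show "J \<subseteq> {..t}" using f by (auto simp: J_def)
    show "?W \<subseteq> {..t} \<rightarrow>\<^sub>E {..<B}" by blast
    fix u v i assume u: "u \<in> ?W" and v: "v \<in> ?W" and eq: "\<And>i. i \<in> {..t} - J \<Longrightarrow> u i = v i" and i: "i \<in> J"
    obtain j where j: "j \<in> {1..<q}" "i = f j" using i by (auto simp: J_def)
    have ij: "i \<in> {i\<in>{..t}. lab i = j}" using f[of j] j by auto
    have labJ: "lab i' \<in> {1..<q} \<and> i' = f (lab i')" if i': "i' \<in> J" for i'
    proof -
      obtain j' where j': "j' \<in> {1..<q}" "i' = f j'" using i' unfolding J_def by blast
      then have "lab i' = j'" using f(2)[of j'] by simp
      then show ?thesis using j' by simp
    qed
    have other: "i' \<notin> J" if "lab i' = j" "i' \<noteq> i" for i'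
      using labJ[of i'] that j(2) by auto
    have notq: "i' \<notin> J" if "lab i' = q" for i'
      using labJ[of i'] that by auto
    have sumq: "(\<Sum>i\<in>{i\<in>{..t}. lab i = q}. u i) = (\<Sum>i\<in>{i\<in>{..t}. lab i = q}. v i)"
      using notq eq by (intro sum.cong) auto
    have rest: "(\<Sum>i\<in>{i\<in>{..t}. lab i = j} - {i}. u i) = (\<Sum>i\<in>{i\<in>{..t}. lab i = j} - {i}. v i)"
      using other eq by (intro sum.cong) auto
    have sumj: "(\<Sum>i\<in>{i\<in>{..t}. lab i = j}. w i) = w i + (\<Sum>i\<in>{i\<in>{..t}. lab i = j} - {i}. w i)" for w :: "nat \<Rightarrow> nat"
      by (rule sum.remove[OF _ ij]) simp
    have jq: "j \<in> {1..q}" using j by simp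
    have "\<bar>real (u i + (\<Sum>i\<in>{i\<in>{..t}. lab i = j} - {i}. v i)) - real (\<Sum>i\<in>{i\<in>{..t}. lab i = q}. v i)\<bar> \<le> real D"
      "\<bar>real (v i + (\<Sum>i\<in>{i\<in>{..t}. lab i = j} - {i}. v i)) - real (\<Sum>i\<in>{i\<in>{..t}. lab i = q}. v i)\<bar> \<le> real D"
    proof -
      have bound: "\<bar>real (\<Sum>i\<in>{i\<in>{..t}. lab i = j}. w i) - real (\<Sum>i\<in>{i\<in>{..t}. lab i = q}. w i)\<bar> \<le> real D"
        if "w \<in> ?W" for w
        using that jq by blast
      show "\<bar>real (u i + (\<Sum>i\<in>{i\<in>{..t}. lab i = j} - {i}. v i)) - real (\<Sum>i\<in>{i\<in>{..t}. lab i = q}. v i)\<bar> \<le> real D"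
        using bound[OF u] unfolding sumj[of u] rest sumq .
      show "\<bar>real (v i + (\<Sum>i\<in>{i\<in>{..t}. lab i = j} - {i}. v i)) - real (\<Sum>i\<in>{i\<in>{..t}. lab i = q}. v i)\<bar> \<le> real D"
        using bound[OF v] unfolding sumj[of v] .
    qed
    then have "real (u i) \<le> real (v i) + 2 * real D" unfolding of_nat_add by linarith
    then have "real (u i) \<le> real (v i + 2 * D)" by simp
    then show "u i \<le> v i + 2 * D" unfolding of_nat_le_iff .
  qed simp
  then show "card ?W \<le> (4 * D + 1) ^ (q - 1) * B ^ (t + 1 - (q - 1))" by (simp add: cJ)
qed

text \<open>
  Here the gaps are rounded and not the positions of the cuts, so that the volume equations remain linear with coefficients
  0 and 1 in the rounded parameters; a position is a sum of at most \<open>t + 1\<close> gaps, which accounts for the error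
  \<open>(t + 1) / L\<close>. Of the \<open>t + 2\<close> parameters (corner and gaps) \<open>q - 1\<close> are determined up to boundedly many values.
  A part without any gap is empty and cannot have the average volume.
\<close>

lemma covering_by_rounding_gaps:
  fixes n k q t m :: nat
  assumes d: "CARD('d::finite) = 1" and n: "n \<ge> 1" and q: "q \<ge> 1"
    and m: "m + (q - 1) \<ge> t + 3" and \<epsilon>: "\<epsilon> > 0"
  shows "\<exists>L0. \<forall>L\<ge>L0. \<forall>(\<iota> :: nat \<Rightarrow> 'd) p. \<exists>U. finite U \<and> real (card U) \<le> \<epsilon> * real L ^ m \<and>
    covers_balanced n q t (real k / real L) (real (t + 1) / real L) \<iota> p U"
proof -
  define D where "D = k + (t + 1)"
  \<comment> \<open>One factor for the corner and one for each gap that is not determined by the others.\<close>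
  define w where "w = 1 + (t + 1 - (q - 1))"
  define K where "K = real ((4 * D + 1) ^ (q - 1)) * (3 * real n) ^ w"
  obtain L0 where L0: "K / \<epsilon> + 2 * real k * real q * real n + 2 \<le> real L0" using real_arch_simple by blast
  show ?thesis
  proof (intro exI[of _ L0] allI impI)
    fix L and \<iota> :: "nat \<Rightarrow> 'd" and p :: "nat set \<Rightarrow> nat"
    assume "L \<ge> L0"
    then have "K / \<epsilon> + 2 * real k * real q * real n + 2 \<le> real L" using L0 by simp
    moreover have "0 \<le> K / \<epsilon>" "0 \<le> 2 * real k * real q * real n" using \<epsilon> by (simp_all add: K_def)
    ultimately have L: "K / \<epsilon> \<le> real L" "2 * real k * real q * real n < real L" "1 \<le> real L" by linarith+
    then have Lpos: "real L > 0" by simp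
    define lab where "lab i = p {..<i}" for i :: nat
    define B where "B = 2 * n * L + 1"
    define W where "W = {\<omega> \<in> {..t} \<rightarrow>\<^sub>E {..<B}. \<forall>j\<in>{1..q}.
      \<bar>real (\<Sum>i\<in>{i\<in>{..t}. lab i = j}. \<omega> i) - real (\<Sum>i\<in>{i\<in>{..t}. lab i = q}. \<omega> i)\<bar> \<le> real D}"
    define A where "A = {- int (n * L)..int (n * L)}"
    define point where "point = (\<lambda>(\<alpha>, \<omega>). (\<chi> i :: 'd. real_of_int \<alpha> / real L,
      real (\<Sum>i<Suc t. \<omega> i) / real L, \<lambda>l. real (\<Sum>i<Suc l. \<omega> i) / real L))"
    have finW: "finite W" by (rule finite_subset[of _ "{..t} \<rightarrow>\<^sub>E {..<B}"]) (auto simp: W_def intro!: finite_PiE)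
    have finA: "finite A" by (simp add: A_def)
    have "card {- int M..int M} = 2 * M + 1" for M :: nat
      unfolding card_atLeastAtMost_int by linarith
    from this[of "n * L"] have cardA: "card A = B" by (simp add: A_def B_def mult.assoc)
    have balanced_labels: "{1..q} \<subseteq> lab ` {..t}"
      if valid: "valid_cuts n q t \<iota> p a s b"
        and bal: "\<forall>j\<in>{1..q}. \<bar>measure lebesgue (share t \<iota> p a s b j) - measure lebesgue (share t \<iota> p a s b q)\<bar> \<le> real k / real L"
      for a s b
    proof (rule ccontr)
      assume "\<not> ?thesis"
      then obtain j where j: "j \<in> {1..q}" "j \<notin> lab ` {..t}" by blast
      have s: "1 / real n \<le> s" using valid by (simp add: valid_cuts_def)
      then have s0: "0 \<le> s" by (rule order_trans[rotated]) simp
      have "{i \<in> {..t}. p {..<i} = j} = {}" using j(2) by (auto simp: lab_def)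
      then have "measure lebesgue (share t \<iota> p a s b j) = 0"
        unfolding measure_share_eq_sum_gaps[OF d valid] by (simp only: sum.empty)
      moreover have "\<bar>measure lebesgue (share t \<iota> p a s b j) - s ^ CARD('d) / real q\<bar> \<le> 2 * (real k / real L)"
        using valid by (intro balanced_share_near_average[OF _ s0 bal j(1)]) (simp add: valid_cuts_def)
      ultimately have "\<bar>s / real q\<bar> \<le> 2 * (real k / real L)" by (simp add: d)
      moreover have "1 / real n / real q \<le> s / real q" using s by (intro divide_right_mono) auto
      ultimately have "1 / real n / real q \<le> 2 * (real k / real L)" by linarith
      then have "real L \<le> 2 * real k * real q * real n" using n q Lpos by (simp add: field_simps)
      then show False using L(2) by simp
    qed
    show "\<exists>U. finite U \<and> real (card U) \<le> \<epsilon> * real L ^ m \<and>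
        covers_balanced n q t (real k / real L) (real (t + 1) / real L) \<iota> p U"
    proof (cases "{1..q} \<subseteq> lab ` {..t}")
      case False
      then have "covers_balanced n q t (real k / real L) (real (t + 1) / real L) \<iota> p {}"
        using balanced_labels unfolding covers_balanced_def by blast
      then show ?thesis using \<epsilon> by (intro exI[of _ "{}"]) simp
    next
      case True
      have qt: "q \<le> t + 1" by (rule card_balanced_gaps(2)[OF True q])
      have "real (card (point ` (A \<times> W))) \<le> \<epsilon> * real L ^ m"
      proof -
        have "card (point ` (A \<times> W)) \<le> card (A \<times> W)" using finA finW by (intro card_image_le) simp
        also have "\<dots> = B * card W" by (simp add: card_cartesian_product cardA)
        also have "\<dots> \<le> B * ((4 * D + 1) ^ (q - 1) * B ^ (t + 1 - (q - 1)))"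
          unfolding W_def by (intro mult_left_mono card_balanced_gaps(1)[OF True q]) simp
        also have "\<dots> = (4 * D + 1) ^ (q - 1) * B ^ w" by (simp add: w_def)
        finally have "real (card (point ` (A \<times> W))) \<le> real ((4 * D + 1) ^ (q - 1) * B ^ w)"
          unfolding of_nat_le_iff .
        also have "\<dots> = real ((4 * D + 1) ^ (q - 1)) * real B ^ w" by (simp only: of_nat_mult of_nat_power)
        also have "\<dots> \<le> real ((4 * D + 1) ^ (q - 1)) * (3 * real n * real L) ^ w"
        proof (intro mult_left_mono power_mono)
          have "1 \<le> n * L" using n L(3) by simp
          then have "real 1 \<le> real (n * L)" unfolding of_nat_le_iff .
          then show "real B \<le> 3 * real n * real L" by (simp add: B_def mult.commute)
        qed auto
        also have "\<dots> = K * real L ^ w" by (simp add: K_def power_mult_distrib)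
        also have "\<dots> \<le> (\<epsilon> * real L) * real L ^ w"
          using L(1) \<epsilon> by (intro mult_right_mono) (auto simp: field_simps)
        also have "\<dots> = \<epsilon> * real L ^ (w + 1)" by simp
        also have "\<dots> \<le> \<epsilon> * real L ^ m"
          using m qt q \<epsilon> L(3) by (intro mult_left_mono power_increasing) (auto simp: w_def)
        finally show ?thesis .
      qed
      moreover have "covers_balanced n q t (real k / real L) (real (t + 1) / real L) \<iota> p (point ` (A \<times> W))"
        unfolding covers_balanced_def
      proof (intro allI impI)
        fix a :: "real ^ 'd" and s b
        assume valid: "valid_cuts n q t \<iota> p a s b"
          and bal: "\<forall>j\<in>{1..q}. \<bar>measure lebesgue (share t \<iota> p a s b j) - measure lebesgue (share t \<iota> p a s b q)\<bar> \<le> real k / real L"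
        obtain e :: 'd where "UNIV = {e}" using d by (auto simp: card_1_singleton_iff)
        then have e: "a $ i = a $ e" for i by (metis UNIV_I singletonD)
        have box: "- real n \<le> a $ e" "a $ e + s \<le> real n" using valid by (auto simp: valid_cuts_def)
        have "1 / real n \<le> s" using valid by (simp add: valid_cuts_def)
        then have s0: "0 \<le> s" by (rule order_trans[rotated]) simp
        have g0: "0 \<le> gap t s b i" if "i \<le> t" for i using gap_nonneg[OF valid that] .
        define \<alpha> where "\<alpha> = \<lfloor>real L * a $ e\<rfloor>"
        define \<omega> where "\<omega> = (\<lambda>i\<in>{..t}. nat \<lfloor>real L * gap t s b i\<rfloor>)"
        have \<omega>: "real (\<omega> i) \<le> real L * gap t s b i" "real L * gap t s b i \<le> real (\<omega> i) + 1" if "i \<le> t" for i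
        proof -
          have "0 \<le> real L * gap t s b i" using g0[OF that] by simp
          then have "real (\<omega> i) = real_of_int \<lfloor>real L * gap t s b i\<rfloor>"
            using that by (simp add: \<omega>_def)
          then show "real (\<omega> i) \<le> real L * gap t s b i" "real L * gap t s b i \<le> real (\<omega> i) + 1" by linarith+
        qed
        have sums: "real (\<Sum>i\<in>I. \<omega> i) \<le> real L * (\<Sum>i\<in>I. gap t s b i)"
          "real L * (\<Sum>i\<in>I. gap t s b i) \<le> real (\<Sum>i\<in>I. \<omega> i) + real (t + 1)" if "I \<subseteq> {..t}" for I
        proof -
          have i: "i \<le> t" if "i \<in> I" for i using that \<open>I \<subseteq> {..t}\<close> by auto
          show "real (\<Sum>i\<in>I. \<omega> i) \<le> real L * (\<Sum>i\<in>I. gap t s b i)"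
            unfolding of_nat_sum sum_distrib_left using \<omega>(1) i by (intro sum_mono) auto
          have "real L * (\<Sum>i\<in>I. gap t s b i) \<le> (\<Sum>i\<in>I. real (\<omega> i) + 1)"
            unfolding sum_distrib_left using \<omega>(2) i by (intro sum_mono) auto
          also have "\<dots> = real (\<Sum>i\<in>I. \<omega> i) + real (card I)" by (simp add: sum.distrib)
          also have "card I \<le> t + 1" using card_mono[OF _ that] by simp
          finally show "real L * (\<Sum>i\<in>I. gap t s b i) \<le> real (\<Sum>i\<in>I. \<omega> i) + real (t + 1)" by simp
        qed
        have near: "\<bar>cut_pos t s b (Suc l) - real (\<Sum>i<Suc l. \<omega> i) / real L\<bar> \<le> real (t + 1) / real L" if l: "l \<le> t" for l
        proof -
          have "{..<Suc l} \<subseteq> {..t}" using l by auto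
          from sums[OF this]
          have "\<bar>real L * cut_pos t s b (Suc l) - real (\<Sum>i<Suc l. \<omega> i)\<bar> \<le> real (t + 1)"
            unfolding sum_gap by linarith
          then have "\<bar>real L * cut_pos t s b (Suc l) - real (\<Sum>i<Suc l. \<omega> i)\<bar> / real L \<le> real (t + 1) / real L"
            by (intro divide_right_mono) auto
          moreover have "cut_pos t s b (Suc l) - real (\<Sum>i<Suc l. \<omega> i) / real L
              = (real L * cut_pos t s b (Suc l) - real (\<Sum>i<Suc l. \<omega> i)) / real L"
            using Lpos by (simp add: diff_divide_distrib)
          ultimately show ?thesis using Lpos by (simp only: abs_divide abs_of_nat)
        qed
        have neara: "\<bar>a $ i - real_of_int \<alpha> / real L\<bar> \<le> real (t + 1) / real L" for i
        proof -
          have "\<bar>real L * a $ e - real_of_int \<alpha>\<bar> \<le> real (t + 1)" unfolding \<alpha>_def by linarith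
          then have "\<bar>real L * a $ e - real_of_int \<alpha>\<bar> / real L \<le> real (t + 1) / real L"
            by (intro divide_right_mono) auto
          moreover have "a $ i - real_of_int \<alpha> / real L = (real L * a $ e - real_of_int \<alpha>) / real L"
            using Lpos e[of i] by (simp add: diff_divide_distrib)
          ultimately show ?thesis using Lpos by (simp only: abs_divide abs_of_nat)
        qed
        have pos_t: "cut_pos t s b (Suc t) = s" by (simp add: cut_pos_def)
        have pos_l: "cut_pos t s b (Suc l) = b l" if "l < t" for l using that by (simp add: cut_pos_def)
        obtain a' s' b' where pt: "point (\<alpha>, \<omega>) = (a', s', b')" by (cases "point (\<alpha>, \<omega>)") auto
        then have pt': "a' = (\<chi> i. real_of_int \<alpha> / real L)" "s' = real (\<Sum>i<Suc t. \<omega> i) / real L"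
          "b' = (\<lambda>l. real (\<Sum>i<Suc l. \<omega> i) / real L)"
          unfolding point_def by auto
        have close: "close_cuts t (real (t + 1) / real L) a s b a' s' b'"
          unfolding close_cuts_def
        proof (intro conjI allI impI)
          show "\<bar>a $ i - a' $ i\<bar> \<le> real (t + 1) / real L" for i using neara[of i] by (simp add: pt')
          show "\<bar>s - s'\<bar> \<le> real (t + 1) / real L" using near[of t] unfolding pt' pos_t by simp
          show "\<bar>b l - b' l\<bar> \<le> real (t + 1) / real L" if "l < t" for l
            using near[of l] that unfolding pt' pos_l[OF that] by simp
        qed
        have "\<alpha> \<in> A"
        proof -
          have "real L * (- real n) \<le> real L * a $ e" using box(1) by (rule mult_left_mono) simp
          moreover have "real L * a $ e \<le> real L * real n" using box(2) s0 by (intro mult_left_mono) auto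
          ultimately have "real_of_int (- int (n * L)) \<le> real L * a $ e" "real L * a $ e < real_of_int (int (n * L)) + 1"
            by (simp_all add: mult.commute)
          then have "- int (n * L) \<le> \<alpha> \<and> \<alpha> \<le> int (n * L)"
            unfolding \<alpha>_def by (simp only: le_floor_iff floor_le_iff)
          then show ?thesis by (simp add: A_def)
        qed
        moreover have "\<omega> \<in> W"
        proof -
          have "\<omega> i < B" if i: "i \<le> t" for i
          proof -
            have "gap t s b i \<le> (\<Sum>i<Suc t. gap t s b i)"
              using i g0 by (intro member_le_sum) auto
            then have "gap t s b i \<le> s" unfolding sum_gap pos_t .
            also have "s \<le> 2 * real n" using box by linarith
            finally have "real L * gap t s b i \<le> real L * (2 * real n)" by (intro mult_left_mono) auto
            then have "real (\<omega> i) \<le> real (2 * n * L)" using \<omega>(1)[OF i] by (simp add: mult_ac)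
            then show ?thesis unfolding of_nat_le_iff B_def by simp
          qed
          then have "\<omega> \<in> {..t} \<rightarrow>\<^sub>E {..<B}" by (auto simp: \<omega>_def)
          moreover have "\<bar>real (\<Sum>i\<in>{i\<in>{..t}. lab i = j}. \<omega> i) - real (\<Sum>i\<in>{i\<in>{..t}. lab i = q}. \<omega> i)\<bar> \<le> real D"
            if j: "j \<in> {1..q}" for j
          proof -
            let ?G = "\<lambda>j. \<Sum>i\<in>{i\<in>{..t}. lab i = j}. gap t s b i"
            have "\<bar>?G j - ?G q\<bar> \<le> real k / real L"
              using bspec[OF bal j] unfolding measure_share_eq_sum_gaps[OF d valid] lab_def .
            then have "real L * \<bar>?G j - ?G q\<bar> \<le> real L * (real k / real L)" by (rule mult_left_mono) simp
            moreover have "real L * \<bar>?G j - ?G q\<bar> = \<bar>real L * ?G j - real L * ?G q\<bar>"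
              using Lpos by (simp add: abs_mult flip: right_diff_distrib)
            ultimately have "\<bar>real L * ?G j - real L * ?G q\<bar> \<le> real k" using Lpos by simp
            moreover have sub: "{i\<in>{..t}. lab i = j} \<subseteq> {..t}" for j by auto
            ultimately show ?thesis
              using sums[OF sub[of j]] sums[OF sub[of q]] unfolding D_def of_nat_add[of k] by linarith
          qed
          ultimately show ?thesis by (simp add: W_def)
        qed
        ultimately have "(a', s', b') \<in> point ` (A \<times> W)" using pt by (metis SigmaI imageI)
        then show "\<exists>(a', s', b')\<in>point ` (A \<times> W). close_cuts t (real (t + 1) / real L) a s b a' s' b'"
          using close by blast
      qed
      ultimately show ?thesis
        by (intro exI[of _ "point ` (A \<times> W)"] conjI finite_imageI finite_cartesian_product finA finW)
    qed
  qed
qed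

section \<open>Generic colorings are unsplittable\<close>

theorem theorem6p7:
  fixes k t q :: nat
  assumes "k \<ge> 1" and "t \<ge> 1" and "q \<ge> 2"
    and "k * (q - 1) > t + CARD('d::finite) + q - 1 \<or>
         (CARD('d) = 1 \<and> k * (q - 1) > t + 2)"
  shows "(\<exists>f :: real ^ 'd \<Rightarrow> nat. f \<in> unsplittable_colorings k q t) \<and>
         Metric_space.mtopology (coloring_space k) class_dist closure_of
           ((\<lambda>f :: real ^ 'd \<Rightarrow> nat. coloring_equiv k `` {f}) ` unsplittable_colorings k q t)
         = coloring_space k"
proof -
  have q: "q \<ge> 1" using assms(3) by simp
  have m: "(k - 1) * (q - 1) + (q - 1) = k * (q - 1)"
    using assms(1) by (cases k) auto
  have "\<exists>g\<in>robust_colorings k q t n. coloring_dist f g < \<epsilon>"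
    if n: "n \<ge> 1" and f: "f \<in> measurable_colorings k" and \<epsilon>: "\<epsilon> > 0"
    for n and f :: "real ^ 'd \<Rightarrow> nat" and \<epsilon>
  proof (cases "k * (q - 1) > t + CARD('d) + q - 1")
    case True
    then have "(k - 1) * (q - 1) \<ge> t + CARD('d) + 1" using m q by linarith
    from covering_by_rounding[OF n assms(3) this]
    show ?thesis
      by (intro robust_colorings_dense[OF assms(1) q n _ _ f \<epsilon>, of 1]) auto
  next
    case False
    then have d: "CARD('d) = 1" and "(k - 1) * (q - 1) + (q - 1) \<ge> t + 3"
      using assms(4) m by auto
    from covering_by_rounding_gaps[OF d n q this(2)]
    show ?thesis
      by (intro robust_colorings_dense[OF assms(1) q n _ _ f \<epsilon>, of "real (t + 1)"]) auto
  qed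
  then show ?thesis by (rule unsplittable_dense_if_robust_dense[OF assms(1) q])
qed

end
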